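(* For every $n\in\mathbb{Z}_{\ge 0}$ there exists a positive constant $C_{1,n}$, depending only on $n$ (in particular not on the Hilbert space $H$, the operator $A$ or the initial data), such that the following holds. Let $H$ be a real Hilbert space and $A$ a nonnegative selfadjoint operator in $H$ with domain $D(A)$. For every $(u_0,u_1)\in \mathcal{H}=D(A^{1/2})\times H$, the weak solution $u$ of $u''(t)+Au(t)+u'(t)=0$ for $t>0$, $(u,u')(0)=(u_0,u_1)$, satisfies $$\|u(t)-V_n(t)\|^2+t\,E(u-V_n;t)\le C_{1,n}\,t^{-2n}\,\|(u_0,u_1)\|_{\mathcal{H}}^2,\qquad t\ge 1.$$
   Context: $H$ has inner product $\langle\cdot,\cdot\rangle$ and norm $\|\cdot\|$. The energy space is $\mathcal{H}=D(A^{1/2})\times H$ with norm $\|(u_0,u_1)\|_{\mathcal H}^2=\|u_0\|_{D(A^{1/2})}^2+\|u_1\|^2$, where $\|f\|_{D(A^{1/2})}^2=\|f\|^2+\|A^{1/2}f\|^2$. Weak solution: $u\in C^1([0,\infty);H)\cap C([0,\infty);D(A^{1/2}))$ such that $(u(t),u'(t))=e^{t\mathcal L}(u_0,u_1)$ for all $t\ge0$, where $\{e^{t\mathcal L}\}_{t\ge0}$ is the $C_0$-semigroup on $\mathcal H$ generated by $\mathcal L(f,g)=(g,-Af-g)$ with $D(\mathcal L)=D(A)\times D(A^{1/2})$ (a unique weak solution exists). Energy functional: $E(w;t)=\|w'(t)\|^2+\|A^{1/2}w(t)\|^2$. Profiles: $\{e^{-tA}\}_{t\ge0}$ is the $C_0$-semigroup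 on $H$ generated by $-A$; $v_0(t)=e^{-tA}(u_0+u_1)$ and for $\ell\ge1$ $$v_\ell(t)=A^\ell\left(\sum_{j=0}^{\ell}\binom{2\ell}{\ell+j}\frac{(-tA)^j}{j!}e^{-tA}(u_0+u_1)-\sum_{k=0}^{\ell-1}\binom{2\ell-1}{\ell+k}\frac{(-tA)^k}{k!}e^{-tA}u_0\right),\quad t>0.$$ $V_0(t)=0$ and $V_n(t)=\sum_{\ell=0}^{n-1}v_\ell(t)$ for $n\ge1$. *)

theory Defs
  imports "HOL-Analysis.Analysis"
begin

text \<open>
  A (real) Hilbert space is a type of class \<open>{real_inner, complete_space}\<close>. An unbounded operator
  is a pair of a total function \<open>A\<close> and its domain \<open>DA\<close>; values of \<open>A\<close> outside \<open>DA\<close> carry no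
  information.
\<close>

definition linear_operator_on :: "'a::real_vector set \<Rightarrow> ('a \<Rightarrow> 'a) \<Rightarrow> bool" where
  "linear_operator_on D A \<longleftrightarrow>
     subspace D \<and> (\<forall>x\<in>D. \<forall>y\<in>D. A (x + y) = A x + A y) \<and> (\<forall>c. \<forall>x\<in>D. A (c *\<^sub>R x) = c *\<^sub>R A x)"

text \<open>Graph of the Hilbert space adjoint; single-valued when \<open>D\<close> is dense.\<close>

definition adjoint_graph :: "'a::real_inner set \<Rightarrow> ('a \<Rightarrow> 'a) \<Rightarrow> ('a \<times> 'a) set" where
  "adjoint_graph D A = {(y, z). \<forall>x\<in>D. inner (A x) y = inner x z}"

definition selfadjoint_operator :: "'a::real_inner set \<Rightarrow> ('a \<Rightarrow> 'a) \<Rightarrow> bool" where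
  "selfadjoint_operator D A \<longleftrightarrow>
     linear_operator_on D A \<and> closure D = UNIV \<and> adjoint_graph D A = {(x, A x) |x. x \<in> D}"

definition nonneg_selfadjoint :: "'a::real_inner set \<Rightarrow> ('a \<Rightarrow> 'a) \<Rightarrow> bool" where
  "nonneg_selfadjoint D A \<longleftrightarrow> selfadjoint_operator D A \<and> (\<forall>x\<in>D. 0 \<le> inner (A x) x)"

text \<open>\<open>(B, DB)\<close> is the square root \<open>A\<^sup>1\<^sup>/\<^sup>2\<close>: the unique nonnegative selfadjoint operator with
  \<open>B\<^sup>2 = A\<close>, equality of domains included.\<close>

definition is_sqrt_operator ::
    "'a::real_inner set \<Rightarrow> ('a \<Rightarrow> 'a) \<Rightarrow> 'a set \<Rightarrow> ('a \<Rightarrow> 'a) \<Rightarrow> bool" where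
  "is_sqrt_operator DB B DA A \<longleftrightarrow>
     nonneg_selfadjoint DB B \<and> DA = {x \<in> DB. B x \<in> DB} \<and> (\<forall>x\<in>DA. A x = B (B x))"

text \<open>
  \<open>C\<^sub>0\<close>-semigroups on a normed space with carrier \<open>X\<close> and norm \<open>N\<close>. The energy space
  \<open>D(A\<^sup>1\<^sup>/\<^sup>2) \<times> H\<close> is not a type, and its norm is not the norm of the product type, so both are
  parameters. Only \<open>t \<ge> 0\<close> matters.
\<close>

definition C0_semigroup :: "'b::real_vector set \<Rightarrow> ('b \<Rightarrow> real) \<Rightarrow> (real \<Rightarrow> 'b \<Rightarrow> 'b) \<Rightarrow> bool" where
  "C0_semigroup X N S \<longleftrightarrow>
     (\<forall>t\<ge>0. S t ` X \<subseteq> X \<and> linear_operator_on X (S t) \<and> (\<exists>M. \<forall>x\<in>X. N (S t x) \<le> M * N x)) \<and>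
     (\<forall>x\<in>X. S 0 x = x) \<and>
     (\<forall>s\<ge>0. \<forall>t\<ge>0. \<forall>x\<in>X. S (s + t) x = S s (S t x)) \<and>
     (\<forall>x\<in>X. ((\<lambda>t. N (S t x - x)) \<longlongrightarrow> 0) (at_right 0))"

definition generator_graph ::
    "'b::real_vector set \<Rightarrow> ('b \<Rightarrow> real) \<Rightarrow> (real \<Rightarrow> 'b \<Rightarrow> 'b) \<Rightarrow> ('b \<times> 'b) set" where
  "generator_graph X N S =
     {(x, y). x \<in> X \<and> y \<in> X \<and> ((\<lambda>h. N ((1 / h) *\<^sub>R (S h x - x) - y)) \<longlongrightarrow> 0) (at_right 0)}"

definition semigroup_generated_by ::
    "'b::real_vector set \<Rightarrow> ('b \<Rightarrow> real) \<Rightarrow> (real \<Rightarrow> 'b \<Rightarrow> 'b) \<Rightarrow> 'b set \<Rightarrow> ('b \<Rightarrow> 'b) \<Rightarrow> bool" where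
  "semigroup_generated_by X N S D G \<longleftrightarrow>
     C0_semigroup X N S \<and> generator_graph X N S = {(x, G x) |x. x \<in> D}"

text \<open>\<open>T t\<close> is \<open>e\<^sup>-\<^sup>t\<^sup>A\<close>.\<close>

definition heat_semigroup ::
    "'a::real_normed_vector set \<Rightarrow> ('a \<Rightarrow> 'a) \<Rightarrow> (real \<Rightarrow> 'a \<Rightarrow> 'a) \<Rightarrow> bool" where
  "heat_semigroup DA A T \<longleftrightarrow> semigroup_generated_by UNIV norm T DA (\<lambda>x. - A x)"

text \<open>Below, \<open>B\<close> with domain \<open>DB\<close> stands for \<open>A\<^sup>1\<^sup>/\<^sup>2\<close>.\<close>

definition sqrt_graph_norm :: "('a::real_normed_vector \<Rightarrow> 'a) \<Rightarrow> 'a \<Rightarrow> real" where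
  "sqrt_graph_norm B f = sqrt ((norm f)\<^sup>2 + (norm (B f))\<^sup>2)"

definition energy_space :: "'a set \<Rightarrow> ('a \<times> 'a) set" where
  "energy_space DB = DB \<times> UNIV"

definition energy_space_norm :: "('a::real_normed_vector \<Rightarrow> 'a) \<Rightarrow> 'a \<times> 'a \<Rightarrow> real" where
  "energy_space_norm B = (\<lambda>(f, g). sqrt ((sqrt_graph_norm B f)\<^sup>2 + (norm g)\<^sup>2))"

definition wave_semigroup ::
    "'a::real_normed_vector set \<Rightarrow> ('a \<Rightarrow> 'a) \<Rightarrow> 'a set \<Rightarrow> ('a \<Rightarrow> 'a) \<Rightarrow>
     (real \<Rightarrow> 'a \<times> 'a \<Rightarrow> 'a \<times> 'a) \<Rightarrow> bool" where
  "wave_semigroup DA A DB B S \<longleftrightarrow>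
     semigroup_generated_by (energy_space DB) (energy_space_norm B) S
       (DA \<times> DB) (\<lambda>(f, g). (g, - A f - g))"

text \<open>The first two lines say \<open>u \<in> C\<^sup>1([0,\<infinity>); H)\<close> with derivative \<open>u'\<close> (one-sided at \<open>0\<close>), the next two
  \<open>u \<in> C([0,\<infinity>); D(A\<^sup>1\<^sup>/\<^sup>2))\<close>.\<close>

definition weak_solution ::
    "'a::real_normed_vector set \<Rightarrow> ('a \<Rightarrow> 'a) \<Rightarrow> 'a set \<Rightarrow> ('a \<Rightarrow> 'a) \<Rightarrow> 'a \<Rightarrow> 'a \<Rightarrow>
     (real \<Rightarrow> 'a) \<Rightarrow> bool" where
  "weak_solution DA A DB B u0 u1 u \<longleftrightarrow> (\<exists>u' S.
     (\<forall>t\<ge>0. (u has_vector_derivative u' t) (at t within {0..})) \<and>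
     continuous_on {0..} u' \<and>
     (\<forall>t\<ge>0. u t \<in> DB) \<and>
     (\<forall>t\<ge>0. ((\<lambda>s. sqrt_graph_norm B (u s - u t)) \<longlongrightarrow> 0) (at t within {0..})) \<and>
     wave_semigroup DA A DB B S \<and>
     (\<forall>t\<ge>0. (u t, u' t) = S t (u0, u1)))"

definition energy :: "('a::real_normed_vector \<Rightarrow> 'a) \<Rightarrow> (real \<Rightarrow> 'a) \<Rightarrow> real \<Rightarrow> real" where
  "energy B w t = (norm (vector_derivative w (at t)))\<^sup>2 + (norm (B (w t)))\<^sup>2"

definition profile ::
    "('a::real_vector \<Rightarrow> 'a) \<Rightarrow> (real \<Rightarrow> 'a \<Rightarrow> 'a) \<Rightarrow> 'a \<Rightarrow> 'a \<Rightarrow> nat \<Rightarrow> real \<Rightarrow> 'a" where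
  "profile A T u0 u1 l t =
     (if l = 0 then T t (u0 + u1)
      else (A ^^ l)
        ((\<Sum>j=0..l. (real ((2 * l) choose (l + j)) / fact j) *\<^sub>R
            ((\<lambda>x. - (t *\<^sub>R A x)) ^^ j) (T t (u0 + u1))) -
         (\<Sum>k=0..l-1. (real ((2 * l - 1) choose (l + k)) / fact k) *\<^sub>R
            ((\<lambda>x. - (t *\<^sub>R A x)) ^^ k) (T t u0))))"

definition profile_sum ::
    "('a::real_vector \<Rightarrow> 'a) \<Rightarrow> (real \<Rightarrow> 'a \<Rightarrow> 'a) \<Rightarrow> 'a \<Rightarrow> 'a \<Rightarrow> nat \<Rightarrow> real \<Rightarrow> 'a" where
  "profile_sum A T u0 u1 n t = (\<Sum>l<n. profile A T u0 u1 l t)"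

text \<open>
  The estimate with constant \<open>C\<close>, for all operators and all data on the Hilbert space \<open>'a\<close>. For \<open>t \<ge> 1\<close>
  it includes that \<open>u - V\<^sub>n\<close> is differentiable at \<open>t\<close> and \<open>D(A\<^sup>1\<^sup>/\<^sup>2)\<close>-valued, without which the energy
  would be meaningless.
\<close>

definition admissible_constant ::
    "'a::{real_inner,complete_space} itself \<Rightarrow> nat \<Rightarrow> real \<Rightarrow> bool" where
  "admissible_constant _ n C \<longleftrightarrow>
     (\<forall>DA (A :: 'a \<Rightarrow> 'a) DB B T u0 u1 u.
        nonneg_selfadjoint DA A \<longrightarrow> is_sqrt_operator DB B DA A \<longrightarrow> heat_semigroup DA A T \<longrightarrow>
        (u0, u1) \<in> energy_space DB \<longrightarrow> weak_solution DA A DB B u0 u1 u \<longrightarrow>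
        (\<forall>t\<ge>1.
           let w = (\<lambda>s. u s - profile_sum A T u0 u1 n s) in
             w differentiable (at t) \<and> w t \<in> DB \<and>
             (norm (w t))\<^sup>2 + t * energy B w t
               \<le> C * t powi (- 2 * int n) * (energy_space_norm B (u0, u1))\<^sup>2))"

text \<open>
  HOL cannot quantify over the Hilbert space, which is a type, inside a formula, so ``there is a
  constant that serves all Hilbert spaces'' is stated by naming the constant with a closed term that
  mentions no type variable: any positive constant that is admissible for the Hilbert space
  \<open>\<real>\<close>. By the spectral theorem the admissible constants are the same for every nonzero \<open>H\<close>. A
  constant obtained by \<open>\<exists>C\<close> inside a statement about \<open>'a\<close> could depend on \<open>'a\<close>.
\<close>

definition C1 :: "nat \<Rightarrow> real" where
  "C1 n = (SOME C. 0 < C \<and> admissible_constant TYPE(real) n C)"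

end

theory Submission
  imports Defs "HOL-Computational_Algebra.Polynomial"
begin

text \<open>
  With a number \<open>\<lambda> \<ge> 0\<close> in place of \<open>A\<close>, the equation is the damped oscillator
  \<open>u'' + u' + \<lambda> u = 0\<close>, whose solution is \<open>p u\<^sub>0 + q u\<^sub>1\<close> for two explicit functions of \<open>(t, \<lambda>)\<close>, and
  the profiles are explicit functions too. The theorem rests on the estimate for this scalar problem
  and on its transfer to operators. The constant \<open>C1 n\<close> is some constant that works on the Hilbert
  space \<open>\<real>\<close>, so the transfer has to work in both directions without any loss in the constant.

  The scalar estimate (\<open>exists_scalar_estimate\<close>). For \<open>\<lambda> < 1/4\<close> put \<open>\<sigma> = sqrt (1 - 4 \<lambda>)\<close> and
  \<open>z = (1 - \<sigma>) / (1 + \<sigma>)\<close>. The slow characteristic root is \<open>-\<lambda> (1 + z)\<close>, so the slow part of \<open>q\<close> is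
  \<open>exp (- t \<lambda>) exp (- z y) / \<sigma>\<close> with \<open>y = t \<lambda>\<close>. Expanding the second factor in powers of \<open>\<lambda>\<close>, with \<open>y\<close>
  held fixed, produces the profiles, because \<open>z\<^sup>j / \<sigma>\<close> is the generating function of the binomial
  coefficients \<open>2 m choose (m + j)\<close> (\<open>shifted_binomial_series\<close>). These coefficients are nonnegative;
  hence for \<open>\<lambda> \<le> 3/16\<close> the tail of the series from order \<open>n\<close> on is at most \<open>(16 \<lambda> / 3)\<^sup>n\<close> times the sum of the
  absolute values at \<open>\<lambda> = 3/16\<close>, which is a multiple of \<open>exp (y / 3)\<close> as \<open>z = 1/3\<close> there
  (\<open>profile_poly_tail\<close>). After multiplication by \<open>exp (- y)\<close> what remains is
  \<open>\<lambda>\<^sup>n exp (- 2 y / 3) = t\<^sup>-\<^sup>n y\<^sup>n exp (- 2 y / 3)\<close>, which is of order \<open>t\<^sup>-\<^sup>n\<close> uniformly in \<open>\<lambda>\<close>. Each time derivative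
  brings another factor \<open>\<lambda>\<close>, that is, another \<open>1 / t\<close>. The fast root and the frequencies \<open>\<lambda> \<ge> 3/16\<close> contribute
  exponentially small terms.

  The transfer. For fixed \<open>t\<close> the scalar estimate says that a symmetric \<open>2 \<times> 2\<close> matrix of functions of \<open>\<lambda>\<close>
  is positive semidefinite at every \<open>\<lambda> \<ge> 0\<close>. The resolvent \<open>R = (1 + A)\<^sup>-\<^sup>1\<close> is a positive contraction. A
  polynomial that is nonnegative on \<open>[0, 1]\<close> is, up to a small error, a nonnegative combination of the
  polynomials \<open>X\<^sup>k (1 - X)\<^sup>m\<close>, and so takes \<open>R\<close> to a nonnegative operator (\<open>opoly_nonneg\<close>). This gives a positive
  multiplicative calculus \<open>h \<mapsto> h(A)\<close> for continuous \<open>h\<close> that vanish at infinity, and completing the square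
  inside the calculus turns a positive semidefinite matrix of functions into a nonnegative quadratic
  form on pairs of vectors (\<open>Phi_form_nonneg\<close>). The heat semigroup is \<open>exp (- t \<lambda>)\<close> applied to \<open>A\<close>
  (\<open>T_eq_fc\<close>), and after smoothing with \<open>exp (- e A)\<close> the weak solution is \<open>p u\<^sub>0 + q u\<^sub>1\<close> applied to \<open>A\<close>
  (\<open>wave_eq_fc\<close>). Hence the smoothed estimate holds with the same constant, and \<open>e \<rightarrow> 0\<close> gives the estimate on
  every Hilbert space (\<open>scalar_estimate_transfers\<close>). Conversely, multiplication by \<open>\<lambda>\<close> is an operator on the
  Hilbert space \<open>\<real>\<close>, so a constant that is admissible there satisfies the scalar estimate for every \<open>\<lambda>\<close>
  (\<open>scalar_estimate_if_admissible_constant\<close>).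
\<close>

section \<open>Nonnegative selfadjoint operators and their resolvents\<close>

text \<open>
  The parallelogram identity: two points of \<open>M\<close> that are both nearly closest to \<open>x\<close> must be close to each
  other, since otherwise their midpoint would be closer to \<open>x\<close> than the distance to \<open>M\<close>.
\<close>

lemma nearest_point_sequence_Cauchy:
  fixes M :: "'a::real_inner set"
  assumes M: "subspace M" and m: "\<And>n. m n \<in> M"
    and near: "\<And>n. dist x (m n) < infdist x M + 1 / real (Suc n)"
  shows "Cauchy m"
proof (rule metric_CauchyI)
  fix e :: real assume e: "e > 0"
  define d where "d = infdist x M"
  have d0: "d \<ge> 0" by (simp add: d_def infdist_nonneg)
  have "(\<lambda>n. 4 * ((d + 1 / real (Suc n))\<^sup>2 - d\<^sup>2)) \<longlonglongrightarrow> 4 * ((d + 0)\<^sup>2 - d\<^sup>2)"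
    by (intro tendsto_intros LIMSEQ_Suc[OF lim_1_over_n])
  then have "(\<lambda>n. 4 * ((d + 1 / real (Suc n))\<^sup>2 - d\<^sup>2)) \<longlonglongrightarrow> 0" by simp
  then have "\<forall>\<^sub>F n in sequentially. 4 * ((d + 1 / real (Suc n))\<^sup>2 - d\<^sup>2) < e\<^sup>2"
    by (rule order_tendstoD) (use e in simp)
  then obtain N where N: "4 * ((d + 1 / real (Suc N))\<^sup>2 - d\<^sup>2) < e\<^sup>2"
    by (auto simp: eventually_sequentially)
  show "\<exists>N. \<forall>i\<ge>N. \<forall>k\<ge>N. dist (m i) (m k) < e"
  proof (intro exI allI impI)
    fix i k assume ik: "N \<le> i" "N \<le> k"
    have bd: "(norm (x - m j))\<^sup>2 \<le> (d + 1 / real (Suc N))\<^sup>2" if "N \<le> j" for j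
    proof (rule power_mono)
      have "1 / real (Suc j) \<le> 1 / real (Suc N)" using that by (simp add: frac_le)
      then show "norm (x - m j) \<le> d + 1 / real (Suc N)"
        using near[of j] by (simp add: d_def dist_norm)
    qed simp
    have mid: "(1/2) *\<^sub>R (m i + m k) \<in> M"
      using M m by (simp add: subspace_def)
    have "d \<le> norm (x - (1/2) *\<^sub>R (m i + m k))"
      using infdist_le[OF mid, of x] by (simp add: d_def dist_norm)
    then have "d\<^sup>2 \<le> (norm (x - (1/2) *\<^sub>R (m i + m k)))\<^sup>2"
      using d0 by (rule power_mono)
    moreover have "(norm (m i - m k))\<^sup>2 = 2 * (norm (x - m i))\<^sup>2 + 2 * (norm (x - m k))\<^sup>2
        - 4 * (norm (x - (1/2) *\<^sub>R (m i + m k)))\<^sup>2"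
      unfolding power2_norm_eq_inner
      by (simp add: inner_diff_left inner_diff_right inner_add_left inner_add_right
          inner_commute algebra_simps)
    ultimately have "(norm (m i - m k))\<^sup>2 \<le> 4 * ((d + 1 / real (Suc N))\<^sup>2 - d\<^sup>2)"
      using bd[OF ik(1)] bd[OF ik(2)] unfolding right_diff_distrib by argo
    then have "(norm (m i - m k))\<^sup>2 < e\<^sup>2" using N by (rule order_le_less_trans)
    then show "dist (m i) (m k) < e"
      using e by (simp add: dist_norm power_less_imp_less_base)
  qed
qed

text \<open>
  The difference between a point outside \<open>M\<close> and its nearest point in \<open>M\<close> is orthogonal to \<open>M\<close>; completeness
  supplies the nearest point.
\<close>

lemma closed_subspace_orthogonal_vector:
  fixes M :: "'a::{real_inner,complete_space} set"
  assumes M: "subspace M" and cl: "closed M" and ne: "M \<noteq> UNIV"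
  obtains y where "y \<noteq> 0" "\<And>v. v \<in> M \<Longrightarrow> inner v y = 0"
proof -
  obtain x where x: "x \<notin> M" using ne by blast
  define d where "d = infdist x M"
  have M0: "M \<noteq> {}" using M subspace_0 by blast
  have "\<exists>a\<in>M. dist x a < d + 1 / real (Suc n)" for n
  proof (rule ccontr)
    assume "\<not> ?thesis"
    then have "d + 1 / real (Suc n) \<le> (INF a\<in>M. dist x a)"
      using M0 by (intro cINF_greatest) auto
    then show False using M0 by (simp add: d_def infdist_notempty)
  qed
  then obtain m where m: "\<And>n. m n \<in> M" "\<And>n. dist x (m n) < d + 1 / real (Suc n)" by metis
  have "Cauchy m" using nearest_point_sequence_Cauchy[OF M] m unfolding d_def by blast
  then obtain c where c: "m \<longlonglongrightarrow> c" using Cauchy_convergent_iff convergent_def by blast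
  have cM: "c \<in> M" using cl c m(1) closed_sequentially by blast
  have "norm (x - c) \<le> d"
  proof (rule LIMSEQ_le)
    show "(\<lambda>n. dist x (m n)) \<longlonglongrightarrow> norm (x - c)"
      unfolding dist_norm by (intro tendsto_intros c)
    have "(\<lambda>n. d + 1 / real (Suc n)) \<longlonglongrightarrow> d + 0"
      by (intro tendsto_intros LIMSEQ_Suc[OF lim_1_over_n])
    then show "(\<lambda>n. d + 1 / real (Suc n)) \<longlonglongrightarrow> d" by simp
    show "\<exists>N. \<forall>n\<ge>N. dist x (m n) \<le> d + 1 / real (Suc n)" using m(2) by (intro exI[of _ 0]) (auto intro: less_imp_le)
  qed
  then have min: "norm (x - c) \<le> norm (x - a)" if "a \<in> M" for a
    using infdist_le[OF that, of x] by (simp add: d_def dist_norm)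
  have "inner v (x - c) = 0" if v: "v \<in> M" for v
  proof (rule ccontr)
    assume n0: "inner v (x - c) \<noteq> 0"
    define b where "b = inner v (x - c)"
    have vv: "inner v v > 0" using n0 by auto
    define s where "s = b / inner v v"
    have "c + s *\<^sub>R v \<in> M" using M cM v by (simp add: subspace_def)
    then have "(norm (x - c))\<^sup>2 \<le> (norm (x - (c + s *\<^sub>R v)))\<^sup>2"
      using min by (simp add: power_mono)
    also have "\<dots> = (norm (x - c))\<^sup>2 - 2 * s * b + s\<^sup>2 * inner v v"
      unfolding power2_norm_eq_inner b_def
      by (simp add: inner_diff_left inner_diff_right inner_add_left inner_add_right
          inner_commute algebra_simps power2_eq_square)
    also have "\<dots> = (norm (x - c))\<^sup>2 - b\<^sup>2 / inner v v"
      using vv unfolding s_def by (simp add: field_simps power2_eq_square)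
    finally have "b\<^sup>2 / inner v v \<le> 0" by simp
    then show False using vv n0 by (simp add: b_def divide_le_0_iff)
  qed
  moreover have "x - c \<noteq> 0" using x cM by auto
  ultimately show thesis using that by blast
qed

locale nonneg_operator =
  fixes DA :: "'a::{real_inner,complete_space} set" and A :: "'a \<Rightarrow> 'a"
  assumes nonneg_selfadjoint: "nonneg_selfadjoint DA A"
begin

lemma subspace_domain: "subspace DA"
  and A_add: "x \<in> DA \<Longrightarrow> y \<in> DA \<Longrightarrow> A (x + y) = A x + A y"
  and A_scaleR: "x \<in> DA \<Longrightarrow> A (c *\<^sub>R x) = c *\<^sub>R A x"
  and A_nonneg: "x \<in> DA \<Longrightarrow> 0 \<le> inner (A x) x"
  using nonneg_selfadjoint
  unfolding nonneg_selfadjoint_def selfadjoint_operator_def linear_operator_on_def by auto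

lemma adjoint_iff: "(x, z) \<in> adjoint_graph DA A \<longleftrightarrow> x \<in> DA \<and> z = A x"
  using nonneg_selfadjoint
  unfolding nonneg_selfadjoint_def selfadjoint_operator_def by auto

lemma A_sym: "x \<in> DA \<Longrightarrow> y \<in> DA \<Longrightarrow> inner (A x) y = inner x (A y)"
  using adjoint_iff[of y "A y"] by (auto simp: adjoint_graph_def)

lemma adjointD:
  assumes "\<And>v. v \<in> DA \<Longrightarrow> inner (A v) x = inner v z"
  shows "x \<in> DA \<and> A x = z"
  using adjoint_iff[of x z] assms by (auto simp: adjoint_graph_def)

lemma closed_graph:
  assumes "\<And>n. x n \<in> DA" "x \<longlonglongrightarrow> a" "(\<lambda>n. A (x n)) \<longlonglongrightarrow> b"
  shows "a \<in> DA \<and> A a = b"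
proof (rule adjointD)
  fix v assume v: "v \<in> DA"
  have "(\<lambda>n. inner (A v) (x n)) \<longlonglongrightarrow> inner (A v) a" by (intro tendsto_intros assms)
  moreover have "(\<lambda>n. inner (A v) (x n)) = (\<lambda>n. inner v (A (x n)))" using A_sym v assms(1) by auto
  moreover have "(\<lambda>n. inner v (A (x n))) \<longlonglongrightarrow> inner v b" by (intro tendsto_intros assms)
  ultimately show "inner (A v) a = inner v b" using LIMSEQ_unique by fastforce
qed

lemma norm_le_norm_shift: "x \<in> DA \<Longrightarrow> norm x \<le> norm (x + A x)"
proof -
  assume x: "x \<in> DA"
  have "(norm x)\<^sup>2 \<le> inner (x + A x) x"
    using A_nonneg[OF x] by (simp add: inner_add_left power2_norm_eq_inner)
  also have "\<dots> \<le> norm (x + A x) * norm x" by (rule norm_cauchy_schwarz)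
  finally show ?thesis
    by (cases "norm x = 0") (simp_all add: power2_eq_square mult_le_cancel_right)
qed

lemma A_diff: "x \<in> DA \<Longrightarrow> y \<in> DA \<Longrightarrow> A (x - y) = A x - A y"
  using A_add[of x "(-1) *\<^sub>R y"] A_scaleR[of y "-1"] subspace_domain
  by (simp add: subspace_def) (metis scaleR_minus1_left)

text \<open>
  The range of \<open>1 + A\<close> is closed because \<open>1 + A\<close> is bounded below and \<open>A\<close> is closed. A vector orthogonal to the
  range lies in the domain of the adjoint, hence of \<open>A\<close>, and satisfies \<open>A y = - y\<close>, which nonnegativity of \<open>A\<close>
  forbids unless \<open>y = 0\<close>.
\<close>

lemma range_shift: "(\<lambda>x. x + A x) ` DA = UNIV"
proof (rule ccontr)
  let ?M = "(\<lambda>x. x + A x) ` DA"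
  assume ne: "?M \<noteq> UNIV"
  have sub: "subspace ?M"
    unfolding subspace_def
  proof (intro conjI ballI allI)
    show "0 \<in> ?M"
      using subspace_0[OF subspace_domain] A_scaleR[of 0 0] by (force intro!: image_eqI[of _ _ 0])
    fix x y assume "x \<in> ?M" "y \<in> ?M"
    then show "x + y \<in> ?M"
      using A_add subspace_add[OF subspace_domain]
      by (force simp: algebra_simps intro!: image_eqI[where x="_ + _"])
  next
    fix c x assume "x \<in> ?M"
    then show "c *\<^sub>R x \<in> ?M"
      using A_scaleR subspace_scale[OF subspace_domain]
      by (auto simp: scaleR_add_right intro!: image_eqI[where x="c *\<^sub>R _"])
  qed
  have "closed ?M"
  proof (subst closed_sequential_limits, intro allI impI, elim conjE)
    fix y l assume y: "\<forall>n. y n \<in> ?M" and l: "y \<longlonglongrightarrow> l"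
    then obtain x where x: "\<And>n. x n \<in> DA" "\<And>n. y n = x n + A (x n)" unfolding image_iff by metis
    have "dist (x i) (x k) \<le> dist (y i) (y k)" for i k
      using norm_le_norm_shift[of "x i - x k"] A_diff[OF x(1) x(1), of i k] x
        subspace_diff[OF subspace_domain] by (simp add: dist_norm algebra_simps)
    moreover have "Cauchy y" using l by (rule LIMSEQ_imp_Cauchy)
    ultimately have "Cauchy x" unfolding Cauchy_def by (meson order_le_less_trans)
    then obtain a where a: "x \<longlonglongrightarrow> a" using Cauchy_convergent_iff convergent_def by blast
    have "(\<lambda>n. A (x n)) = (\<lambda>n. y n - x n)" using x by auto
    then have "(\<lambda>n. A (x n)) \<longlonglongrightarrow> l - a" using l a by (simp add: tendsto_diff)
    from closed_graph[OF x(1) a this] show "l \<in> ?M" by (auto intro!: image_eqI[of _ _ a])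
  qed
  then obtain y where y: "y \<noteq> 0" "\<And>v. v \<in> ?M \<Longrightarrow> inner v y = 0"
    using closed_subspace_orthogonal_vector[OF sub _ ne] by blast
  have "y \<in> DA \<and> A y = - y"
  proof (rule adjointD)
    fix v assume "v \<in> DA"
    then have "inner (v + A v) y = 0" using y by blast
    then show "inner (A v) y = inner v (- y)" by (simp add: inner_add_left)
  qed
  then have "inner y y \<le> 0" using A_nonneg[of y] by auto
  then show False using y(1) inner_gt_zero_iff[of y] by linarith
qed

text \<open>
  The resolvent \<open>(1 + A)\<^sup>-\<^sup>1\<close>.
\<close>

definition R :: "'a \<Rightarrow> 'a" where "R x = (SOME y. y \<in> DA \<and> y + A y = x)"

lemma R_domain: "R x \<in> DA" and R_shift: "R x + A (R x) = x"
proof -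
  have "\<exists>y. y \<in> DA \<and> y + A y = x" using range_shift by (metis UNIV_I imageE)
  then have "R x \<in> DA \<and> R x + A (R x) = x" unfolding R_def by (rule someI_ex)
  then show "R x \<in> DA" "R x + A (R x) = x" by auto
qed

lemma A_R: "A (R x) = x - R x"
  using R_shift[of x] by (simp add: algebra_simps)

lemma R_unique: "y \<in> DA \<Longrightarrow> y + A y = x \<Longrightarrow> R x = y"
  using norm_le_norm_shift[of "R x - y"] A_diff[of "R x" y] R_domain[of x] A_R[of x]
    subspace_diff[OF subspace_domain, of "R x" y] by (auto simp: algebra_simps)

lemma linear_R: "linear R"
proof (rule linearI)
  fix x y show "R (x + y) = R x + R y"
    by (rule R_unique) (simp_all add: R_domain A_add A_R subspace_add[OF subspace_domain])
next
  fix c x show "R (c *\<^sub>R x) = c *\<^sub>R R x"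
    by (rule R_unique) (simp_all add: R_domain A_scaleR A_R subspace_scale[OF subspace_domain] algebra_simps)
qed

lemma R_sym: "inner (R x) y = inner x (R y)"
  using A_sym[OF R_domain R_domain, of x y] by (simp add: A_R inner_diff_left inner_diff_right)

lemma R_firm: "(norm (R x))\<^sup>2 \<le> inner (R x) x"
  using A_nonneg[OF R_domain, of x]
  by (simp add: A_R inner_diff_left inner_diff_right power2_norm_eq_inner inner_commute)

end

section \<open>Polynomials of a positive contraction\<close>

text \<open>
  The abstract properties of a resolvent \<open>(1 + A)\<^sup>-\<^sup>1\<close>. The last one is \<open>R\<^sup>2 \<le> R\<close> in the order of symmetric
  operators, which contains both \<open>0 \<le> R\<close> and \<open>R \<le> 1\<close>.
\<close>

locale firm_operator =
  fixes R :: "'a::{real_inner,complete_space} \<Rightarrow> 'a"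
  assumes linear: "linear R"
    and sym: "inner (R x) y = inner x (R y)"
    and firm: "(norm (R x))\<^sup>2 \<le> inner (R x) x"
begin

lemma add: "R (x + y) = R x + R y" and scale: "R (c *\<^sub>R x) = c *\<^sub>R R x"
  and diff: "R (x - y) = R x - R y" and zero: "R 0 = 0" and minus: "R (- x) = - R x"
  using linear by (auto simp: linear_add linear_scale linear_diff linear_0 linear_neg)

definition opoly :: "real poly \<Rightarrow> 'a \<Rightarrow> 'a" where
  "opoly p x = (\<Sum>i\<le>degree p. coeff p i *\<^sub>R (R ^^ i) x)"

lemma opoly_upto: "degree p \<le> n \<Longrightarrow> opoly p x = (\<Sum>i\<le>n. coeff p i *\<^sub>R (R ^^ i) x)"
  unfolding opoly_def by (rule sum.mono_neutral_left) (auto simp: coeff_eq_0)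

lemma opoly_0 [simp]: "opoly 0 x = 0" by (simp add: opoly_def)

lemma opoly_add: "opoly (p + q) x = opoly p x + opoly q x"
proof -
  define n where "n = max (degree p) (degree q)"
  have "degree p \<le> n" "degree q \<le> n" "degree (p + q) \<le> n"
    by (auto simp: n_def intro: degree_add_le)
  then show ?thesis by (simp add: opoly_upto sum.distrib scaleR_left_distrib)
qed

lemma opoly_smult: "opoly (smult c p) x = c *\<^sub>R opoly p x"
  using opoly_upto[of "smult c p" "degree p" x]
  by (simp add: opoly_def scaleR_sum_right degree_smult_le)

lemma opoly_diff: "opoly (p - q) x = opoly p x - opoly q x"
  using opoly_add[of p "smult (-1) q" x] opoly_smult[of "-1" q x] by simp

lemma opoly_sum: "opoly (\<Sum>i\<in>I. f i) x = (\<Sum>i\<in>I. opoly (f i) x)"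
  by (induction I rule: infinite_finite_induct) (auto simp: opoly_add)

lemma opoly_pCons: "opoly (pCons a p) x = a *\<^sub>R x + R (opoly p x)"
proof -
  have "opoly (pCons a p) x = (\<Sum>i\<le>Suc (degree p). coeff (pCons a p) i *\<^sub>R (R ^^ i) x)"
    by (rule opoly_upto) (simp add: degree_pCons_le)
  also have "\<dots> = a *\<^sub>R x + (\<Sum>i\<le>degree p. coeff p i *\<^sub>R R ((R ^^ i) x))"
    unfolding sum.atMost_Suc_shift by simp
  also have "(\<Sum>i\<le>degree p. coeff p i *\<^sub>R R ((R ^^ i) x)) = R (opoly p x)"
    by (simp add: opoly_def linear_sum[OF linear] scale)
  finally show ?thesis .
qed

lemma opoly_vadd: "opoly p (x + y) = opoly p x + opoly p y"
  and opoly_vscale: "opoly p (c *\<^sub>R x) = c *\<^sub>R opoly p x"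
  by (induction p) (auto simp: opoly_pCons add scale algebra_simps)

lemma opoly_mult: "opoly (p * q) x = opoly p (opoly q x)"
  by (induction p) (auto simp: opoly_pCons opoly_add opoly_smult)

lemma opoly_commute:
  assumes C: "linear C" and comm: "\<And>x. C (R x) = R (C x)"
  shows "C (opoly p x) = opoly p (C x)"
  using C by (induction p) (auto simp: opoly_pCons linear_0 linear_add linear_scale comm)

lemma opoly_sym: "inner (opoly p x) y = inner x (opoly p y)"
  by (induction p arbitrary: x y)
    (auto simp: opoly_pCons inner_add_left inner_add_right sym opoly_commute[OF linear, symmetric])

lemma opoly_1: "opoly 1 x = x" by (simp add: one_pCons opoly_pCons zero)

lemma opoly_X: "opoly [:0, 1:] x = R x" by (simp add: opoly_pCons zero)

text \<open>
  Writing \<open>k\<close> and \<open>m\<close> as twice something plus a remainder moves the even parts to the other side of the inner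
  product by symmetry. What is left are the four products of \<open>1\<close>, \<open>R\<close> with \<open>1\<close>, \<open>1 - R\<close>, each nonnegative because
  \<open>R\<^sup>2 \<le> R \<le> 1\<close>.
\<close>

lemma opoly_bernstein_nonneg:
  "0 \<le> inner (opoly ([:0, 1:] ^ k * [:1, -1:] ^ m) x) x"
proof -
  let ?X = "[:0, 1:] :: real poly" and ?Y = "[:1, -1:] :: real poly"
  have base: "0 \<le> inner (opoly (?X ^ a * ?Y ^ b) y) y" if "a < 2" "b < 2" for a b y
  proof -
    have r: "0 \<le> inner (R y) y" using firm[of y] by (smt (verit) zero_le_power2)
    have "(norm (R y))\<^sup>2 \<le> norm (R y) * norm y"
      using firm[of y] norm_cauchy_schwarz[of "R y" y] by linarith
    then have "norm (R y) \<le> norm y"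
      by (cases "norm (R y) = 0") (auto simp: power2_eq_square mult_le_cancel_left)
    then have "inner (R y) y \<le> inner y y"
      using norm_cauchy_schwarz[of "R y" y] mult_right_mono[of "norm (R y)" "norm y" "norm y"]
      by (simp add: dot_square_norm power2_eq_square)
    moreover have "inner (R (R y)) y \<le> inner (R y) y"
      using firm[of y] by (simp add: sym power2_norm_eq_inner inner_commute)
    moreover have "a = 0 \<or> a = 1" "b = 0 \<or> b = 1" using that by auto
    ultimately show ?thesis using r
      by (auto simp: opoly_pCons opoly_mult opoly_1 zero inner_diff_left inner_add_left diff add minus)
  qed
  let ?q = "?X ^ (k div 2) * ?Y ^ (m div 2)" and ?r = "?X ^ (k mod 2) * ?Y ^ (m mod 2)"
  have "?X ^ k * ?Y ^ m = (?X ^ (k div 2 * 2 + k mod 2)) * (?Y ^ (m div 2 * 2 + m mod 2))" by simp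
  also have "\<dots> = ?q * (?r * ?q)"
    unfolding power_add power_mult power2_eq_square by (simp only: ac_simps)
  finally have "inner (opoly (?X ^ k * ?Y ^ m) x) x = inner (opoly ?r (opoly ?q x)) (opoly ?q x)"
    by (simp add: opoly_mult[of ?q] opoly_mult[of ?r ?q] opoly_sym[of ?q])
  then show ?thesis using base[of "k mod 2" "m mod 2"] by simp
qed

end

text \<open>
  The ratio \<open>k (k - 1) \<cdots> (k - j + 1) / (n (n - 1) \<cdots> (n - j + 1))\<close> of falling factorials, which is the coefficient
  of \<open>X\<^sup>j\<close> with respect to the Bernstein basis of degree \<open>n\<close>.
\<close>

primrec falling_ratio :: "nat \<Rightarrow> nat \<Rightarrow> nat \<Rightarrow> real" where
  "falling_ratio n k 0 = 1"
| "falling_ratio n k (Suc j) = falling_ratio n k j * ((real k - real j) / (real n - real j))"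

lemma falling_ratio_eq_0: "k < j \<Longrightarrow> falling_ratio n k j = 0"
  by (induction j) (auto simp: less_Suc_eq)

lemma falling_ratio_binomial:
  assumes "j \<le> k" "k \<le> n"
  shows "real (n choose k) * falling_ratio n k j = real ((n - j) choose (k - j))"
  using assms
proof (induction j)
  case (Suc j)
  have k: "Suc (k - Suc j) = k - j" "Suc (n - Suc j) = n - j" using Suc.prems by auto
  have "(k - j) * ((n - j) choose (k - j)) = (n - j) * ((n - Suc j) choose (k - Suc j))"
    using Suc_times_binomial_eq[of "n - Suc j" "k - Suc j"] by (simp add: k mult.commute)
  then have "(real k - real j) * real ((n - j) choose (k - j))
      = (real n - real j) * real ((n - Suc j) choose (k - Suc j))"
    using Suc.prems by (metis of_nat_diff of_nat_mult Suc_leD le_trans)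
  moreover have "real n - real j > 0" using Suc.prems by simp
  moreover have "real (n choose k) * falling_ratio n k j = real ((n - j) choose (k - j))"
    using Suc by simp
  ultimately show ?case by (simp add: field_simps)
qed simp

lemma falling_ratio_bounds:
  assumes "k \<le> n" shows "0 \<le> falling_ratio n k j \<and> falling_ratio n k j \<le> 1"
proof (induction j)
  case (Suc j)
  show ?case
  proof (cases "j < k")
    case True
    then have "0 \<le> (real k - real j) / (real n - real j)" "(real k - real j) / (real n - real j) \<le> 1"
      using assms by (auto simp: divide_le_eq)
    with Suc show ?thesis unfolding falling_ratio.simps by (intro conjI mult_nonneg_nonneg mult_le_one) auto
  next
    case False
    then have "falling_ratio n k (Suc j) = 0"
      by (cases "j = k") (auto simp: falling_ratio_eq_0)
    then show ?thesis by (simp del: falling_ratio.simps)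
  qed
qed simp

text \<open>
  Each of the \<open>j\<close> factors \<open>(k - i) / (n - i)\<close> differs from \<open>k / n\<close> by at most \<open>d / (n - d)\<close>, and all these numbers
  lie in \<open>[0, 1]\<close>, so the errors add up. As soon as \<open>k < j\<close> the ratio is \<open>0\<close>, and then \<open>k / n\<close> itself is small.
\<close>

lemma falling_ratio_error:
  assumes "k \<le> n" "d < n" "j \<le> d"
  shows "\<bar>falling_ratio n k j - (k / n) ^ j\<bar> \<le> real j * (real d / (real n - real d))"
  using assms(3)
proof (induction j)
  case (Suc j)
  let ?r = "falling_ratio n k j" and ?x = "real k / real n"
  let ?e = "real d / (real n - real d)"
  have x: "0 \<le> ?x" "?x \<le> 1" using assms by (auto simp: divide_le_eq)
  have e0: "?e \<ge> 0" using assms by simp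
  have ih: "\<bar>?r - ?x ^ j\<bar> \<le> real j * ?e" using Suc by simp
  show ?case
  proof (cases "j < k")
    case True
    have nj: "real n - real j > 0" "real n > 0" using Suc.prems assms by auto
    have "?x - (real k - real j) / (real n - real j) = real j * (real n - real k) / (real n * (real n - real j))"
      using nj by (simp add: field_simps)
    also have "\<dots> = (real j / (real n - real j)) * ((real n - real k) / real n)" by simp
    finally have eq: "?x - (real k - real j) / (real n - real j) = \<dots>" .
    have "real j / (real n - real j) \<le> ?e" using Suc.prems assms by (intro frac_le) auto
    moreover have "0 \<le> (real n - real k) / real n" "(real n - real k) / real n \<le> 1"
      using assms by (auto simp: divide_le_eq)
    ultimately have "(real j / (real n - real j)) * ((real n - real k) / real n) \<le> ?e * 1"
      using e0 by (intro mult_mono) auto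
    moreover have "0 \<le> (real j / (real n - real j)) * ((real n - real k) / real n)"
      using nj assms by simp
    ultimately have c: "\<bar>?x - (real k - real j) / (real n - real j)\<bar> \<le> ?e"
      unfolding eq by (simp only: abs_of_nonneg)
    have "falling_ratio n k (Suc j) - ?x ^ Suc j =
       (?r - ?x ^ j) * ?x - ?r * (?x - (real k - real j) / (real n - real j))"
      by (simp add: algebra_simps)
    also have "\<bar>\<dots>\<bar> \<le> \<bar>?r - ?x ^ j\<bar> * ?x + ?r * \<bar>?x - (real k - real j) / (real n - real j)\<bar>"
      using x falling_ratio_bounds[OF assms(1), of j]
      by (intro order_trans[OF abs_triangle_ineq4]) (simp add: abs_mult)
    also have "\<dots> \<le> real j * ?e * 1 + 1 * ?e"
      using x falling_ratio_bounds[OF assms(1), of j] ih c e0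
      by (intro add_mono mult_mono) auto
    finally show ?thesis
      by (simp only: of_nat_Suc distrib_right mult_1_left mult_1_right add.commute)
  next
    case False
    have z: "falling_ratio n k (Suc j) = 0"
      using False by (cases "j = k") (auto simp: falling_ratio_eq_0)
    have "?x ^ Suc j \<le> real j * ?e + ?e"
    proof (cases "j = k")
      case True
      have "?x ^ Suc j \<le> ?x ^ 1" using x by (intro power_decreasing) auto
      also have "\<dots> \<le> ?e" using True Suc.prems assms by (simp) (intro frac_le, auto)
      finally show ?thesis using e0 by (smt (verit) mult_nonneg_nonneg of_nat_0_le_iff)
    next
      case jk: False
      then have "?r = 0" using False by (simp add: falling_ratio_eq_0)
      then have "?x ^ j \<le> real j * ?e" using ih x by simp
      moreover have "?x ^ Suc j \<le> ?x ^ j" using x by (intro power_decreasing) auto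
      ultimately show ?thesis using e0 by linarith
    qed
    moreover have "0 \<le> ?x ^ Suc j" using x by simp
    ultimately show ?thesis unfolding z of_nat_Suc distrib_right mult_1_left by linarith
  qed
qed simp

lemma smult_sum_right: "smult c (\<Sum>i\<in>S. f i) = (\<Sum>i\<in>S. smult c (f i))"
  by (induction S rule: infinite_finite_induct) (auto simp: smult_add_right)

lemma sum_bernstein_poly:
  "(\<Sum>k\<le>n. smult (real (n choose k)) ([:0, 1:] ^ k * [:1, -1:] ^ (n - k))) = (1 :: real poly)"
proof -
  have e: "[:0, 1:] + [:1, -1:] = (1 :: real poly)" by (simp add: one_pCons)
  show ?thesis
    using binomial_ring[of "[:0, 1:]" "[:1, -1:] :: real poly" n] unfolding e power_one
    by (simp add: of_nat_poly mult.assoc)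
qed

text \<open>
  Multiply \<open>X\<^sup>j\<close> by \<open>1 = (X + (1 - X))\<^sup>n\<^sup>-\<^sup>j\<close>.
\<close>

lemma monomial_bernstein_form:
  assumes "j \<le> n"
  shows "([:0, 1:] :: real poly) ^ j =
    (\<Sum>k\<le>n. smult (real (n choose k) * falling_ratio n k j) ([:0, 1:] ^ k * [:1, -1:] ^ (n - k)))"
proof -
  let ?X = "[:0, 1:] :: real poly" and ?Y = "[:1, -1:] :: real poly"
  let ?g = "\<lambda>k. smult (real (n choose k) * falling_ratio n k j) (?X ^ k * ?Y ^ (n - k))"
  have "?X ^ j = ?X ^ j * (\<Sum>k\<le>n - j. smult (real ((n - j) choose k)) (?X ^ k * ?Y ^ (n - j - k)))"
    by (simp only: sum_bernstein_poly mult_1_right)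
  also have "\<dots> = (\<Sum>k\<le>n - j. ?g (k + j))"
    unfolding sum_distrib_left
  proof (rule sum.cong[OF refl])
    fix k assume "k \<in> {..n - j}"
    then have "real (n choose (k + j)) * falling_ratio n (k + j) j = real ((n - j) choose k)"
      using falling_ratio_binomial[of j "k + j" n] assms by simp
    then show "?X ^ j * smult (real ((n - j) choose k)) (?X ^ k * ?Y ^ (n - j - k)) = ?g (k + j)"
      by (simp add: power_add algebra_simps)
  qed
  also have "\<dots> = (\<Sum>k\<in>{j..n}. ?g k)"
    using assms by (intro sum.reindex_bij_witness[of _ "\<lambda>k. k - j" "\<lambda>k. k + j"]) auto
  also have "\<dots> = (\<Sum>k\<le>n. ?g k)"
    by (rule sum.mono_neutral_left) (auto simp: falling_ratio_eq_0)
  finally show ?thesis .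
qed

lemma poly_bernstein_form:
  assumes "degree p \<le> n"
  shows "p = (\<Sum>k\<le>n. smult (real (n choose k) * (\<Sum>j\<le>degree p. coeff p j * falling_ratio n k j))
      ([:0, 1:] ^ k * [:1, -1:] ^ (n - k)))"
proof -
  let ?X = "[:0, 1:] :: real poly" and ?Y = "[:1, -1:] :: real poly"
  have "p = (\<Sum>j\<le>degree p. smult (coeff p j) (?X ^ j))"
    using poly_as_sum_of_monoms[of p] by (simp add: monom_altdef)
  also have "\<dots> = (\<Sum>j\<le>degree p. smult (coeff p j)
      (\<Sum>k\<le>n. smult (real (n choose k) * falling_ratio n k j) (?X ^ k * ?Y ^ (n - k))))"
    using assms by (intro sum.cong refl arg_cong[where f="smult _"] monomial_bernstein_form) auto
  also have "\<dots> = (\<Sum>k\<le>n. \<Sum>j\<le>degree p. smult (coeff p j * (real (n choose k) * falling_ratio n k j))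
       (?X ^ k * ?Y ^ (n - k)))"
    by (subst sum.swap) (simp add: smult_sum_right)
  also have "\<dots> = (\<Sum>k\<le>n. smult (real (n choose k) * (\<Sum>j\<le>degree p. coeff p j * falling_ratio n k j))
      (?X ^ k * ?Y ^ (n - k)))"
    by (intro sum.cong refl) (simp add: smult_sum sum_distrib_left algebra_simps)
  finally show ?thesis .
qed

context firm_operator begin

text \<open>
  In the Bernstein basis of degree \<open>n\<close> the coefficients of \<open>p\<close> tend to the values \<open>p (k / n) \<ge> 0\<close>, uniformly in
  \<open>k\<close>. So \<open>p\<close> is bounded below by a nonnegative combination of Bernstein polynomials minus an error that tends
  to \<open>0\<close>; the Bernstein polynomials of \<open>R\<close> are nonnegative and add up to \<open>1\<close>.
\<close>

lemma opoly_nonneg: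
  assumes p: "\<And>\<mu>. 0 \<le> \<mu> \<Longrightarrow> \<mu> \<le> 1 \<Longrightarrow> 0 \<le> poly p \<mu>"
  shows "0 \<le> inner (opoly p x) x"
proof -
  define d where "d = degree p"
  define K where "K = (\<Sum>j\<le>d. \<bar>coeff p j\<bar> * real j)"
  define err where "err n = K * (real d / (real n - real d))" for n :: nat
  \<comment> \<open>The bound on \<open>p\<close> that the Bernstein form of degree \<open>n\<close> gives.\<close>
  have lower: "- err n * (norm x)\<^sup>2 \<le> inner (opoly p x) x" if n: "d < n" for n
  proof -
    let ?b = "\<lambda>k. \<Sum>j\<le>d. coeff p j * falling_ratio n k j"
    let ?B = "\<lambda>k. [:0, 1:] ^ k * [:1, -1:] ^ (n - k) :: real poly"
    let ?s = "\<lambda>k. real (n choose k) * inner (opoly (?B k) x) x"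
    have "?b k \<ge> - err n" if k: "k \<le> n" for k
    proof -
      have "\<bar>?b k - poly p (k / n)\<bar> = \<bar>\<Sum>j\<le>d. coeff p j * (falling_ratio n k j - (k / n) ^ j)\<bar>"
        by (simp add: poly_altdef d_def sum_subtractf right_diff_distrib)
      also have "\<dots> \<le> (\<Sum>j\<le>d. \<bar>coeff p j\<bar> * (real j * (real d / (real n - real d))))"
      proof (rule order_trans[OF sum_abs], rule sum_mono)
        fix j assume "j \<in> {..d}"
        then show "\<bar>coeff p j * (falling_ratio n k j - (k / n) ^ j)\<bar>
            \<le> \<bar>coeff p j\<bar> * (real j * (real d / (real n - real d)))"
          unfolding abs_mult using falling_ratio_error[OF k n] by (intro mult_left_mono) auto
      qed
      also have "\<dots> = err n" unfolding err_def K_def sum_distrib_right by (simp only: mult.assoc)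
      finally have "\<bar>?b k - poly p (k / n)\<bar> \<le> err n" .
      moreover have "0 \<le> poly p (k / n)" using k n by (intro p) (auto simp: divide_le_eq)
      ultimately show ?thesis by linarith
    qed
    then have "(\<Sum>k\<le>n. - err n * ?s k) \<le> (\<Sum>k\<le>n. ?b k * ?s k)"
      by (intro sum_mono mult_right_mono mult_nonneg_nonneg opoly_bernstein_nonneg) auto
    moreover have "(\<Sum>k\<le>n. ?s k) = inner (opoly (\<Sum>k\<le>n. smult (real (n choose k)) (?B k)) x) x"
      by (simp only: opoly_sum opoly_smult inner_sum_left inner_scaleR_left)
    then have "(\<Sum>k\<le>n. - err n * ?s k) = - err n * (norm x)\<^sup>2"
      by (simp only: sum_bernstein_poly opoly_1 power2_norm_eq_inner sum_distrib_left[symmetric])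
    moreover have "inner (opoly p x) x = (\<Sum>k\<le>n. ?b k * ?s k)"
    proof -
      have dn: "degree p \<le> n" using n d_def by simp
      have "inner (opoly p x) x = inner (opoly (\<Sum>k\<le>n. smult (real (n choose k) * ?b k) (?B k)) x) x"
        using poly_bernstein_form[OF dn] by (simp add: d_def)
      also have "\<dots> = (\<Sum>k\<le>n. ?b k * ?s k)"
        unfolding opoly_sum opoly_smult inner_sum_left inner_scaleR_left by (simp only: ac_simps)
      finally show ?thesis .
    qed
    ultimately show ?thesis by linarith
  qed
  have "(\<lambda>n. - err (n + Suc d) * (norm x)\<^sup>2) = (\<lambda>n. - (K * (real d * (1 / real (Suc n)))) * (norm x)\<^sup>2)"
    by (auto simp: err_def fun_eq_iff)
  also have "\<dots> \<longlonglongrightarrow> - (K * (real d * 0)) * (norm x)\<^sup>2"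
    by (intro tendsto_intros LIMSEQ_Suc[OF lim_1_over_n])
  finally have "(\<lambda>n. - err (n + Suc d) * (norm x)\<^sup>2) \<longlonglongrightarrow> 0" by simp
  then show ?thesis
    by (rule LIMSEQ_le_const2) (use lower in \<open>auto intro!: exI[of _ 0]\<close>)
qed

text \<open>
  The polynomial \<open>M\<^sup>2 - p\<^sup>2\<close> is nonnegative on \<open>[0, 1]\<close>.
\<close>

lemma opoly_norm_le:
  assumes p: "\<And>\<mu>. 0 \<le> \<mu> \<Longrightarrow> \<mu> \<le> 1 \<Longrightarrow> \<bar>poly p \<mu>\<bar> \<le> M"
  shows "norm (opoly p x) \<le> M * norm x"
proof -
  have M: "0 \<le> M" using p[of 0] by simp
  have "0 \<le> inner (opoly ([:M\<^sup>2:] - p * p) x) x"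
  proof (rule opoly_nonneg)
    fix \<mu> :: real assume "0 \<le> \<mu>" "\<mu> \<le> 1"
    then have "\<bar>poly p \<mu>\<bar>\<^sup>2 \<le> M\<^sup>2" using p by (intro power_mono) auto
    then show "0 \<le> poly ([:M\<^sup>2:] - p * p) \<mu>" by (simp add: power2_eq_square)
  qed
  then have "(norm (opoly p x))\<^sup>2 \<le> (M * norm x)\<^sup>2"
    by (simp add: opoly_diff opoly_pCons zero opoly_mult inner_diff_left opoly_sym power2_norm_eq_inner
        power_mult_distrib flip: power2_norm_eq_inner)
  then show ?thesis using M by (simp add: power2_le_iff_abs_le)
qed

section \<open>Continuous functions of a positive contraction\<close>

definition approximant :: "(real \<Rightarrow> real) \<Rightarrow> nat \<Rightarrow> real poly" where
  "approximant g n = (SOME p. \<forall>\<mu>. 0 \<le> \<mu> \<longrightarrow> \<mu> \<le> 1 \<longrightarrow> \<bar>poly p \<mu> - g \<mu>\<bar> \<le> 1 / real (Suc n))"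

lemma approximant:
  assumes g: "continuous_on {0..1} g" and "0 \<le> \<mu>" "\<mu> \<le> 1"
  shows "\<bar>poly (approximant g n) \<mu> - g \<mu>\<bar> \<le> 1 / real (Suc n)"
proof -
  have "0 < 1 / real (Suc n)" by simp
  from Bernstein_Weierstrass[OF g this] obtain N where
    N: "\<And>x. x \<in> {0..1} \<Longrightarrow> \<bar>g x - (\<Sum>k\<le>N. g (k/N) * Bernstein N k x)\<bar> < 1 / real (Suc n)"
    by (meson order_refl)
  define p where "p = (\<Sum>k\<le>N. smult (g (k/N) * real (N choose k)) ([:0, 1:] ^ k * [:1, -1:] ^ (N - k)))"
  have "poly p x = (\<Sum>k\<le>N. g (k/N) * Bernstein N k x)" for x
    by (simp add: p_def poly_sum Bernstein_def mult.assoc)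
  then have "\<forall>\<mu>. 0 \<le> \<mu> \<longrightarrow> \<mu> \<le> 1 \<longrightarrow> \<bar>poly p \<mu> - g \<mu>\<bar> \<le> 1 / real (Suc n)"
    using N by (metis abs_minus_commute atLeastAtMost_iff less_imp_le)
  then have "\<forall>\<mu>. 0 \<le> \<mu> \<longrightarrow> \<mu> \<le> 1 \<longrightarrow> \<bar>poly (approximant g n) \<mu> - g \<mu>\<bar> \<le> 1 / real (Suc n)"
    unfolding approximant_def by (rule someI)
  then show ?thesis using assms(2,3) by blast
qed

definition Phi :: "(real \<Rightarrow> real) \<Rightarrow> 'a \<Rightarrow> 'a" where
  "Phi g x = lim (\<lambda>n. opoly (approximant g n) x)"

lemma opoly_approximant_tendsto:
  assumes g: "continuous_on {0..1} g"
  shows "(\<lambda>n. opoly (approximant g n) x) \<longlonglongrightarrow> Phi g x"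
proof -
  have "Cauchy (\<lambda>n. opoly (approximant g n) x)"
  proof (rule metric_CauchyI)
    fix e :: real assume e: "e > 0"
    have "(\<lambda>n. 2 * (1 / real (Suc n)) * norm x) \<longlonglongrightarrow> 2 * 0 * norm x"
      by (intro tendsto_intros LIMSEQ_Suc[OF lim_1_over_n])
    then have "\<forall>\<^sub>F n in sequentially. 2 * (1 / real (Suc n)) * norm x < e"
      by (rule order_tendstoD) (use e in simp)
    then obtain N where N: "2 * (1 / real (Suc N)) * norm x < e" by (auto simp: eventually_sequentially)
    show "\<exists>N. \<forall>i\<ge>N. \<forall>k\<ge>N. dist (opoly (approximant g i) x) (opoly (approximant g k) x) < e"
    proof (intro exI allI impI)
      fix i k assume ik: "N \<le> i" "N \<le> k"
      have "norm (opoly (approximant g i - approximant g k) x) \<le> 2 * (1 / real (Suc N)) * norm x"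
      proof (rule opoly_norm_le)
        fix \<mu> :: real assume "0 \<le> \<mu>" "\<mu> \<le> 1"
        from approximant[OF g this, of i] approximant[OF g this, of k]
        have "\<bar>poly (approximant g i - approximant g k) \<mu>\<bar> \<le> 1 / real (Suc i) + 1 / real (Suc k)"
          unfolding poly_diff by linarith
        also have "\<dots> \<le> 1 / real (Suc N) + 1 / real (Suc N)"
          using ik by (intro add_mono frac_le) auto
        finally show "\<bar>poly (approximant g i - approximant g k) \<mu>\<bar> \<le> 2 * (1 / real (Suc N))" by simp
      qed
      with N show "dist (opoly (approximant g i) x) (opoly (approximant g k) x) < e"
        by (simp only: dist_norm opoly_diff)
    qed
  qed
  then show ?thesis unfolding Phi_def by (simp add: Cauchy_convergent_iff convergent_LIMSEQ_iff)
qed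

lemma Phi_limit:
  assumes g: "continuous_on {0..1} g"
    and p: "\<And>n \<mu>. 0 \<le> \<mu> \<Longrightarrow> \<mu> \<le> 1 \<Longrightarrow> \<bar>poly (p n) \<mu> - g \<mu>\<bar> \<le> e n" and e: "e \<longlonglongrightarrow> 0"
  shows "(\<lambda>n. opoly (p n) x) \<longlonglongrightarrow> Phi g x"
proof -
  have "(\<lambda>n. opoly (p n) x - opoly (approximant g n) x) \<longlonglongrightarrow> 0"
  proof (rule Lim_null_comparison)
    have "norm (opoly (p n) x - opoly (approximant g n) x) \<le> (e n + 1 / real (Suc n)) * norm x" for n
      unfolding opoly_diff[symmetric]
    proof (rule opoly_norm_le)
      fix \<mu> :: real assume "0 \<le> \<mu>" "\<mu> \<le> 1"
      from approximant[OF g this, of n] p[OF this, of n]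
      show "\<bar>poly (p n - approximant g n) \<mu>\<bar> \<le> e n + 1 / real (Suc n)"
        unfolding poly_diff by linarith
    qed
    then show "\<forall>\<^sub>F n in sequentially. norm (opoly (p n) x - opoly (approximant g n) x)
        \<le> (e n + 1 / real (Suc n)) * norm x" by simp
    have "(\<lambda>n. (e n + 1 / real (Suc n)) * norm x) \<longlonglongrightarrow> (0 + 0) * norm x"
      by (intro tendsto_intros e LIMSEQ_Suc[OF lim_1_over_n])
    then show "(\<lambda>n. (e n + 1 / real (Suc n)) * norm x) \<longlonglongrightarrow> 0" by simp
  qed
  from tendsto_add[OF this opoly_approximant_tendsto[OF g, of x]] show ?thesis by simp
qed

lemma Phi_poly: "Phi (poly p) x = opoly p x"
proof -
  have "(\<lambda>n. opoly p x) \<longlonglongrightarrow> Phi (poly p) x"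
    by (rule Phi_limit[where e="\<lambda>_. 0"]) (auto intro!: continuous_intros)
  then show ?thesis by (simp add: LIMSEQ_const_iff)
qed

lemma Phi_cong:
  assumes g: "continuous_on {0..1} g" and eq: "\<And>\<mu>. 0 \<le> \<mu> \<Longrightarrow> \<mu> \<le> 1 \<Longrightarrow> g \<mu> = h \<mu>"
  shows "Phi g x = Phi h x"
proof -
  have h: "continuous_on {0..1} h" using g eq by (subst continuous_on_cong[of _ _ _ g]) auto
  have "(\<lambda>n. opoly (approximant g n) x) \<longlonglongrightarrow> Phi h x"
    by (rule Phi_limit[OF h _ LIMSEQ_Suc[OF lim_1_over_n]]) (use approximant[OF g] eq in auto)
  then show ?thesis using opoly_approximant_tendsto[OF g] LIMSEQ_unique by blast
qed

lemma Phi_1: "Phi (\<lambda>\<mu>. 1) x = x"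
proof -
  have "poly 1 = (\<lambda>\<mu>. 1 :: real)" by (simp add: fun_eq_iff)
  then show ?thesis using Phi_poly[of 1 x] by (simp add: opoly_1)
qed

lemma Phi_id: "Phi (\<lambda>\<mu>. \<mu>) x = R x"
proof -
  have "poly [:0, 1:] = (\<lambda>\<mu>. \<mu> :: real)" by (simp add: fun_eq_iff)
  then show ?thesis using Phi_poly[of "[:0, 1:]" x] by (simp add: opoly_X)
qed

lemma Phi_vadd: "continuous_on {0..1} g \<Longrightarrow> Phi g (x + y) = Phi g x + Phi g y"
  using tendsto_add[OF opoly_approximant_tendsto opoly_approximant_tendsto, of g g x y]
    opoly_approximant_tendsto[of g "x + y"] LIMSEQ_unique by (fastforce simp: opoly_vadd)

lemma Phi_vscale: "continuous_on {0..1} g \<Longrightarrow> Phi g (c *\<^sub>R x) = c *\<^sub>R Phi g x"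
  using tendsto_scaleR[OF tendsto_const opoly_approximant_tendsto, of g c x]
    opoly_approximant_tendsto[of g "c *\<^sub>R x"] LIMSEQ_unique by (fastforce simp: opoly_vscale)

lemma Phi_sym: 
  assumes g: "continuous_on {0..1} g" shows "inner (Phi g x) y = inner x (Phi g y)"
proof (rule LIMSEQ_unique)
  show "(\<lambda>n. inner (opoly (approximant g n) x) y) \<longlonglongrightarrow> inner (Phi g x) y"
    by (intro tendsto_intros opoly_approximant_tendsto g)
  show "(\<lambda>n. inner (opoly (approximant g n) x) y) \<longlonglongrightarrow> inner x (Phi g y)"
    unfolding opoly_sym by (intro tendsto_intros opoly_approximant_tendsto g)
qed

lemma Phi_add:
  assumes g: "continuous_on {0..1} g" and h: "continuous_on {0..1} h"
  shows "Phi (\<lambda>\<mu>. g \<mu> + h \<mu>) x = Phi g x + Phi h x"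
proof (rule LIMSEQ_unique)
  show "(\<lambda>n. opoly (approximant g n + approximant h n) x) \<longlonglongrightarrow> Phi g x + Phi h x"
    unfolding opoly_add by (intro tendsto_intros opoly_approximant_tendsto g h)
  have e: "(\<lambda>n. 1 / real (Suc n) + 1 / real (Suc n)) \<longlonglongrightarrow> 0"
    using tendsto_add[OF LIMSEQ_Suc[OF lim_1_over_n[where 'a=real]] LIMSEQ_Suc[OF lim_1_over_n[where 'a=real]]]
    by simp
  show "(\<lambda>n. opoly (approximant g n + approximant h n) x) \<longlonglongrightarrow> Phi (\<lambda>\<mu>. g \<mu> + h \<mu>) x"
  proof (rule Phi_limit[OF _ _ e])
    fix n and \<mu> :: real assume "0 \<le> \<mu>" "\<mu> \<le> 1"
    from approximant[OF g this, of n] approximant[OF h this, of n]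
    show "\<bar>poly (approximant g n + approximant h n) \<mu> - (g \<mu> + h \<mu>)\<bar> \<le> 1 / real (Suc n) + 1 / real (Suc n)"
      unfolding poly_add by linarith
  qed (intro continuous_intros g h)
qed

lemma Phi_norm_le:
  assumes g: "continuous_on {0..1} g" and M: "\<And>\<mu>. 0 \<le> \<mu> \<Longrightarrow> \<mu> \<le> 1 \<Longrightarrow> \<bar>g \<mu>\<bar> \<le> M"
  shows "norm (Phi g x) \<le> M * norm x"
proof (rule LIMSEQ_le)
  show "(\<lambda>n. norm (opoly (approximant g n) x)) \<longlonglongrightarrow> norm (Phi g x)"
    by (intro tendsto_intros opoly_approximant_tendsto g)
  have "(\<lambda>n. (M + 1 / real (Suc n)) * norm x) \<longlonglongrightarrow> (M + 0) * norm x"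
    by (intro tendsto_intros LIMSEQ_Suc[OF lim_1_over_n])
  then show "(\<lambda>n. (M + 1 / real (Suc n)) * norm x) \<longlonglongrightarrow> M * norm x" by simp
  have "norm (opoly (approximant g n) x) \<le> (M + 1 / real (Suc n)) * norm x" for n
  proof (rule opoly_norm_le)
    fix \<mu> :: real assume "0 \<le> \<mu>" "\<mu> \<le> 1"
    from approximant[OF g this, of n] M[OF this]
    show "\<bar>poly (approximant g n) \<mu>\<bar> \<le> M + 1 / real (Suc n)" by linarith
  qed
  then show "\<exists>N. \<forall>n\<ge>N. norm (opoly (approximant g n) x) \<le> (M + 1 / real (Suc n)) * norm x" by blast
qed

text \<open>
  Products of approximants of \<open>g\<close> and \<open>h\<close> approximate \<open>g h\<close> uniformly, and for polynomials the product goes to the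
  composition.
\<close>

lemma Phi_mult:
  assumes g: "continuous_on {0..1} g" and h: "continuous_on {0..1} h"
  shows "Phi (\<lambda>\<mu>. g \<mu> * h \<mu>) x = Phi g (Phi h x)"
proof -
  have "compact (g ` {0..1})" "compact (h ` {0..1})" by (auto intro!: compact_continuous_image g h)
  then obtain G H where "\<forall>\<mu>\<in>{0..1}. \<bar>g \<mu>\<bar> \<le> G" "\<forall>\<mu>\<in>{0..1}. \<bar>h \<mu>\<bar> \<le> H"
    by (auto dest!: compact_imp_bounded simp: bounded_iff)
  then have GH: "\<And>\<mu>. 0 \<le> \<mu> \<Longrightarrow> \<mu> \<le> 1 \<Longrightarrow> \<bar>g \<mu>\<bar> \<le> G" "\<And>\<mu>. 0 \<le> \<mu> \<Longrightarrow> \<mu> \<le> 1 \<Longrightarrow> \<bar>h \<mu>\<bar> \<le> H"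
    by auto
  let ?r = "\<lambda>n. 1 / real (Suc n)"
  let ?p = "approximant g" and ?q = "approximant h"
  have G0: "0 \<le> G" using GH(1)[of 0] by simp
  have r: "?r \<longlonglongrightarrow> 0" by (rule LIMSEQ_Suc[OF lim_1_over_n])
  have lim1: "(\<lambda>n. opoly (?p n * ?q n) x) \<longlonglongrightarrow> Phi (\<lambda>\<mu>. g \<mu> * h \<mu>) x"
  proof (rule Phi_limit)
    show "continuous_on {0..1} (\<lambda>\<mu>. g \<mu> * h \<mu>)" by (intro continuous_intros g h)
    have "(\<lambda>n. (G + ?r n) * ?r n + H * ?r n) \<longlonglongrightarrow> (G + 0) * 0 + H * 0"
      by (intro tendsto_intros r)
    then show "(\<lambda>n. (G + ?r n) * ?r n + H * ?r n) \<longlonglongrightarrow> 0" by simp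
    fix n and \<mu> :: real assume \<mu>: "0 \<le> \<mu>" "\<mu> \<le> 1"
    have p: "\<bar>poly (?p n) \<mu>\<bar> \<le> G + ?r n" using approximant[OF g \<mu>, of n] GH(1)[OF \<mu>] by linarith
    have "poly (?p n * ?q n) \<mu> - g \<mu> * h \<mu>
      = poly (?p n) \<mu> * (poly (?q n) \<mu> - h \<mu>) + h \<mu> * (poly (?p n) \<mu> - g \<mu>)"
      by (simp add: algebra_simps)
    also have "\<bar>\<dots>\<bar> \<le> \<bar>poly (?p n) \<mu>\<bar> * \<bar>poly (?q n) \<mu> - h \<mu>\<bar> + \<bar>h \<mu>\<bar> * \<bar>poly (?p n) \<mu> - g \<mu>\<bar>"
      by (metis abs_mult abs_triangle_ineq)
    also have "\<dots> \<le> (G + ?r n) * ?r n + H * ?r n"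
      using GH(2)[OF \<mu>] by (intro add_mono mult_mono p approximant g h \<mu>) (auto simp: G0)
    finally show "\<bar>poly (?p n * ?q n) \<mu> - g \<mu> * h \<mu>\<bar> \<le> (G + ?r n) * ?r n + H * ?r n" .
  qed
  have "(\<lambda>n. opoly (?p n) (opoly (?q n) x - Phi h x) + opoly (?p n) (Phi h x))
     \<longlonglongrightarrow> 0 + Phi g (Phi h x)"
  proof (intro tendsto_add opoly_approximant_tendsto g)
    show "(\<lambda>n. opoly (?p n) (opoly (?q n) x - Phi h x)) \<longlonglongrightarrow> 0"
    proof (rule Lim_null_comparison)
      have "norm (opoly (?p n) y) \<le> (G + 1) * norm y" for n y
      proof (rule opoly_norm_le)
        fix \<mu> :: real assume \<mu>: "0 \<le> \<mu>" "\<mu> \<le> 1"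
        have "?r n \<le> 1" by simp
        then show "\<bar>poly (?p n) \<mu>\<bar> \<le> G + 1" using approximant[OF g \<mu>, of n] GH(1)[OF \<mu>] by linarith
      qed
      then show "\<forall>\<^sub>F n in sequentially. norm (opoly (?p n) (opoly (?q n) x - Phi h x))
         \<le> (G + 1) * norm (opoly (?q n) x - Phi h x)" by simp
      have "(\<lambda>n. (G + 1) * norm (opoly (?q n) x - Phi h x)) \<longlonglongrightarrow> (G + 1) * norm (Phi h x - Phi h x)"
        by (intro tendsto_intros opoly_approximant_tendsto h)
      then show "(\<lambda>n. (G + 1) * norm (opoly (?q n) x - Phi h x)) \<longlonglongrightarrow> 0" by simp
    qed
  qed
  then have "(\<lambda>n. opoly (?p n * ?q n) x) \<longlonglongrightarrow> Phi g (Phi h x)"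
    by (simp add: opoly_mult flip: opoly_vadd)
  with lim1 show ?thesis using LIMSEQ_unique by blast
qed

lemma Phi_cmult: "continuous_on {0..1} g \<Longrightarrow> Phi (\<lambda>\<mu>. c * g \<mu>) x = c *\<^sub>R Phi g x"
proof -
  assume "continuous_on {0..1} g"
  moreover have "poly [:c:] = (\<lambda>\<mu>. c)" by (simp add: fun_eq_iff)
  ultimately show ?thesis
    using Phi_mult[of "\<lambda>\<mu>. c" g x] Phi_poly[of "[:c:]" "Phi g x"] by (simp add: opoly_pCons zero)
qed

lemma Phi_nonneg:
  assumes g: "continuous_on {0..1} g" and nn: "\<And>\<mu>. 0 \<le> \<mu> \<Longrightarrow> \<mu> \<le> 1 \<Longrightarrow> 0 \<le> g \<mu>"
  shows "0 \<le> inner (Phi g x) x"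
proof -
  have s: "continuous_on {0..1} (\<lambda>\<mu>. sqrt (g \<mu>))" by (intro continuous_intros g)
  have "Phi g x = Phi (\<lambda>\<mu>. sqrt (g \<mu>) * sqrt (g \<mu>)) x" by (rule Phi_cong[OF g]) (simp add: nn)
  also have "\<dots> = Phi (\<lambda>\<mu>. sqrt (g \<mu>)) (Phi (\<lambda>\<mu>. sqrt (g \<mu>)) x)" by (rule Phi_mult[OF s s])
  finally show ?thesis by (simp only: Phi_sym[OF s, of _ x] Phi_sym[OF s, of "Phi _ x" x] inner_ge_zero)
qed

lemma Phi_commute:
  assumes C: "bounded_linear C" and comm: "\<And>x. C (R x) = R (C x)" and g: "continuous_on {0..1} g"
  shows "C (Phi g x) = Phi g (C x)"
proof (rule LIMSEQ_unique)
  show "(\<lambda>n. C (opoly (approximant g n) x)) \<longlonglongrightarrow> C (Phi g x)"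
    by (intro bounded_linear.tendsto[OF C] opoly_approximant_tendsto g)
  show "(\<lambda>n. C (opoly (approximant g n) x)) \<longlonglongrightarrow> Phi g (C x)"
    using opoly_approximant_tendsto[OF g, of "C x"]
      opoly_commute[OF bounded_linear.linear[OF C] comm] by simp
qed

text \<open>
  Completing the square: with \<open>s = sqrt (c + \<delta>)\<close> and \<open>r = b / s\<close> the form is
  \<open>\<parallel>r(R) x + s(R) y\<parallel>\<^sup>2 + \<langle>(a - r\<^sup>2)(R) x, x\<rangle> - \<delta> \<parallel>y\<parallel>\<^sup>2\<close>, and \<open>a - r\<^sup>2 \<ge> 0\<close> because the matrix has nonnegative determinant.
  The shift by \<open>\<delta> > 0\<close> is there because \<open>c\<close> may vanish. This is the step that carries a scalar inequality to
  operators with the same constant.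
\<close>

lemma Phi_form_nonneg:
  assumes a: "continuous_on {0..1} a" and b: "continuous_on {0..1} b" and c: "continuous_on {0..1} c"
    and psd: "\<And>\<mu> \<xi> \<eta>. 0 \<le> \<mu> \<Longrightarrow> \<mu> \<le> 1 \<Longrightarrow> 0 \<le> a \<mu> * \<xi>\<^sup>2 + 2 * b \<mu> * \<xi> * \<eta> + c \<mu> * \<eta>\<^sup>2"
  shows "0 \<le> inner (Phi a x) x + 2 * inner (Phi b x) y + inner (Phi c y) y"
proof (rule field_le_epsilon)
  fix e :: real assume e: "0 < e"
  define \<delta> where "\<delta> = e / (1 + inner y y)"
  have \<delta>: "0 < \<delta>" using e by (simp add: \<delta>_def add_pos_nonneg)
  have cn: "0 \<le> c \<mu>" if "0 \<le> \<mu>" "\<mu> \<le> 1" for \<mu> using psd[OF that, of 0 1] by simp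
  define s where "s \<mu> = sqrt (c \<mu> + \<delta>)" for \<mu>
  define r where "r \<mu> = b \<mu> / s \<mu>" for \<mu>
  have s_pos: "0 < s \<mu>" if "0 \<le> \<mu>" "\<mu> \<le> 1" for \<mu> using cn[OF that] \<delta> by (simp add: s_def)
  have cs: "continuous_on {0..1} s" unfolding s_def by (intro continuous_intros c)
  have cr: "continuous_on {0..1} r" unfolding r_def
    by (intro continuous_intros b cs) (use s_pos in force)
  have "0 \<le> inner (Phi (\<lambda>\<mu>. a \<mu> + (-1) * (r \<mu> * r \<mu>)) x) x"
  proof (rule Phi_nonneg)
    show "continuous_on {0..1} (\<lambda>\<mu>. a \<mu> + (-1) * (r \<mu> * r \<mu>))" by (intro continuous_intros a cr)
    fix \<mu> :: real assume \<mu>: "0 \<le> \<mu>" "\<mu> \<le> 1"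
    have cd: "0 < c \<mu> + \<delta>" using cn[OF \<mu>] \<delta> by simp
    have "0 \<le> a \<mu> * (c \<mu> + \<delta>)\<^sup>2 + 2 * b \<mu> * (c \<mu> + \<delta>) * (- b \<mu>) + c \<mu> * (- b \<mu>)\<^sup>2" by (rule psd[OF \<mu>])
    also have "\<dots> \<le> a \<mu> * (c \<mu> + \<delta>)\<^sup>2 + 2 * b \<mu> * (c \<mu> + \<delta>) * (- b \<mu>) + (c \<mu> + \<delta>) * (- b \<mu>)\<^sup>2"
      using \<delta> by (intro add_left_mono mult_right_mono) auto
    also have "\<dots> = (c \<mu> + \<delta>) * (a \<mu> * (c \<mu> + \<delta>) - (b \<mu>)\<^sup>2)"
      by (simp add: algebra_simps power2_eq_square)
    finally have "0 \<le> a \<mu> * (c \<mu> + \<delta>) - (b \<mu>)\<^sup>2" using cd by (simp add: zero_le_mult_iff)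
    then have "(b \<mu>)\<^sup>2 / (c \<mu> + \<delta>) \<le> a \<mu>" using cd by (simp add: divide_le_eq)
    then show "0 \<le> a \<mu> + (-1) * (r \<mu> * r \<mu>)"
      using cd by (simp add: r_def s_def flip: power2_eq_square) (simp add: power_divide)
  qed
  also have "inner (Phi (\<lambda>\<mu>. a \<mu> + (-1) * (r \<mu> * r \<mu>)) x) x = inner (Phi a x) x - inner (Phi r (Phi r x)) x"
  proof -
    have "continuous_on {0..1} (\<lambda>\<mu>. r \<mu> * r \<mu>)" by (intro continuous_intros cr)
    then have "Phi (\<lambda>\<mu>. a \<mu> + (-1) * (r \<mu> * r \<mu>)) x = Phi a x - Phi r (Phi r x)"
      by (subst Phi_add[OF a]) (auto simp only: Phi_cmult Phi_mult[OF cr cr] scaleR_minus1_left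
          intro!: continuous_intros cr, simp)
    then show ?thesis by (simp add: inner_diff_left)
  qed
  finally have 1: "0 \<le> inner (Phi a x) x - inner (Phi r (Phi r x)) x" .
  have b_eq: "Phi b x = Phi s (Phi r x)"
    unfolding Phi_mult[OF cs cr, symmetric]
    by (rule Phi_cong[OF b]) (use s_pos in \<open>force simp: r_def\<close>)
  have "Phi c y + \<delta> *\<^sub>R y = Phi (\<lambda>\<mu>. c \<mu> + \<delta> * 1) y"
    by (subst Phi_add[OF c]) (simp_all only: Phi_cmult continuous_on_const Phi_1 continuous_on_mult)
  also have "\<dots> = Phi (\<lambda>\<mu>. s \<mu> * s \<mu>) y"
  proof (rule Phi_cong)
    fix \<mu> :: real assume "0 \<le> \<mu>" "\<mu> \<le> 1"
    then have "0 \<le> c \<mu> + \<delta>" using cn \<delta> by (simp add: add_nonneg_nonneg less_imp_le)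
    then show "c \<mu> + \<delta> * 1 = s \<mu> * s \<mu>" by (simp add: s_def)
  qed (intro continuous_intros c)
  also have "\<dots> = Phi s (Phi s y)" by (rule Phi_mult[OF cs cs])
  finally have c_eq: "Phi c y = Phi s (Phi s y) - \<delta> *\<^sub>R y" by (simp add: algebra_simps)
  have "0 \<le> inner (Phi r x + Phi s y) (Phi r x + Phi s y)" by simp
  also have "\<dots> = inner (Phi r (Phi r x)) x + 2 * inner (Phi b x) y + inner (Phi s (Phi s y)) y"
    unfolding b_eq
    by (simp add: inner_add_left inner_add_right Phi_sym[OF cs, of "Phi r x"] Phi_sym[OF cs, of "Phi s y"]
        Phi_sym[OF cr, of "Phi r x"] inner_commute[of "Phi s y" "Phi r x"])
  finally have "0 \<le> inner (Phi a x) x + 2 * inner (Phi b x) y + inner (Phi c y) y + \<delta> * inner y y"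
    using 1 by (simp add: c_eq inner_diff_left)
  moreover have "\<delta> * inner y y \<le> e"
    using e by (simp add: \<delta>_def divide_le_eq add_pos_nonneg algebra_simps)
  ultimately show "0 \<le> inner (Phi a x) x + 2 * inner (Phi b x) y + inner (Phi c y) y + e" by linarith
qed

end

sublocale nonneg_operator \<subseteq> firm_operator R
  by (rule firm_operator.intro[OF linear_R R_sym R_firm])

section \<open>Functions of a nonnegative selfadjoint operator\<close>

definition vanishing :: "(real \<Rightarrow> real) \<Rightarrow> bool" where
  "vanishing h \<longleftrightarrow> continuous_on {0..} h \<and> (h \<longlongrightarrow> 0) at_top"

lemma vanishing_add: "vanishing g \<Longrightarrow> vanishing h \<Longrightarrow> vanishing (\<lambda>l. g l + h l)"
  and vanishing_diff: "vanishing g \<Longrightarrow> vanishing h \<Longrightarrow> vanishing (\<lambda>l. g l - h l)"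
  and vanishing_mult: "vanishing g \<Longrightarrow> vanishing h \<Longrightarrow> vanishing (\<lambda>l. g l * h l)"
  and vanishing_cmult: "vanishing g \<Longrightarrow> vanishing (\<lambda>l. c * g l)"
  unfolding vanishing_def
  using tendsto_add[of g 0 at_top h 0] tendsto_diff[of g 0 at_top h 0] tendsto_mult[of g 0 at_top h 0]
    tendsto_mult[of "\<lambda>_. c" c at_top g 0]
  by (auto intro!: continuous_on_add continuous_on_diff continuous_on_mult)

lemma vanishing_0: "vanishing (\<lambda>l. 0)"
  by (simp add: vanishing_def)

lemma vanishing_sum: "(\<And>i. i \<in> I \<Longrightarrow> vanishing (g i)) \<Longrightarrow> vanishing (\<lambda>l. \<Sum>i\<in>I. g i l)"
  by (induction I rule: infinite_finite_induct) (simp_all add: vanishing_0 vanishing_add)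

text \<open>
  Polynomially bounded continuous functions: those that a factor \<open>exp (- s \<lambda>)\<close> brings into the domain of the
  functional calculus.
\<close>

definition tempered :: "(real \<Rightarrow> real) \<Rightarrow> bool" where
  "tempered h \<longleftrightarrow> continuous_on {0..} h \<and> (\<exists>M k. \<forall>l\<ge>0. \<bar>h l\<bar> \<le> M * (1 + l) ^ k)"

lemma temperedI:
  "continuous_on {0..} h \<Longrightarrow> (\<And>l. 0 \<le> l \<Longrightarrow> \<bar>h l\<bar> \<le> M * (1 + l) ^ k) \<Longrightarrow> tempered h"
  unfolding tempered_def by blast

lemma tempered_const [simp]: "tempered (\<lambda>l. c)"
  by (rule temperedI[where M="\<bar>c\<bar>" and k=0]) auto

lemma tempered_id [simp]: "tempered (\<lambda>l. l)"
  by (rule temperedI[where M=1 and k=1]) auto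

lemma tempered_add:
  assumes "tempered g" "tempered h" shows "tempered (\<lambda>l. g l + h l)"
proof -
  obtain M k N j where b: "\<And>l. 0 \<le> l \<Longrightarrow> \<bar>g l\<bar> \<le> M * (1 + l) ^ k" "\<And>l. 0 \<le> l \<Longrightarrow> \<bar>h l\<bar> \<le> N * (1 + l) ^ j"
    using assms unfolding tempered_def by blast
  have M: "0 \<le> M" "0 \<le> N" using b(1)[of 0] b(2)[of 0] by auto
  show ?thesis
  proof (rule temperedI[where M="M + N" and k="max k j"])
    show "continuous_on {0..} (\<lambda>l. g l + h l)"
      using assms by (auto simp: tempered_def intro!: continuous_intros)
    fix l :: real assume l: "0 \<le> l"
    have "\<bar>g l + h l\<bar> \<le> M * (1 + l) ^ k + N * (1 + l) ^ j" using b[OF l] by linarith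
    also have "\<dots> \<le> M * (1 + l) ^ max k j + N * (1 + l) ^ max k j"
      using M l by (intro add_mono mult_left_mono power_increasing) auto
    finally show "\<bar>g l + h l\<bar> \<le> (M + N) * (1 + l) ^ max k j" by (simp add: algebra_simps)
  qed
qed

lemma tempered_mult:
  assumes "tempered g" "tempered h" shows "tempered (\<lambda>l. g l * h l)"
proof -
  obtain M k N j where b: "\<And>l. 0 \<le> l \<Longrightarrow> \<bar>g l\<bar> \<le> M * (1 + l) ^ k" "\<And>l. 0 \<le> l \<Longrightarrow> \<bar>h l\<bar> \<le> N * (1 + l) ^ j"
    using assms unfolding tempered_def by blast
  have M: "0 \<le> M" using b(1)[of 0] by auto
  show ?thesis
  proof (rule temperedI[where M="M * N" and k="k + j"])
    show "continuous_on {0..} (\<lambda>l. g l * h l)"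
      using assms by (auto simp: tempered_def intro!: continuous_intros)
    fix l :: real assume l: "0 \<le> l"
    have "\<bar>g l * h l\<bar> \<le> (M * (1 + l) ^ k) * (N * (1 + l) ^ j)"
      unfolding abs_mult using b[OF l] M l by (intro mult_mono) auto
    then show "\<bar>g l * h l\<bar> \<le> (M * N) * (1 + l) ^ (k + j)" by (simp add: algebra_simps power_add)
  qed
qed

lemma tempered_minus: "tempered g \<Longrightarrow> tempered (\<lambda>l. - g l)"
  using tempered_mult[of "\<lambda>l. -1" g] by simp

lemma tempered_diff: "tempered g \<Longrightarrow> tempered h \<Longrightarrow> tempered (\<lambda>l. g l - h l)"
  using tempered_add[of g "\<lambda>l. - h l"] tempered_minus by simp

lemma tempered_power: "tempered g \<Longrightarrow> tempered (\<lambda>l. g l ^ k)"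
  by (induction k) (simp_all add: tempered_mult)

lemma tempered_sum: "(\<And>i. i \<in> I \<Longrightarrow> tempered (g i)) \<Longrightarrow> tempered (\<lambda>l. \<Sum>i\<in>I. g i l)"
  by (induction I rule: infinite_finite_induct) (simp_all add: tempered_add)

lemma tempered_exp: "0 \<le> s \<Longrightarrow> tempered (\<lambda>l. exp (- s * l))"
  by (rule temperedI[where M=1 and k=0]) (auto intro!: continuous_intros)

lemmas tempered_intros = tempered_const tempered_id tempered_add tempered_mult tempered_minus
  tempered_diff tempered_power tempered_sum tempered_exp

lemma exp_power_tendsto_0:
  assumes "0 < s" shows "((\<lambda>l::real. exp (- s * l) * (1 + l) ^ k) \<longlongrightarrow> 0) at_top"
proof -
  have "filterlim (\<lambda>l::real. s + s * l) at_top at_top"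
    by (intro filterlim_tendsto_add_at_top[OF tendsto_const]
        filterlim_tendsto_pos_mult_at_top[OF tendsto_const assms] filterlim_ident)
  from filterlim_compose[OF tendsto_power_div_exp_0[of k] this]
  have "((\<lambda>l. (exp s / s ^ k) * ((s + s * l) ^ k / exp (s + s * l))) \<longlongrightarrow> (exp s / s ^ k) * 0) at_top"
    by (intro tendsto_intros)
  moreover have "(exp s / s ^ k) * ((s + s * l) ^ k / exp (s + s * l)) = exp (- s * l) * (1 + l) ^ k" for l
  proof -
    have "(s + s * l) ^ k = s ^ k * (1 + l) ^ k"
      by (simp add: distrib_left flip: power_mult_distrib)
    then show ?thesis using assms by (simp add: exp_add exp_minus field_simps)
  qed
  ultimately show ?thesis by simp
qed

lemma vanishing_exp_tempered:
  assumes "0 < s" "tempered h" shows "vanishing (\<lambda>l. exp (- s * l) * h l)"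
proof -
  obtain M k where b: "\<And>l. 0 \<le> l \<Longrightarrow> \<bar>h l\<bar> \<le> M * (1 + l) ^ k"
    using assms unfolding tempered_def by blast
  have "((\<lambda>l. exp (- s * l) * h l) \<longlongrightarrow> 0) at_top"
  proof (rule Lim_null_comparison)
    show "((\<lambda>l. M * (exp (- s * l) * (1 + l) ^ k)) \<longlongrightarrow> 0) at_top"
      using tendsto_mult_left[OF exp_power_tendsto_0[OF assms(1)], of M k] by simp
    show "\<forall>\<^sub>F l in at_top. norm (exp (- s * l) * h l) \<le> M * (exp (- s * l) * (1 + l) ^ k)"
      using eventually_ge_at_top[of 0]
    proof eventually_elim
      fix l :: real assume "0 \<le> l"
      from mult_left_mono[OF b[OF this], of "exp (- s * l)"]
      show "norm (exp (- s * l) * h l) \<le> M * (exp (- s * l) * (1 + l) ^ k)"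
        by (simp add: abs_mult algebra_simps)
    qed
  qed
  then show ?thesis using assms(2) unfolding vanishing_def tempered_def
    by (auto intro!: continuous_intros)
qed

lemma exp_tempered_bounded:
  assumes "0 < s" "tempered h"
  obtains M where "\<And>l. 0 \<le> l \<Longrightarrow> \<bar>exp (- s * l) * h l\<bar> \<le> M"
proof -
  have v: "vanishing (\<lambda>l. exp (- s * l) * h l)" by (rule vanishing_exp_tempered[OF assms])
  then have "\<forall>\<^sub>F l in at_top. \<bar>exp (- s * l) * h l\<bar> < 1"
    unfolding vanishing_def by (auto dest: tendstoD[where e=1] simp: dist_real_def)
  then obtain K where K: "\<And>l. K \<le> l \<Longrightarrow> \<bar>exp (- s * l) * h l\<bar> < 1"
    by (auto simp: eventually_at_top_linorder)
  have "continuous_on {0..K} (\<lambda>l. exp (- s * l) * h l)"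
    using v unfolding vanishing_def by (auto intro: continuous_on_subset)
  then have "bounded ((\<lambda>l. exp (- s * l) * h l) ` {0..K})"
    by (intro compact_imp_bounded compact_continuous_image) auto
  then obtain B where B: "\<forall>l\<in>{0..K}. \<bar>exp (- s * l) * h l\<bar> \<le> B" by (auto simp: bounded_iff)
  have "\<bar>exp (- s * l) * h l\<bar> \<le> max B 1" if "0 \<le> l" for l
    using K[of l] B that by (cases "K \<le> l") (auto simp: le_max_iff_disj less_imp_le)
  then show thesis by (rule that)
qed

text \<open>
  Passage from the spectral variable \<open>l \<ge> 0\<close> of \<open>A\<close> to the spectral variable \<open>\<mu> = 1 / (1 + l)\<close> of the resolvent. The
  point \<open>\<mu> = 0\<close> corresponds to \<open>l = \<infinity>\<close>, where the functions in question vanish.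
\<close>

definition pull :: "(real \<Rightarrow> real) \<Rightarrow> real \<Rightarrow> real" where
  "pull h \<mu> = (if \<mu> = 0 then 0 else h (1 / \<mu> - 1))"

lemma continuous_on_pull:
  assumes "vanishing h" shows "continuous_on {0..1} (pull h)"
  unfolding continuous_on_eq_continuous_within
proof
  fix \<mu> :: real assume \<mu>: "\<mu> \<in> {0..1}"
  show "continuous (at \<mu> within {0..1}) (pull h)"
  proof (cases "\<mu> = 0")
    case True
    have "(pull h \<longlongrightarrow> 0) (at 0 within {0..1})"
    proof (rule Lim_transform_eventually)
      have "filterlim (\<lambda>\<mu>::real. -1 + inverse \<mu>) at_top (at_right 0)"
        by (intro filterlim_tendsto_add_at_top[OF tendsto_const] filterlim_inverse_at_top_right)
      moreover have "(h \<longlongrightarrow> 0) at_top" using assms by (simp add: vanishing_def)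
      ultimately have "((\<lambda>\<mu>. h (-1 + inverse \<mu>)) \<longlongrightarrow> 0) (at_right 0)"
        using filterlim_compose by blast
      then show "((\<lambda>\<mu>. h (-1 + inverse \<mu>)) \<longlongrightarrow> 0) (at 0 within {0..1})"
        by (simp add: at_within_Icc_at_right)
      show "\<forall>\<^sub>F \<mu> in at 0 within {0..1}. h (-1 + inverse \<mu>) = pull h \<mu>"
        by (auto simp: eventually_at_filter pull_def inverse_eq_divide)
    qed
    then show ?thesis using True by (simp add: continuous_within pull_def)
  next
    case False
    then have pos: "0 < \<mu>" using \<mu> by auto
    have "continuous_on {0<..1} (\<lambda>\<mu>. h (1 / \<mu> - 1))"
    proof (rule continuous_on_compose2[of "{0..}" h])
      show "continuous_on {0..} h" using assms by (simp add: vanishing_def)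
      show "continuous_on {0<..1} (\<lambda>\<mu>::real. 1 / \<mu> - 1)" by (auto intro!: continuous_intros)
    qed auto
    then have "continuous_on {0<..1} (pull h)"
      by (subst continuous_on_cong[where g="\<lambda>\<mu>. h (1 / \<mu> - 1)"]) (auto simp: pull_def)
    then have "continuous (at \<mu> within {0<..1}) (pull h)"
      using pos \<mu> by (auto simp: continuous_on_eq_continuous_within)
    moreover have "at \<mu> within {0<..1} = at \<mu> within {0..1}"
      by (rule at_within_nhd[of _ "{0<..}"]) (use pos in auto)
    ultimately show ?thesis by simp
  qed
qed

lemma pull_add: "pull (\<lambda>l. g l + h l) = (\<lambda>\<mu>. pull g \<mu> + pull h \<mu>)"
  and pull_mult: "pull (\<lambda>l. g l * h l) = (\<lambda>\<mu>. pull g \<mu> * pull h \<mu>)"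
  and pull_cmult: "pull (\<lambda>l. c * g l) = (\<lambda>\<mu>. c * pull g \<mu>)"
  by (auto simp: pull_def)

context nonneg_operator begin

text \<open>
  The operator \<open>h(A)\<close>, for continuous \<open>h\<close> on \<open>[0, \<infinity>)\<close> that vanish at infinity.
\<close>

definition fc :: "(real \<Rightarrow> real) \<Rightarrow> 'a \<Rightarrow> 'a" where
  "fc h = Phi (pull h)"

lemma fc_cong:
  assumes "vanishing g" "\<And>l. 0 \<le> l \<Longrightarrow> g l = h l" shows "fc g x = fc h x"
  unfolding fc_def by (rule Phi_cong[OF continuous_on_pull[OF assms(1)]]) (auto simp: pull_def assms(2))

lemma fc_add: "vanishing g \<Longrightarrow> vanishing h \<Longrightarrow> fc (\<lambda>l. g l + h l) x = fc g x + fc h x"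
  unfolding fc_def pull_add by (rule Phi_add[OF continuous_on_pull continuous_on_pull])

lemma fc_cmult: "vanishing g \<Longrightarrow> fc (\<lambda>l. c * g l) x = c *\<^sub>R fc g x"
  unfolding fc_def pull_cmult by (rule Phi_cmult[OF continuous_on_pull])

lemma fc_diff: "vanishing g \<Longrightarrow> vanishing h \<Longrightarrow> fc (\<lambda>l. g l - h l) x = fc g x - fc h x"
  using fc_add[of g "\<lambda>l. (-1) * h l" x] fc_cmult[of h "-1" x] vanishing_cmult[of h "-1"] by simp

lemma fc_sum:
  assumes "finite I" "\<And>i. i \<in> I \<Longrightarrow> vanishing (g i)"
  shows "fc (\<lambda>l. \<Sum>i\<in>I. g i l) x = (\<Sum>i\<in>I. fc (g i) x)"
  using assms
proof (induction I rule: finite_induct)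
  case empty
  from fc_cmult[OF vanishing_0, of 0 x] show ?case by simp
qed (simp add: fc_add vanishing_sum)

lemma fc_mult: "vanishing g \<Longrightarrow> vanishing h \<Longrightarrow> fc (\<lambda>l. g l * h l) x = fc g (fc h x)"
  unfolding fc_def pull_mult by (rule Phi_mult[OF continuous_on_pull continuous_on_pull])

lemma fc_sym: "vanishing g \<Longrightarrow> inner (fc g x) y = inner x (fc g y)"
  unfolding fc_def by (rule Phi_sym[OF continuous_on_pull])

lemma fc_vadd: "vanishing g \<Longrightarrow> fc g (x + y) = fc g x + fc g y"
  and fc_vscale: "vanishing g \<Longrightarrow> fc g (c *\<^sub>R x) = c *\<^sub>R fc g x"
  unfolding fc_def by (simp_all add: Phi_vadd Phi_vscale continuous_on_pull)

lemma fc_norm_le: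
  assumes "vanishing g" "\<And>l. 0 \<le> l \<Longrightarrow> \<bar>g l\<bar> \<le> M" shows "norm (fc g x) \<le> M * norm x"
  unfolding fc_def
proof (rule Phi_norm_le[OF continuous_on_pull[OF assms(1)]])
  have "0 \<le> M" using assms(2)[of 0] by linarith
  then show "\<bar>pull g \<mu>\<bar> \<le> M" if "0 \<le> \<mu>" "\<mu> \<le> 1" for \<mu>
    using that assms(2)[of "1 / \<mu> - 1"] by (auto simp: pull_def)
qed

lemma bounded_linear_fc:
  assumes "vanishing g" shows "bounded_linear (fc g)"
proof -
  have "compact (pull g ` {0..1})" by (intro compact_continuous_image continuous_on_pull assms) auto
  then obtain M where M: "\<forall>\<mu>\<in>{0..1}. \<bar>pull g \<mu>\<bar> \<le> M"
    by (auto dest!: compact_imp_bounded simp: bounded_iff)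
  have "norm (fc g x) \<le> norm x * M" for x
    unfolding fc_def using Phi_norm_le[OF continuous_on_pull[OF assms], of M x] M
    by (simp add: mult.commute)
  then show ?thesis
    by (intro bounded_linear_intro[where K=M]) (auto simp: fc_vadd fc_vscale assms)
qed

lemma fc_commute:
  assumes "bounded_linear C" "\<And>x. C (R x) = R (C x)" "vanishing g"
  shows "C (fc g x) = fc g (C x)"
  unfolding fc_def by (rule Phi_commute[OF assms(1,2) continuous_on_pull[OF assms(3)]])

lemma vanishing_resolvent: "vanishing (\<lambda>l. 1 / (1 + l))"
  unfolding vanishing_def
proof
  show "((\<lambda>l::real. 1 / (1 + l)) \<longlongrightarrow> 0) at_top"
    by (intro tendsto_divide_0[OF tendsto_const] filterlim_at_top_imp_at_infinity
        filterlim_tendsto_add_at_top[OF tendsto_const] filterlim_ident)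
qed (auto intro!: continuous_intros)

lemma fc_resolvent: "fc (\<lambda>l. 1 / (1 + l)) x = R x"
proof -
  have "fc (\<lambda>l. 1 / (1 + l)) x = Phi (\<lambda>\<mu>. \<mu>) x"
    unfolding fc_def by (rule Phi_cong[OF continuous_on_pull[OF vanishing_resolvent]]) (auto simp: pull_def)
  then show ?thesis by (simp add: Phi_id)
qed

lemma bounded_linear_R: "bounded_linear R"
  using bounded_linear_fc[OF vanishing_resolvent] by (simp add: fc_resolvent[abs_def])

text \<open>
  With \<open>g = (1 + l) h\<close> one has \<open>h(A) = R g(A)\<close>, and \<open>A R = 1 - R\<close>.
\<close>

lemma A_fc:
  assumes h: "vanishing h" and lh: "vanishing (\<lambda>l. l * h l)"
  shows "fc h x \<in> DA" "A (fc h x) = fc (\<lambda>l. l * h l) x"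
proof -
  have g: "vanishing (\<lambda>l. h l + l * h l)" by (rule vanishing_add[OF h lh])
  have "fc h x = fc (\<lambda>l. 1 / (1 + l) * (h l + l * h l)) x"
    by (rule fc_cong[OF h]) (simp add: field_simps)
  also have "\<dots> = R (fc (\<lambda>l. h l + l * h l) x)"
    using fc_mult[OF vanishing_resolvent g, of x] by (simp only: fc_resolvent)
  finally have eq: "fc h x = R (fc (\<lambda>l. h l + l * h l) x)" .
  show "fc h x \<in> DA" unfolding eq by (rule R_domain)
  show "A (fc h x) = fc (\<lambda>l. l * h l) x"
    by (subst eq, subst A_R, subst eq[symmetric]) (simp add: fc_add[OF h lh])
qed

lemma fc_form_nonneg:
  assumes abc: "vanishing a" "vanishing b" "vanishing c"
    and psd: "\<And>l \<xi> \<eta>. 0 \<le> l \<Longrightarrow> 0 \<le> a l * \<xi>\<^sup>2 + 2 * b l * \<xi> * \<eta> + c l * \<eta>\<^sup>2"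
  shows "0 \<le> inner (fc a x) x + 2 * inner (fc b x) y + inner (fc c y) y"
  unfolding fc_def
proof (rule Phi_form_nonneg[OF continuous_on_pull continuous_on_pull continuous_on_pull, OF abc])
  fix \<mu> \<xi> \<eta> :: real assume "0 \<le> \<mu>" "\<mu> \<le> 1"
  then show "0 \<le> pull a \<mu> * \<xi>\<^sup>2 + 2 * pull b \<mu> * \<xi> * \<eta> + pull c \<mu> * \<eta>\<^sup>2"
    using psd[of "1 / \<mu> - 1" \<xi> \<eta>] by (auto simp: pull_def)
qed

end

text \<open>
  A Taylor bound whose constant depends only on the bound for \<open>f''\<close>. It makes difference quotients in time converge
  uniformly in the spectral variable, which is what the functional calculus needs.
\<close>

lemma second_order_remainder:
  fixes f f' f'' :: "real \<Rightarrow> real"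
  assumes S: "convex S" and s: "s \<in> S" and t: "t \<in> S"
    and f: "\<And>r. r \<in> S \<Longrightarrow> (f has_real_derivative f' r) (at r within S)"
    and f': "\<And>r. r \<in> S \<Longrightarrow> (f' has_real_derivative f'' r) (at r within S)"
    and M: "\<And>r. r \<in> S \<Longrightarrow> \<bar>f'' r\<bar> \<le> M"
  shows "\<bar>f s - f t - (s - t) * f' t\<bar> \<le> M * (s - t)\<^sup>2"
proof -
  let ?I = "closed_segment t s"
  have I: "?I \<subseteq> S" using S s t by (rule_tac closed_segment_subset)
  have M0: "0 \<le> M" using M[OF t] by linarith
  have d: "\<bar>f' r - f' t\<bar> \<le> M * \<bar>s - t\<bar>" if r: "r \<in> ?I" for r
  proof -
    have "norm (f' r - f' t) \<le> M * norm (r - t)"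
      by (rule field_differentiable_bound[OF S f']) (use M r I t in auto)
    also have "\<dots> \<le> M * \<bar>s - t\<bar>"
      using r M0 dist_in_closed_segment(1)[OF r] by (intro mult_left_mono) (auto simp: dist_real_def)
    finally show ?thesis by simp
  qed
  have "norm ((f s - s * f' t) - (f t - t * f' t)) \<le> (M * \<bar>s - t\<bar>) * norm (s - t)"
  proof (rule field_differentiable_bound[where S="?I" and f'="\<lambda>r. f' r - f' t"])
    fix r assume r: "r \<in> ?I"
    then show "((\<lambda>r. f r - r * f' t) has_field_derivative f' r - f' t) (at r within ?I)"
      using I by (auto intro!: derivative_eq_intros DERIV_subset[OF f])
  qed (use d in auto)
  then show ?thesis by (simp add: algebra_simps power2_eq_square abs_mult flip: abs_mult)
qed

lemma quadratic_remainder_imp_derivative: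
  fixes F :: "real \<Rightarrow> 'b::real_normed_vector"
  assumes "\<And>s. s \<in> S \<Longrightarrow> norm (F s - F t - (s - t) *\<^sub>R D) \<le> K * (s - t)\<^sup>2"
  shows "(F has_vector_derivative D) (at t within S)"
  unfolding has_vector_derivative_def has_derivative_within_alt
proof (intro conjI allI impI)
  show "bounded_linear (\<lambda>h. h *\<^sub>R D)" by (rule bounded_linear_scaleR_left)
  fix e :: real assume e: "0 < e"
  show "\<exists>d>0. \<forall>s\<in>S. norm (s - t) < d \<longrightarrow> norm (F s - F t - (s - t) *\<^sub>R D) \<le> e * norm (s - t)"
  proof (intro exI conjI ballI impI)
    show "0 < e / (\<bar>K\<bar> + 1)" using e by simp
    fix s assume s: "s \<in> S" "norm (s - t) < e / (\<bar>K\<bar> + 1)"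
    have "K * (s - t)\<^sup>2 \<le> (\<bar>K\<bar> + 1) * \<bar>s - t\<bar> * \<bar>s - t\<bar>"
      by (simp add: power2_eq_square mult.assoc mult_right_mono flip: abs_mult)
    also have "\<dots> \<le> e * \<bar>s - t\<bar>"
    proof (rule mult_right_mono)
      show "(\<bar>K\<bar> + 1) * \<bar>s - t\<bar> \<le> e" using s(2) by (simp add: less_divide_eq mult.commute less_imp_le)
    qed simp
    finally show "norm (F s - F t - (s - t) *\<^sub>R D) \<le> e * norm (s - t)"
      using assms[OF s(1)] by simp
  qed
qed

context nonneg_operator begin

lemma fc_has_vector_derivative:
  assumes S: "convex S" and t: "t \<in> S"
    and van: "\<And>s. s \<in> S \<Longrightarrow> vanishing (f s)" "vanishing (f' t)"
    and f: "\<And>l r. 0 \<le> l \<Longrightarrow> r \<in> S \<Longrightarrow> ((\<lambda>s. f s l) has_real_derivative f' r l) (at r within S)"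
    and f': "\<And>l r. 0 \<le> l \<Longrightarrow> r \<in> S \<Longrightarrow> ((\<lambda>s. f' s l) has_real_derivative f'' r l) (at r within S)"
    and M: "\<And>l r. 0 \<le> l \<Longrightarrow> r \<in> S \<Longrightarrow> \<bar>f'' r l\<bar> \<le> M"
  shows "((\<lambda>s. fc (f s) x) has_vector_derivative fc (f' t) x) (at t within S)"
proof (rule quadratic_remainder_imp_derivative)
  fix s assume s: "s \<in> S"
  have "fc (f s) x - fc (f t) x - (s - t) *\<^sub>R fc (f' t) x = fc (\<lambda>l. f s l - f t l - (s - t) * f' t l) x"
    by (simp add: fc_diff fc_cmult van s t vanishing_diff vanishing_cmult)
  also have "norm \<dots> \<le> (M * (s - t)\<^sup>2) * norm x"
  proof (rule fc_norm_le)
    show "vanishing (\<lambda>l. f s l - f t l - (s - t) * f' t l)"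
      by (intro vanishing_diff vanishing_cmult van s t)
    fix l :: real assume l: "0 \<le> l"
    show "\<bar>f s l - f t l - (s - t) * f' t l\<bar> \<le> M * (s - t)\<^sup>2"
      by (rule second_order_remainder[OF S s t f[OF l] f'[OF l] M[OF l]])
  qed
  finally show "norm (fc (f s) x - fc (f t) x - (s - t) *\<^sub>R fc (f' t) x) \<le> (M * norm x) * (s - t)\<^sup>2"
    by (simp add: mult_ac)
qed

end

section \<open>One-sided derivatives and uniform boundedness\<close>

text \<open>
  A semigroup gives derivatives from the right only. If the increment of \<open>f\<close> exceeded \<open>e (b - a)\<close>, then at the last
  point up to which the increment stays within the allowed slope \<open>e\<close> the right derivative could not be \<open>0\<close>.
\<close>

lemma right_derivative_zero_constant:
  fixes f :: "real \<Rightarrow> real"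
  assumes ab: "a \<le> b" and cont: "continuous_on {a..b} f"
    and deriv: "\<And>s. a \<le> s \<Longrightarrow> s < b \<Longrightarrow> (f has_vector_derivative 0) (at s within {s..})"
  shows "f b = f a"
proof -
  have small: "\<bar>f b - f a\<bar> \<le> e * (b - a)" if e: "0 < e" for e
  proof (rule ccontr)
    assume neg: "\<not> ?thesis"
    define g where "g s = \<bar>f s - f a\<bar> - e * (s - a)" for s
    let ?Z = "{s \<in> {a..b}. g s \<le> 0}"
    have cg: "continuous_on {a..b} g" unfolding g_def by (intro continuous_intros cont)
    have "closed ?Z" using continuous_closed_preimage[OF cg, of "{..0}"] by (simp add: vimage_def Int_def)
    moreover have "bounded ?Z" by (rule bounded_subset[of "{a..b}"]) auto
    ultimately have "compact ?Z" by (simp add: compact_eq_bounded_closed)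
    moreover have "a \<in> ?Z" using ab by (simp add: g_def)
    ultimately obtain c where c: "c \<in> ?Z" "\<And>s. s \<in> ?Z \<Longrightarrow> s \<le> c"
      using compact_attains_sup[of ?Z] by blast
    have "c \<noteq> b" using c(1) neg by (auto simp: g_def)
    then have cb: "a \<le> c" "c < b" using c(1) by auto
    have "\<exists>d>0. \<forall>s\<in>{c..}. norm (s - c) < d \<longrightarrow> norm (f s - f c - (s - c) *\<^sub>R 0) \<le> e * norm (s - c)"
      using deriv[OF cb] e unfolding has_vector_derivative_def has_derivative_within_alt by blast
    then obtain d where d: "0 < d" "\<And>s. c \<le> s \<Longrightarrow> s - c < d \<Longrightarrow> \<bar>f s - f c\<bar> \<le> e * (s - c)" by force
    define s where "s = min b (c + d / 2)"
    have s: "c < s" "s \<le> b" "s - c < d" using cb d(1) by (auto simp: s_def min_def)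
    have "g s \<le> g c" using d(2)[of s] s by (simp add: g_def algebra_simps)
    then have "s \<in> ?Z" using c(1) s cb by auto
    then show False using c(2) s by fastforce
  qed
  have "\<bar>f b - f a\<bar> \<le> 0"
  proof (rule field_le_epsilon)
    fix e :: real assume e: "0 < e"
    have "\<bar>f b - f a\<bar> \<le> (e / (b - a + 1)) * (b - a)" using e ab by (intro small) auto
    also have "\<dots> \<le> e" using e ab by (simp add: divide_le_eq)
    finally show "\<bar>f b - f a\<bar> \<le> 0 + e" by simp
  qed
  then show ?thesis by simp
qed

text \<open>
  The principle of uniform boundedness, from the Baire category theorem: one of the closed sets
  \<open>{x. \<forall>n. \<parallel>T n x\<parallel> \<le> k}\<close> contains a ball.
\<close>

lemma uniform_boundedness:
  fixes T :: "nat \<Rightarrow> 'a::{real_normed_vector,complete_space} \<Rightarrow> 'b::real_normed_vector"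
  assumes T: "\<And>n. bounded_linear (T n)" and bd: "\<And>x. \<exists>B. \<forall>n. norm (T n x) \<le> B"
  obtains M where "\<And>n x. norm (T n x) \<le> M * norm x"
proof -
  define F where "F k = {x. \<forall>n. norm (T n x) \<le> real k}" for k
  have F: "closed (F k)" for k
  proof -
    have "F k = (\<Inter>n. {x. norm (T n x) \<le> real k})" by (auto simp: F_def)
    also have "closed \<dots>"
      by (intro closed_INT ballI closed_Collect_le continuous_intros bounded_linear.continuous_on[OF T])
    finally show ?thesis .
  qed
  have "(\<Union>k. F k) = UNIV"
  proof (intro equalityI subset_UNIV subsetI)
    fix x
    obtain B where "\<forall>n. norm (T n x) \<le> B" using bd by blast
    then have "x \<in> F (nat \<lceil>B\<rceil>)" unfolding F_def by (auto intro: order_trans simp: of_nat_ceiling)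
    then show "x \<in> (\<Union>k. F k)" by blast
  qed
  have "\<exists>k. interior (F k) \<noteq> {}"
  proof (rule ccontr)
    assume "\<not> ?thesis"
    then have "Met_TC.mtopology interior_of (\<Union>(range F)) = {}"
      by (intro Met_TC.metric_Baire_category_alt) (auto simp: F complete_UNIV)
    then show False using \<open>(\<Union>k. F k) = UNIV\<close> by simp
  qed
  then obtain k c where "c \<in> interior (F k)" by blast
  then obtain r where r: "0 < r" "cball c r \<subseteq> F k" by (meson mem_interior_cball)
  show thesis
  proof (rule that)
    fix n x
    interpret bounded_linear "T n" by (rule T)
    show "norm (T n x) \<le> (2 * real k / r) * norm x"
    proof (cases "x = 0")
      case False
      define y where "y = (r / norm x) *\<^sub>R x"
      have "norm y = r" using r(1) False by (simp add: y_def)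
      then have "c + y \<in> F k" "c \<in> F k" using r by (auto simp: dist_norm)
      then have "norm (T n (c + y)) \<le> k" "norm (T n c) \<le> k" by (auto simp: F_def)
      moreover have "T n y = T n (c + y) - T n c" by (simp add: add)
      ultimately have "norm (T n y) \<le> 2 * k" using norm_triangle_ineq4[of "T n (c + y)" "T n c"] by simp
      moreover have "norm (T n y) = (r / norm x) * norm (T n x)" using r(1) by (simp add: y_def scaleR)
      ultimately show ?thesis using r(1) False by (simp add: field_simps)
    qed (simp add: zero)
  qed
qed

text \<open>
  Apply the bounded operator \<open>S t\<close> to the difference quotients at \<open>0\<close> that define \<open>G x\<close>.
\<close>

lemma generator_commutes_with_semigroup:
  assumes gen: "semigroup_generated_by X N S D G" and N: "\<And>x. 0 \<le> N x"
    and t: "0 \<le> t" and x: "x \<in> D"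
  shows "S t x \<in> D" "G (S t x) = S t (G x)"
proof -
  have semi: "\<And>t. 0 \<le> t \<Longrightarrow> S t ` X \<subseteq> X" "\<And>t. 0 \<le> t \<Longrightarrow> linear_operator_on X (S t)"
      "\<And>t. 0 \<le> t \<Longrightarrow> \<exists>M. \<forall>x\<in>X. N (S t x) \<le> M * N x"
      "\<And>s t x. 0 \<le> s \<Longrightarrow> 0 \<le> t \<Longrightarrow> x \<in> X \<Longrightarrow> S (s + t) x = S s (S t x)"
    and graph: "generator_graph X N S = {(x, G x) |x. x \<in> D}"
    using gen unfolding semigroup_generated_by_def C0_semigroup_def by blast+
  have "(x, G x) \<in> generator_graph X N S" using graph x by blast
  then have xX: "x \<in> X" "G x \<in> X" and lim: "((\<lambda>h. N ((1 / h) *\<^sub>R (S h x - x) - G x)) \<longlongrightarrow> 0) (at_right 0)"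
    unfolding generator_graph_def by auto
  have X: "subspace X" and S_add: "\<And>x y. x \<in> X \<Longrightarrow> y \<in> X \<Longrightarrow> S t (x + y) = S t x + S t y"
    and S_scale: "\<And>c x. x \<in> X \<Longrightarrow> S t (c *\<^sub>R x) = c *\<^sub>R S t x"
    using semi(2)[OF t] unfolding linear_operator_on_def by blast+
  have S_diff: "S t (x - y) = S t x - S t y" if "x \<in> X" "y \<in> X" for x y
    using S_add[of x "(-1) *\<^sub>R y"] S_scale[of y "-1"] subspace_scale[OF X, of y "-1"] that by simp
  obtain M where M: "\<And>x. x \<in> X \<Longrightarrow> N (S t x) \<le> M * N x" using semi(3)[OF t] by blast
  have "((\<lambda>h. N ((1 / h) *\<^sub>R (S h (S t x) - S t x) - S t (G x))) \<longlongrightarrow> 0) (at_right 0)"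
  proof (rule Lim_null_comparison)
    show "((\<lambda>h. M * N ((1 / h) *\<^sub>R (S h x - x) - G x)) \<longlongrightarrow> 0) (at_right 0)"
      using tendsto_mult_left[OF lim, of M] by simp
    show "\<forall>\<^sub>F h in at_right 0. norm (N ((1 / h) *\<^sub>R (S h (S t x) - S t x) - S t (G x)))
        \<le> M * N ((1 / h) *\<^sub>R (S h x - x) - G x)"
      using eventually_at_right_less[of 0]
    proof eventually_elim
      fix h :: real assume h: "0 < h"
      have Sh: "S h x \<in> X" using semi(1)[of h] h xX by auto
      have "S h (S t x) = S t (S h x)"
        using semi(4)[of h t x] semi(4)[of t h x] h t xX by (simp add: add.commute)
      then have "(1 / h) *\<^sub>R (S h (S t x) - S t x) - S t (G x) = S t ((1 / h) *\<^sub>R (S h x - x) - G x)"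
        using xX Sh by (simp add: S_diff S_scale subspace_diff[OF X] subspace_scale[OF X])
      moreover have "(1 / h) *\<^sub>R (S h x - x) - G x \<in> X"
        using xX Sh by (simp add: subspace_diff[OF X] subspace_scale[OF X])
      ultimately show "norm (N ((1 / h) *\<^sub>R (S h (S t x) - S t x) - S t (G x)))
        \<le> M * N ((1 / h) *\<^sub>R (S h x - x) - G x)" using M N by simp
    qed
  qed
  then have "(S t x, S t (G x)) \<in> generator_graph X N S"
    using semi(1)[OF t] xX unfolding generator_graph_def by auto
  then show "S t x \<in> D" "G (S t x) = S t (G x)" unfolding graph by auto
qed

lemma has_vector_derivative_from_right:
  fixes f :: "real \<Rightarrow> 'a::real_normed_vector"
  assumes "((\<lambda>h. norm ((1 / h) *\<^sub>R (f (s + h) - f s) - D)) \<longlongrightarrow> 0) (at_right 0)"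
  shows "(f has_vector_derivative D) (at s within {s..})"
  unfolding has_vector_derivative_def has_derivative_within_alt
proof (intro conjI allI impI)
  show "bounded_linear (\<lambda>h. h *\<^sub>R D)" by (rule bounded_linear_scaleR_left)
  fix e :: real assume e: "0 < e"
  have "\<forall>\<^sub>F h in at_right 0. norm ((1 / h) *\<^sub>R (f (s + h) - f s) - D) < e"
    by (rule order_tendstoD(2)[OF assms e])
  then obtain d where d: "0 < d" "\<And>h. 0 < h \<Longrightarrow> h < d \<Longrightarrow> norm ((1 / h) *\<^sub>R (f (s + h) - f s) - D) < e"
    unfolding eventually_at_right_field by auto
  show "\<exists>d>0. \<forall>r\<in>{s..}. norm (r - s) < d \<longrightarrow> norm (f r - f s - (r - s) *\<^sub>R D) \<le> e * norm (r - s)"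
  proof (intro exI[of _ d] conjI d(1) ballI impI)
    fix r assume r: "r \<in> {s..}" "norm (r - s) < d"
    show "norm (f r - f s - (r - s) *\<^sub>R D) \<le> e * norm (r - s)"
    proof (cases "r = s")
      case False
      define h where "h = r - s"
      have h: "0 < h" "h < d" "r = s + h" using False r by (auto simp: h_def)
      have "f r - f s - (r - s) *\<^sub>R D = h *\<^sub>R ((1 / h) *\<^sub>R (f (s + h) - f s) - D)"
        using h by (simp add: algebra_simps)
      also have "norm \<dots> = h * norm ((1 / h) *\<^sub>R (f (s + h) - f s) - D)" using h by simp
      also have "\<dots> \<le> h * e" using d(2)[of h] h by (intro mult_left_mono) auto
      finally show ?thesis using h by (simp add: mult.commute)
    qed simp
  qed
qed

lemma has_vector_derivative_reversed_time:
  fixes F :: "real \<Rightarrow> 'a::real_normed_vector"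
  assumes F: "(F has_vector_derivative F') (at (t - s) within {0..})" and s: "s < t"
  shows "((\<lambda>r. F (t - r)) has_vector_derivative - F') (at s)"
proof -
  have "(F has_vector_derivative F') (at (t - s))"
    using F s at_within_interior[of "t - s" "{0..}"] by simp
  moreover have "((\<lambda>r. t - r) has_vector_derivative - 1) (at s)"
    by (auto intro!: derivative_eq_intros)
  ultimately have "(F \<circ> (\<lambda>r. t - r) has_vector_derivative (-1) *\<^sub>R F') (at s)"
    by (rule vector_diff_chain_at[rotated])
  then show ?thesis by (simp only: o_def scaleR_minus1_left)
qed

section \<open>The heat semigroup as a function of the operator\<close>

locale heat_operator = nonneg_operator +
  fixes T
  assumes heat: "heat_semigroup DA A T"
begin

lemma T_generated: "semigroup_generated_by UNIV norm T DA (\<lambda>x. - A x)"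
  using heat by (simp add: heat_semigroup_def)

lemma T_linear: "0 \<le> t \<Longrightarrow> linear (T t)"
  and T_bound: "0 \<le> t \<Longrightarrow> \<exists>M. \<forall>x. norm (T t x) \<le> M * norm x"
  and T_0: "T 0 x = x"
  and T_add: "0 \<le> s \<Longrightarrow> 0 \<le> t \<Longrightarrow> T (s + t) x = T s (T t x)"
  and T_right: "((\<lambda>t. norm (T t x - x)) \<longlongrightarrow> 0) (at_right 0)"
  using T_generated unfolding semigroup_generated_by_def C0_semigroup_def linear_operator_on_def
  by (auto intro!: linearI)

lemma T_bounded_linear:
  assumes "0 \<le> t" shows "bounded_linear (T t)"
proof -
  obtain M where "\<And>x. norm (T t x) \<le> M * norm x" using T_bound[OF assms] by blast
  then show ?thesis using T_linear[OF assms]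
    by (intro bounded_linear_intro[where K=M]) (auto simp: linear_add linear_scale mult.commute)
qed

lemma A_T: "0 \<le> t \<Longrightarrow> x \<in> DA \<Longrightarrow> T t x \<in> DA \<and> A (T t x) = T t (A x)"
  using generator_commutes_with_semigroup[OF T_generated norm_ge_zero, of t x]
    linear_neg[OF T_linear, of t "A x"] by simp

lemma T_R: "0 \<le> t \<Longrightarrow> T t (R x) = R (T t x)"
  using A_T[OF _ R_domain, of t x] linear_diff[OF T_linear, of t x "R x"]
  by (intro R_unique[symmetric]) (simp_all add: A_R)

text \<open>
  Along a sequence of times tending to \<open>0\<close> the operators are bounded at each vector, by continuity of the orbits at
  \<open>0\<close>, hence bounded uniformly. This is what makes orbits continuous from the left as well.
\<close>

lemma T_locally_bounded:
  obtains d M where "0 < d" "\<And>t x. 0 \<le> t \<Longrightarrow> t \<le> d \<Longrightarrow> norm (T t x) \<le> M * norm x"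
proof (rule ccontr)
  assume neg: "\<not> thesis"
  have "\<exists>t. 0 \<le> t \<and> t \<le> 1 / real (Suc n) \<and> (\<exists>x. norm (T t x) > real n * norm x)" for n
  proof (rule ccontr)
    assume "\<not> ?thesis"
    then have "\<And>t x. 0 \<le> t \<Longrightarrow> t \<le> 1 / real (Suc n) \<Longrightarrow> norm (T t x) \<le> real n * norm x"
      by (meson not_less)
    moreover have "0 < 1 / real (Suc n)" by simp
    ultimately show False using that neg by blast
  qed
  then obtain \<tau> where \<tau>: "\<And>n. 0 \<le> \<tau> n" "\<And>n. \<tau> n \<le> 1 / real (Suc n)"
      "\<And>n. \<exists>x. norm (T (\<tau> n) x) > real n * norm x" by metis
  have "\<exists>B. \<forall>n. norm (T (\<tau> n) x) \<le> B" for x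
  proof -
    have "\<forall>\<^sub>F t in at_right 0. norm (T t x - x) < 1"
      by (rule order_tendstoD(2)[OF T_right]) simp
    then obtain b where b: "0 < b" "\<And>t. 0 < t \<Longrightarrow> t < b \<Longrightarrow> norm (T t x - x) < 1"
      unfolding eventually_at_right_field by auto
    obtain K where K: "1 / real (Suc K) < b" using b(1) nat_approx_posE by blast
    have big: "norm (T (\<tau> n) x) \<le> norm x + 1" if "K \<le> n" for n
    proof -
      have "\<tau> n \<le> 1 / real (Suc K)"
        using \<tau>(2)[of n] that by (meson frac_le of_nat_0_less_iff of_nat_mono order_trans Suc_le_mono zero_less_Suc zero_le_one order_refl)
      then have "\<tau> n < b" using K by simp
      then show ?thesis using b(2)[of "\<tau> n"] \<tau>(1)[of n] norm_triangle_ineq2[of "T (\<tau> n) x" x]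
        by (cases "\<tau> n = 0") (auto simp: T_0)
    qed
    have "norm (T (\<tau> n) x) \<le> norm x + 1 + (\<Sum>i<K. norm (T (\<tau> i) x))" for n
    proof (cases "n < K")
      case True
      then have "norm (T (\<tau> n) x) \<le> (\<Sum>i<K. norm (T (\<tau> i) x))" by (intro member_le_sum) auto
      then show ?thesis using norm_ge_zero[of x] by linarith
    next
      case False
      then have "norm (T (\<tau> n) x) \<le> norm x + 1" using big by simp
      moreover have "0 \<le> (\<Sum>i<K. norm (T (\<tau> i) x))" by (intro sum_nonneg) auto
      ultimately show ?thesis by linarith
    qed
    then show ?thesis by blast
  qed
  from uniform_boundedness[OF T_bounded_linear[OF \<tau>(1)] this]
  obtain M where M: "\<And>n x. norm (T (\<tau> n) x) \<le> M * norm x" by blast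
  obtain n where "M \<le> real n" using real_arch_simple by blast
  moreover obtain x where "real n * norm x < norm (T (\<tau> n) x)" using \<tau>(3) by blast
  ultimately show False using M[of n x] mult_right_mono[of M "real n" "norm x"] by simp
qed

lemma T_bounded_on:
  obtains M where "0 \<le> M" "\<And>t x. 0 \<le> t \<Longrightarrow> t \<le> K \<Longrightarrow> norm (T t x) \<le> M * norm x"
proof -
  obtain d M where d: "0 < d" "\<And>t x. 0 \<le> t \<Longrightarrow> t \<le> d \<Longrightarrow> norm (T t x) \<le> M * norm x"
    using T_locally_bounded by blast
  have M: "norm (T t x) \<le> \<bar>M\<bar> * norm x" if "0 \<le> t" "t \<le> d" for t x
    using d(2)[OF that, of x] by (smt (verit) mult_right_mono norm_ge_zero)
  have "\<forall>t x. 0 \<le> t \<longrightarrow> t \<le> real j * d \<longrightarrow> norm (T t x) \<le> (\<bar>M\<bar> + 1) ^ j * norm x" for j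
  proof (induction j)
    case 0 show ?case by (auto simp: T_0)
  next
    case (Suc j)
    show ?case
    proof (intro allI impI)
      fix t x assume t: "0 \<le> t" "t \<le> real (Suc j) * d"
      show "norm (T t x) \<le> (\<bar>M\<bar> + 1) ^ Suc j * norm x"
      proof (cases "t \<le> d")
        case True
        have "norm (T t x) \<le> \<bar>M\<bar> * norm x" by (rule M[OF t(1) True])
        also have "\<dots> \<le> (\<bar>M\<bar> + 1) ^ Suc j * norm x"
          using power_increasing[of 1 "Suc j" "\<bar>M\<bar> + 1"] by (intro mult_right_mono) auto
        finally show ?thesis .
      next
        case False
        have "T t x = T d (T (t - d) x)" using T_add[of d "t - d" x] d(1) False by simp
        also have "norm \<dots> \<le> \<bar>M\<bar> * norm (T (t - d) x)" using d(1) by (intro M) auto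
        also have "\<dots> \<le> (\<bar>M\<bar> + 1) * ((\<bar>M\<bar> + 1) ^ j * norm x)"
          using Suc.IH False t by (intro mult_mono) (auto simp: algebra_simps)
        finally show ?thesis by simp
      qed
    qed
  qed
  moreover obtain j where "K / d \<le> real j" using real_arch_simple by blast
  then have "K \<le> real j * d" using d(1) by (simp add: divide_le_eq)
  ultimately show thesis using that[of "(\<bar>M\<bar> + 1) ^ j"] by force
qed

lemma T_tendsto: "((\<lambda>t. T t x) \<longlongrightarrow> x) (at_right 0)"
  using T_right[of x] by (simp add: tendsto_norm_zero_iff LIM_zero_iff)

text \<open>
  For \<open>s < t\<close> the difference is \<open>T s (T (t - s) x - x)\<close>, which is small uniformly in \<open>s\<close> by the local bound.
\<close>

lemma continuous_on_T: "continuous_on {0..} (\<lambda>t. T t x)"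
  unfolding continuous_on_iff
proof (intro ballI allI impI)
  fix t e :: real assume t: "t \<in> {0..}" and e: "0 < e"
  obtain M where M: "0 \<le> M" "\<And>s x. 0 \<le> s \<Longrightarrow> s \<le> t + 1 \<Longrightarrow> norm (T s x) \<le> M * norm x"
    using T_bounded_on[of "t + 1"] by blast
  have "\<forall>\<^sub>F h in at_right 0. norm (T h x - x) < e / (M + 1)"
    using e M(1) by (intro order_tendstoD(2)[OF T_right]) simp
  then obtain b where b: "0 < b" "\<And>h. 0 < h \<Longrightarrow> h < b \<Longrightarrow> norm (T h x - x) < e / (M + 1)"
    unfolding eventually_at_right_field by auto
  have main: "norm (T r x - T s x) < e" if "0 \<le> s" "s \<le> r" "r - s < b" "s \<le> t + 1" for r s
  proof (cases "s = r")
    case False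
    have "T r x - T s x = T s (T (r - s) x - x)"
      using T_add[of s "r - s" x] that by (simp add: linear_diff[OF T_linear])
    also have "norm \<dots> \<le> M * norm (T (r - s) x - x)" using that by (intro M) auto
    also have "\<dots> \<le> M * (e / (M + 1))" using b(2)[of "r - s"] that False M(1) by (intro mult_left_mono) auto
    also have "\<dots> < e" using e M(1) by (simp add: divide_less_eq algebra_simps)
    finally show ?thesis .
  qed (use e in simp)
  show "\<exists>d>0. \<forall>s\<in>{0..}. dist s t < d \<longrightarrow> dist (T s x) (T t x) < e"
  proof (intro exI[of _ b] conjI b(1) ballI impI)
    fix s assume s: "s \<in> {0..}" "dist s t < b"
    show "dist (T s x) (T t x) < e"
    proof (cases "s \<le> t")
      case True
      then show ?thesis using main[of s t] s t by (simp add: dist_norm norm_minus_commute dist_real_def)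
    next
      case False
      then show ?thesis using main[of t s] s t by (simp add: dist_norm dist_real_def)
    qed
  qed
qed

lemma R_injective: "R x = 0 \<Longrightarrow> x = 0"
  using R_shift[of x] A_scaleR[OF subspace_0[OF subspace_domain], of 0] by simp

lemma T_R_right_derivative:
  assumes s: "0 \<le> s"
  shows "((\<lambda>s. T s (R x)) has_vector_derivative - A (T s (R x))) (at s within {s..})"
proof (rule has_vector_derivative_from_right)
  have "T s (R x) \<in> DA" using A_T[OF s R_domain] by simp
  then have "(T s (R x), - A (T s (R x))) \<in> generator_graph UNIV norm T"
    using T_generated unfolding semigroup_generated_by_def by blast
  then have "((\<lambda>h. norm ((1 / h) *\<^sub>R (T h (T s (R x)) - T s (R x)) - - A (T s (R x)))) \<longlongrightarrow> 0) (at_right 0)"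
    unfolding generator_graph_def by simp
  then show "((\<lambda>h. norm ((1 / h) *\<^sub>R (T (s + h) (R x) - T s (R x)) - - A (T s (R x)))) \<longlongrightarrow> 0) (at_right 0)"
  proof (rule Lim_transform_eventually)
    show "\<forall>\<^sub>F h in at_right 0. norm ((1 / h) *\<^sub>R (T h (T s (R x)) - T s (R x)) - - A (T s (R x)))
      = norm ((1 / h) *\<^sub>R (T (s + h) (R x) - T s (R x)) - - A (T s (R x)))"
      using eventually_at_right_less[of 0]
      by eventually_elim (use T_add s in \<open>simp add: add.commute[of s]\<close>)
  qed
qed

text \<open>
  Pair \<open>T s (R x)\<close> with \<open>exp (- (t - s) A) R R y\<close>. As a function of \<open>s\<close> this has right derivative zero, because \<open>A\<close>
  is symmetric, so its values at \<open>s = 0\<close> and \<open>s = t\<close> agree. The factors \<open>R\<close> make all functions differentiable up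
  to the end point and are cancelled in the end, as \<open>R\<close> is injective.
\<close>

lemma T_eq_fc:
  assumes t: "0 < t" shows "T t x = fc (\<lambda>l. exp (- t * l)) x"
proof -
  let ?k = "\<lambda>s l. exp (- s * l) * ((1 / (1 + l)) * (1 / (1 + l)))"
  let ?k' = "\<lambda>s l. exp (- s * l) * (- l * ((1 / (1 + l)) * (1 / (1 + l))))"
  have van2: "vanishing (\<lambda>l. (1 / (1 + l)) * (1 / (1 + l)))"
    by (intro vanishing_mult vanishing_resolvent)
  \<comment> \<open>Two factors \<open>1 / (1 + l)\<close> keep the second time derivative bounded up to time \<open>0\<close>.\<close>
  have rb: "0 \<le> (1 / (1 + l)) * (1 / (1 + l))" "l * ((1 / (1 + l)) * (1 / (1 + l))) \<le> 1 / (1 + l)"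
    "l\<^sup>2 * ((1 / (1 + l)) * (1 / (1 + l))) \<le> 1" if "0 \<le> l" for l :: real
  proof -
    have lr: "0 \<le> l * (1 / (1 + l))" "l * (1 / (1 + l)) \<le> 1" using that by (auto simp: divide_le_eq)
    show "0 \<le> (1 / (1 + l)) * (1 / (1 + l))" by simp
    show "l * ((1 / (1 + l)) * (1 / (1 + l))) \<le> 1 / (1 + l)"
      using mult_right_mono[OF lr(2), of "1 / (1 + l)"] that by simp
    show "l\<^sup>2 * ((1 / (1 + l)) * (1 / (1 + l))) \<le> 1"
      using mult_le_one[OF lr(2) lr(1) lr(2)] by (simp add: power2_eq_square)
  qed
  have vk: "vanishing (?k s)" "vanishing (?k' s)" if s: "0 \<le> s" for s
  proof -
    have e: "\<bar>exp (- s * l)\<bar> \<le> 1" if "0 \<le> l" for l using s that by simp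
    have c: "continuous_on {0..} (?k s)" "continuous_on {0..} (?k' s)"
      by (auto intro!: continuous_intros)
    have "((?k s) \<longlongrightarrow> 0) at_top"
    proof (rule Lim_null_comparison)
      show "\<forall>\<^sub>F l in at_top. norm (?k s l) \<le> (1 / (1 + l)) * (1 / (1 + l))"
        using eventually_ge_at_top[of 0]
        by eventually_elim (use e rb(1) in \<open>simp add: abs_mult mult_le_cancel_right1 divide_le_eq\<close>)
    qed (use van2 in \<open>simp add: vanishing_def\<close>)
    moreover have "((?k' s) \<longlongrightarrow> 0) at_top"
    proof (rule Lim_null_comparison)
      show "\<forall>\<^sub>F l in at_top. norm (?k' s l) \<le> 1 / (1 + l)"
        using eventually_ge_at_top[of 0]
      proof eventually_elim
        fix l :: real assume l: "0 \<le> l"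
        have "norm (?k' s l) = \<bar>exp (- s * l)\<bar> * (l * ((1 / (1 + l)) * (1 / (1 + l))))"
          using l by (simp add: abs_mult)
        also have "\<dots> \<le> 1 * (1 / (1 + l))" using e[OF l] rb(2)[OF l] l by (intro mult_mono) auto
        finally show "norm (?k' s l) \<le> 1 / (1 + l)" by simp
      qed
    qed (use vanishing_resolvent in \<open>simp add: vanishing_def\<close>)
    ultimately show "vanishing (?k s)" "vanishing (?k' s)" using c by (auto simp: vanishing_def)
  qed
  have dk: "((\<lambda>s. fc (?k s) y) has_vector_derivative fc (?k' s) y) (at s within {0..})" if "0 \<le> s" for s y
  proof (rule fc_has_vector_derivative[where f''="\<lambda>s l. exp (- s * l) * (l\<^sup>2 * ((1 / (1 + l)) * (1 / (1 + l))))" and M=1])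
    fix l r :: real assume l: "0 \<le> l" "r \<in> {0..}"
    show "\<bar>exp (- r * l) * (l\<^sup>2 * ((1 / (1 + l)) * (1 / (1 + l))))\<bar> \<le> 1"
      unfolding abs_mult[of "exp _"] using rb(3)[OF l(1)] rb(1)[OF l(1)] l by (intro mult_le_one) auto
  qed (use that vk in \<open>auto intro!: derivative_eq_intros simp: power2_eq_square\<close>)
  have main: "R (R (T t (R x))) = fc (?k t) (R x)" for x
  proof -
    have "inner (fc (?k t) (R x)) y = inner (R (R (T t (R x)))) y" for y
    proof -
      let ?f = "\<lambda>s. inner (T s (R x)) (fc (?k (t - s)) y)"
      have d: "(?f has_vector_derivative
          inner (T s (R x)) (- fc (?k' (t - s)) y) + inner (- A (T s (R x))) (fc (?k (t - s)) y)) (at s within {s..})"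
        if "0 \<le> s" "s < t" for s
      proof -
        have "((\<lambda>r. fc (?k (t - r)) y) has_vector_derivative - fc (?k' (t - s)) y) (at s)"
          by (rule has_vector_derivative_reversed_time[OF dk]) (use that in simp_all)
        from bounded_bilinear.has_vector_derivative[OF bounded_bilinear_inner T_R_right_derivative[OF that(1), of x]
            has_vector_derivative_at_within[OF this]]
        show ?thesis .
      qed
      have "?f t = ?f 0"
      proof (rule right_derivative_zero_constant[where f="?f"])
        have "continuous_on {0..t} (\<lambda>s. fc (?k (t - s)) y)"
        proof (rule continuous_on_compose2[of "{0..}" "\<lambda>r. fc (?k r) y"])
          show "continuous_on {0..} (\<lambda>r. fc (?k r) y)"
            by (rule continuous_on_vector_derivative[OF dk]) simp
        qed (auto intro!: continuous_intros)
        then show "continuous_on {0..t} ?f"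
          by (intro continuous_on_inner continuous_on_subset[OF continuous_on_T]) auto
        fix s assume s: "0 \<le> s" "s < t"
        have ak: "fc (?k (t - s)) y \<in> DA" "A (fc (?k (t - s)) y) = - fc (?k' (t - s)) y"
        proof -
          have ts: "0 \<le> t - s" using s by simp
          have e: "(\<lambda>l. l * ?k (t - s) l) = (\<lambda>l. (-1) * ?k' (t - s) l)" by (auto simp: algebra_simps)
          have "vanishing (\<lambda>l. l * ?k (t - s) l)" unfolding e by (intro vanishing_cmult vk ts)
          from A_fc[OF vk(1)[OF ts] this, of y] show "fc (?k (t - s)) y \<in> DA"
              "A (fc (?k (t - s)) y) = - fc (?k' (t - s)) y"
            unfolding e fc_cmult[OF vk(2)[OF ts]] by auto
        qed
        have "T s (R x) \<in> DA" using A_T[OF s(1) R_domain] by simp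
        then have "inner (T s (R x)) (- fc (?k' (t - s)) y) + inner (- A (T s (R x))) (fc (?k (t - s)) y) = 0"
          using A_sym[OF _ ak(1)] ak(2) by simp
        then show "(?f has_vector_derivative 0) (at s within {s..})" using d[OF s] by simp
      qed (use t in simp)
      moreover have "fc (?k 0) y = R (R y)"
        using fc_mult[OF vanishing_resolvent vanishing_resolvent, of y] by (simp add: fc_resolvent)
      ultimately show ?thesis
        using fc_sym[OF vk(1), of t "R x" y] t by (simp add: T_0 sym)
    qed
    then have "fc (?k t) (R x) = R (R (T t (R x)))" 
      using vector_eq_rdot[of "fc (?k t) (R x)" "R (R (T t (R x)))"] by blast
    then show ?thesis by (rule HOL.sym)
  qed
  have et: "vanishing (\<lambda>l. exp (- t * l))"
    using vanishing_exp_tempered[OF t tempered_const[of 1]] by simp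
  have "fc (?k t) z = fc (\<lambda>l. exp (- t * l)) (R (R z))" for z
    by (simp only: fc_mult[OF et van2] fc_mult[OF vanishing_resolvent vanishing_resolvent] fc_resolvent)
  moreover have "R (fc (\<lambda>l. exp (- t * l)) z) = fc (\<lambda>l. exp (- t * l)) (R z)" for z
    by (rule fc_commute[OF bounded_linear_R _ et]) simp
  ultimately have "R (R (R (T t x - fc (\<lambda>l. exp (- t * l)) x))) = 0"
    using main[of x] t by (simp add: T_R diff)
  then have "T t x - fc (\<lambda>l. exp (- t * l)) x = 0" by (rule R_injective[OF R_injective[OF R_injective]])
  then show ?thesis by simp
qed

end

section \<open>The damped oscillator\<close>

text \<open>
  The solutions of \<open>f'' = k f\<close> with \<open>f 0 = 0\<close>, \<open>f' 0 = 1\<close> (\<open>osc_sin\<close>) and with \<open>f 0 = 1\<close>, \<open>f' 0 = 0\<close> (\<open>osc_cos\<close>).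
\<close>

definition osc_sin :: "real \<Rightarrow> real \<Rightarrow> real" where
  "osc_sin k t = (if k < 0 then sin (t * sqrt (- k)) / sqrt (- k)
     else if k = 0 then t else sinh (t * sqrt k) / sqrt k)"

definition osc_cos :: "real \<Rightarrow> real \<Rightarrow> real" where
  "osc_cos k t = (if k \<le> 0 then cos (t * sqrt (- k)) else cosh (t * sqrt k))"

lemma osc_sin_deriv: "(osc_sin k has_real_derivative osc_cos k t) (at t)"
proof -
  have "((\<lambda>t. sin (t * r) / r) has_real_derivative cos (t * r)) (at t)"
    "((\<lambda>t. sinh (t * r) / r) has_real_derivative cosh (t * r)) (at t)" if "r \<noteq> 0" for r
    using that by (auto intro!: derivative_eq_intros)
  then show ?thesis
    unfolding osc_sin_def[abs_def] osc_cos_def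
    by (cases k "0::real" rule: linorder_cases) auto
qed

lemma osc_cos_deriv: "(osc_cos k has_real_derivative k * osc_sin k t) (at t)"
proof -
  have "((\<lambda>t. cos (t * r)) has_real_derivative - (r * r) * (sin (t * r) / r)) (at t)"
    "((\<lambda>t. cosh (t * r)) has_real_derivative (r * r) * (sinh (t * r) / r)) (at t)" for r
    by (auto intro!: derivative_eq_intros)
  from this(1)[of "sqrt (- k)"] this(2)[of "sqrt k"] show ?thesis
    unfolding osc_sin_def osc_cos_def[abs_def]
    by (cases k "0::real" rule: linorder_cases) auto
qed

lemma continuous_on_sin_quotient: "continuous_on UNIV (\<lambda>x::real. if x = 0 then 1 else sin x / x)"
  and continuous_on_sinh_quotient: "continuous_on UNIV (\<lambda>x::real. if x = 0 then 1 else sinh x / x)"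
proof -
  have gen: "continuous_on UNIV (\<lambda>x::real. if x = 0 then 1 else f x / x)"
    if f: "continuous_on UNIV f" "(f has_real_derivative 1) (at 0)" "f 0 = 0" for f
    unfolding continuous_on_eq_continuous_within
  proof
    fix x :: real
    let ?g = "\<lambda>x::real. if x = 0 then 1 else f x / x"
    show "isCont ?g x"
    proof (cases "x = 0")
      case True
      have "(\<lambda>h. f h / h) \<midarrow>0\<rightarrow> 1" using f(2,3) by (simp add: DERIV_def)
      then have "?g \<midarrow>0\<rightarrow> 1" by (rule Lim_transform_eventually) (auto simp: eventually_at_filter)
      then show ?thesis using True by (simp add: isCont_def)
    next
      case False
      have "continuous_on (- {0}) (\<lambda>x. f x / x)"
        using f(1) by (auto intro!: continuous_intros intro: continuous_on_subset)
      then have "continuous_on (- {0}) ?g" by (rule continuous_on_eq) auto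
      then show ?thesis using False by (subst (asm) continuous_on_eq_continuous_at) auto
    qed
  qed
  show "continuous_on UNIV (\<lambda>x::real. if x = 0 then 1 else sin x / x)"
    by (rule gen) (auto intro!: continuous_intros derivative_eq_intros)
  show "continuous_on UNIV (\<lambda>x::real. if x = 0 then 1 else sinh x / x)"
    by (rule gen) (auto intro!: continuous_intros derivative_eq_intros)
qed

text \<open>
  The trigonometric and the hyperbolic branch are \<open>t\<close> times \<open>sin r / r\<close> and \<open>sinh r / r\<close> for \<open>r = t sqrt \<bar>k\<bar>\<close>, which are
  continuous and agree at \<open>r = 0\<close>.
\<close>

lemma continuous_on_osc_sin: "continuous_on S (\<lambda>k. osc_sin k t)"
proof -
  let ?s = "\<lambda>x::real. if x = 0 then 1 else sin x / x" and ?h = "\<lambda>x::real. if x = 0 then 1 else sinh x / x"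
  have "continuous_on UNIV (\<lambda>k. if k \<le> 0 then t * ?s (t * sqrt (- k)) else t * ?h (t * sqrt k))"
  proof (rule continuous_on_cases_le[where h="\<lambda>k. k"])
    show "continuous_on {k \<in> UNIV. k \<le> 0} (\<lambda>k. t * ?s (t * sqrt (- k)))"
      by (rule continuous_on_mult[OF continuous_on_const],
          rule continuous_on_compose2[OF continuous_on_sin_quotient])
        (auto intro!: continuous_intros)
    show "continuous_on {k \<in> UNIV. 0 \<le> k} (\<lambda>k. t * ?h (t * sqrt k))"
      by (rule continuous_on_mult[OF continuous_on_const],
          rule continuous_on_compose2[OF continuous_on_sinh_quotient])
        (auto intro!: continuous_intros)
  qed auto
  moreover have "(\<lambda>k. if k \<le> 0 then t * ?s (t * sqrt (- k)) else t * ?h (t * sqrt k)) = (\<lambda>k. osc_sin k t)"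
    by (auto simp: osc_sin_def fun_eq_iff)
  ultimately have "continuous_on UNIV (\<lambda>k. osc_sin k t)" by (simp only:)
  then show ?thesis by (rule continuous_on_subset) simp
qed

lemma continuous_on_osc_cos: "continuous_on S (\<lambda>k. osc_cos k t)"
proof -
  have "continuous_on UNIV (\<lambda>k. if k \<le> 0 then cos (t * sqrt (- k)) else cosh (t * sqrt k))"
    by (rule continuous_on_cases_le[where h="\<lambda>k. k"]) (auto intro!: continuous_intros)
  then show ?thesis unfolding osc_cos_def by (rule continuous_on_subset) simp
qed

text \<open>
  The solutions of \<open>u'' + u' + l u = 0\<close> with \<open>u 0 = 0\<close>, \<open>u' 0 = 1\<close> (\<open>osc_q\<close>) and with \<open>u 0 = 1\<close>, \<open>u' 0 = 0\<close> (\<open>osc_p\<close>).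
  They satisfy the system \<open>q' = p - q\<close>, \<open>p' = - l q\<close>; the explicit formulas matter for the continuity in \<open>l\<close> and for
  the slow mode at low frequencies.
\<close>

definition osc_q :: "real \<Rightarrow> real \<Rightarrow> real" where
  "osc_q t l = exp (- t / 2) * osc_sin (1/4 - l) t"

definition osc_p :: "real \<Rightarrow> real \<Rightarrow> real" where
  "osc_p t l = exp (- t / 2) * (osc_cos (1/4 - l) t + osc_sin (1/4 - l) t / 2)"

lemma osc_q_deriv: "((\<lambda>t. osc_q t l) has_real_derivative osc_p t l - osc_q t l) (at t within S)"
  unfolding osc_q_def osc_p_def
  by (auto intro!: derivative_eq_intros DERIV_subset[OF osc_sin_deriv subset_UNIV] simp: field_simps)

lemma osc_p_deriv: "((\<lambda>t. osc_p t l) has_real_derivative - l * osc_q t l) (at t within S)"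
  unfolding osc_q_def osc_p_def
  by (auto intro!: derivative_eq_intros DERIV_subset[OF osc_sin_deriv subset_UNIV]
      DERIV_subset[OF osc_cos_deriv subset_UNIV] simp: field_simps)

lemma osc_0: "osc_q 0 l = 0" "osc_p 0 l = 1"
  by (simp_all add: osc_q_def osc_p_def osc_sin_def osc_cos_def)

lemma continuous_on_osc: "continuous_on S (osc_q t)" "continuous_on S (osc_p t)"
proof -
  have "continuous_on S (\<lambda>l. osc_sin (1/4 - l) t)" "continuous_on S (\<lambda>l. osc_cos (1/4 - l) t)"
    by (rule continuous_on_compose2[OF continuous_on_osc_sin[of UNIV]]; auto intro!: continuous_intros)
      (rule continuous_on_compose2[OF continuous_on_osc_cos[of UNIV]]; auto intro!: continuous_intros)
  then show "continuous_on S (osc_q t)" "continuous_on S (osc_p t)"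
    unfolding osc_q_def[abs_def] osc_p_def[abs_def] by (auto intro!: continuous_intros)
qed

lemma nonincreasing_from_0:
  fixes f f' :: "real \<Rightarrow> real"
  assumes "\<And>s. 0 \<le> s \<Longrightarrow> (f has_real_derivative f' s) (at s)" "\<And>s. 0 \<le> s \<Longrightarrow> f' s \<le> 0" "0 \<le> t"
  shows "f t \<le> f 0"
  by (rule DERIV_nonpos_imp_nonincreasing[OF assms(3)]) (use assms(1,2) in blast)

text \<open>
  The energies \<open>p\<^sup>2 + l q\<^sup>2\<close> and \<open>(p - q)\<^sup>2 + l q\<^sup>2\<close> do not increase.
\<close>

lemma osc_bounds:
  assumes "0 \<le> l" "0 \<le> t" shows "\<bar>osc_p t l\<bar> \<le> 1" "\<bar>osc_q t l\<bar> \<le> 2"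
proof -
  have "(osc_p t l)\<^sup>2 + l * (osc_q t l)\<^sup>2 \<le> (osc_p 0 l)\<^sup>2 + l * (osc_q 0 l)\<^sup>2"
  proof (rule nonincreasing_from_0[where f="\<lambda>t. (osc_p t l)\<^sup>2 + l * (osc_q t l)\<^sup>2"
        and f'="\<lambda>t. - 2 * l * (osc_q t l)\<^sup>2"])
    fix s
    show "((\<lambda>t. (osc_p t l)\<^sup>2 + l * (osc_q t l)\<^sup>2) has_real_derivative - 2 * l * (osc_q s l)\<^sup>2) (at s)"
      by (auto intro!: derivative_eq_intros osc_p_deriv osc_q_deriv simp: algebra_simps power2_eq_square)
  qed (use assms in auto)
  moreover have "0 \<le> l * (osc_q t l)\<^sup>2" using assms by simp
  ultimately have "(osc_p t l)\<^sup>2 \<le> 1" by (simp add: osc_0)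
  then show p: "\<bar>osc_p t l\<bar> \<le> 1" by (simp add: abs_square_le_1)
  have "(osc_p t l - osc_q t l)\<^sup>2 + l * (osc_q t l)\<^sup>2 \<le> (osc_p 0 l - osc_q 0 l)\<^sup>2 + l * (osc_q 0 l)\<^sup>2"
  proof (rule nonincreasing_from_0[where f="\<lambda>t. (osc_p t l - osc_q t l)\<^sup>2 + l * (osc_q t l)\<^sup>2"
        and f'="\<lambda>t. - 2 * (osc_p t l - osc_q t l)\<^sup>2"])
    fix s
    show "((\<lambda>t. (osc_p t l - osc_q t l)\<^sup>2 + l * (osc_q t l)\<^sup>2) has_real_derivative
        - 2 * (osc_p s l - osc_q s l)\<^sup>2) (at s)"
      by (auto intro!: derivative_eq_intros osc_p_deriv osc_q_deriv simp: algebra_simps power2_eq_square)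
  qed (use assms in auto)
  moreover have "0 \<le> l * (osc_q t l)\<^sup>2" using assms by simp
  ultimately have "(osc_p t l - osc_q t l)\<^sup>2 \<le> 1" by (simp add: osc_0)
  then have "\<bar>osc_p t l - osc_q t l\<bar> \<le> 1" by (simp add: abs_square_le_1)
  with p show "\<bar>osc_q t l\<bar> \<le> 2" by linarith
qed

lemma oscillator_unique:
  fixes a b :: "real \<Rightarrow> real"
  assumes l: "0 \<le> l" and a: "\<And>t. 0 \<le> t \<Longrightarrow> (a has_real_derivative b t) (at t)"
    and b: "\<And>t. 0 \<le> t \<Longrightarrow> (b has_real_derivative - l * a t - b t) (at t)"
    and "a 0 = 0" "b 0 = 0" "0 \<le> t"
  shows "a t = 0" "b t = 0"
proof -
  have b0: "b s = 0" if s: "0 \<le> s" for s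
  proof -
    have "(b s)\<^sup>2 + l * (a s)\<^sup>2 \<le> (b 0)\<^sup>2 + l * (a 0)\<^sup>2"
    proof (rule nonincreasing_from_0[where f="\<lambda>t. (b t)\<^sup>2 + l * (a t)\<^sup>2" and f'="\<lambda>t. - 2 * (b t)\<^sup>2"])
      fix r :: real assume "0 \<le> r"
      then show "((\<lambda>t. (b t)\<^sup>2 + l * (a t)\<^sup>2) has_real_derivative - 2 * (b r)\<^sup>2) (at r)"
        by (auto intro!: derivative_eq_intros a b simp: algebra_simps power2_eq_square)
    qed (use s in auto)
    moreover have "0 \<le> l * (a s)\<^sup>2" using l by simp
    ultimately have "(b s)\<^sup>2 \<le> (b 0)\<^sup>2 + l * (a 0)\<^sup>2" by linarith
    then show ?thesis by (simp add: assms(4,5))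
  qed
  then show "b t = 0" using assms by blast
  have d: "(a has_real_derivative 0) (at s)" if "0 \<le> s" for s using a[OF that] b0[OF that] by simp
  have "a t \<le> a 0" by (rule nonincreasing_from_0[OF d]) (use assms in auto)
  moreover have "- a t \<le> - a 0"
    by (rule nonincreasing_from_0[where f="\<lambda>t. - a t" and f'="\<lambda>t. 0"])
      (use assms in \<open>auto intro!: derivative_eq_intros d\<close>)
  ultimately show "a t = 0" using assms by simp
qed

text \<open>
  Both sides, as functions of \<open>s\<close>, solve the oscillator equation with the same initial data.
\<close>

lemma osc_add:
  assumes l: "0 \<le> l" and s: "0 \<le> s" and t: "0 \<le> t"
  shows "osc_q (s + t) l = osc_p s l * osc_q t l + osc_q s l * (osc_p t l - osc_q t l)"
    and "osc_p (s + t) l = osc_p s l * osc_p t l - l * osc_q s l * osc_q t l"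
proof -
  have gen: "osc_p (s + t) l * x + osc_q (s + t) l * y
      = osc_p s l * (osc_p t l * x + osc_q t l * y)
        + osc_q s l * (- l * osc_q t l * x + (osc_p t l - osc_q t l) * y)" for x y
  proof -
    let ?X = "osc_p t l * x + osc_q t l * y" and ?Y = "- l * osc_q t l * x + (osc_p t l - osc_q t l) * y"
    define a where "a r = osc_p (r + t) l * x + osc_q (r + t) l * y - (osc_p r l * ?X + osc_q r l * ?Y)" for r
    define b where "b r = - l * osc_q (r + t) l * x + (osc_p (r + t) l - osc_q (r + t) l) * y
      - (- l * osc_q r l * ?X + (osc_p r l - osc_q r l) * ?Y)" for r
    have sh: "((\<lambda>r. osc_p (r + t) l) has_real_derivative - l * osc_q (r + t) l) (at r)"
      "((\<lambda>r. osc_q (r + t) l) has_real_derivative osc_p (r + t) l - osc_q (r + t) l) (at r)" for r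
      using osc_p_deriv[of l "r + t" UNIV] osc_q_deriv[of l "r + t" UNIV] by (simp_all add: DERIV_shift)
    have "a s = 0"
    proof (rule oscillator_unique(1)[OF l, where a=a and b=b])
      show "(a has_real_derivative b r) (at r)" for r
        unfolding a_def b_def
        by (auto intro!: derivative_eq_intros sh osc_p_deriv osc_q_deriv simp: algebra_simps)
      show "(b has_real_derivative - l * a r - b r) (at r)" for r
        unfolding a_def b_def
        by (auto intro!: derivative_eq_intros sh osc_p_deriv osc_q_deriv simp: algebra_simps)
    qed (use s in \<open>simp_all add: a_def b_def osc_0\<close>)
    then show ?thesis by (simp add: a_def)
  qed
  show "osc_q (s + t) l = osc_p s l * osc_q t l + osc_q s l * (osc_p t l - osc_q t l)"
    using gen[of 0 1] by simp
  show "osc_p (s + t) l = osc_p s l * osc_p t l - l * osc_q s l * osc_q t l"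
    using gen[of 1 0] by simp
qed

section \<open>Asymptotic profiles of the damped oscillator\<close>

text \<open>
  For \<open>i = 0\<close> this is the polynomial in the first sum of the profile of order \<open>m\<close>, at \<open>y = t \<lambda>\<close>. For \<open>i = 1\<close> it is
  the one in the second sum of the profile of order \<open>m + 1\<close>.
\<close>

definition profile_poly :: "nat \<Rightarrow> nat \<Rightarrow> real \<Rightarrow> real" where
  "profile_poly i m y = (\<Sum>j\<le>m. real ((2 * m + i) choose (m + i + j)) * (- y) ^ j / fact j)"

text \<open>
  Pascal's rule: differentiation shifts \<open>j\<close>, and the sum of two neighbouring coefficients for \<open>i\<close> is the coefficient
  for \<open>i + 1\<close>. As a consequence, differentiating \<open>exp (- t l) * profile_poly i m (t * l)\<close> in \<open>t\<close> raises \<open>i\<close>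
  and brings out a factor \<open>- l\<close>.
\<close>

lemma profile_poly_deriv:
  "(profile_poly i m has_real_derivative profile_poly i m y - profile_poly (Suc i) m y) (at y)"
proof -
  let ?c = "\<lambda>i j. real ((2 * m + i) choose (m + i + j))"
  let ?t = "\<lambda>j. (- y) ^ j / fact j"
  have "((\<lambda>y. \<Sum>j\<le>m. ?c i j * (- y) ^ j / fact j) has_real_derivative
      (\<Sum>j\<le>m. ?c i j * (real j * (- y) ^ (j - 1) * (- 1)) / fact j)) (at y)"
    by (auto intro!: derivative_eq_intros sum.cong simp: mult_ac)
  moreover have "(\<Sum>j\<le>m. ?c i j * (real j * (- y) ^ (j - 1) * (- 1)) / fact j) = - (\<Sum>j\<le>m. ?c i (Suc j) * ?t j)"
  proof -
    let ?f = "\<lambda>j. ?c i j * (real j * (- y) ^ (j - 1) * (- 1)) / fact j"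
    have s: "?f (Suc j) = - (?c i (Suc j) * ?t j)" for j
      by (simp add: fact_Suc field_simps del: of_nat_Suc)
    have "(\<Sum>j\<le>m. ?f j) = (\<Sum>j\<le>Suc m. ?f j)" by simp
    also have "\<dots> = (\<Sum>j\<le>m. ?f (Suc j))" unfolding sum.atMost_Suc_shift by simp
    also have "\<dots> = - (\<Sum>j\<le>m. ?c i (Suc j) * ?t j)" unfolding s by (rule sum_negf)
    finally show ?thesis .
  qed
  moreover have "profile_poly i m y - profile_poly (Suc i) m y = - (\<Sum>j\<le>m. ?c i (Suc j) * ?t j)"
    by (simp add: profile_poly_def algebra_simps add_divide_distrib sum.distrib)
  ultimately show ?thesis by (simp add: profile_poly_def[abs_def])
qed

text \<open>
  The \<open>i\<close>-th time derivative of the part of \<open>V\<^sub>n\<close> that multiplies \<open>u\<^sub>0 + u\<^sub>1\<close>, for the scalar problem. The part that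
  multiplies \<open>u\<^sub>0\<close> is the time derivative of the same function of order \<open>n - 1\<close>, so that
  \<open>V\<^sub>n = theta 0 n (u\<^sub>0 + u\<^sub>1) + theta 1 (n - 1) u\<^sub>0\<close>.
\<close>

definition theta :: "nat \<Rightarrow> nat \<Rightarrow> real \<Rightarrow> real \<Rightarrow> real" where
  "theta i n t l = (\<Sum>m<n. exp (- t * l) * (l ^ m * (- l) ^ i * profile_poly i m (t * l)))"

lemma theta_deriv: "((\<lambda>t. theta i n t l) has_real_derivative theta (Suc i) n t l) (at t within S)"
proof -
  have "((\<lambda>t. profile_poly i m (t * l)) has_real_derivative
      (profile_poly i m (t * l) - profile_poly (Suc i) m (t * l)) * l) (at t within S)" for m
    by (rule DERIV_chain2[OF profile_poly_deriv]) (auto intro!: derivative_eq_intros)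
  then show ?thesis unfolding theta_def
    by (auto intro!: derivative_eq_intros sum.cong simp: algebra_simps)
qed

lemma tempered_profile_poly: "tempered (\<lambda>l. profile_poly i m (t * l))"
  unfolding profile_poly_def divide_inverse by (intro tempered_intros)

text \<open>
  The error \<open>u - V\<^sub>n\<close> of the scalar problem is \<open>err_A n t l * u\<^sub>0 + err_B n t l * u\<^sub>1\<close>, and the primed functions are the
  time derivatives.
\<close>

definition err_A :: "nat \<Rightarrow> real \<Rightarrow> real \<Rightarrow> real" where
  "err_A n t l = osc_p t l - theta 0 n t l - theta 1 (n - 1) t l"
definition err_B :: "nat \<Rightarrow> real \<Rightarrow> real \<Rightarrow> real" where
  "err_B n t l = osc_q t l - theta 0 n t l"
definition err_A' :: "nat \<Rightarrow> real \<Rightarrow> real \<Rightarrow> real" where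
  "err_A' n t l = - l * osc_q t l - theta 1 n t l - theta 2 (n - 1) t l"
definition err_B' :: "nat \<Rightarrow> real \<Rightarrow> real \<Rightarrow> real" where
  "err_B' n t l = osc_p t l - osc_q t l - theta 1 n t l"

definition scalar_estimate :: "nat \<Rightarrow> real \<Rightarrow> bool" where
  "scalar_estimate n C \<longleftrightarrow> (\<forall>l\<ge>0. \<forall>t\<ge>1. \<forall>x y.
     (err_A n t l * x + err_B n t l * y)\<^sup>2
      + t * ((err_A' n t l * x + err_B' n t l * y)\<^sup>2 + l * (err_A n t l * x + err_B n t l * y)\<^sup>2)
     \<le> C * t powi (- 2 * int n) * ((1 + l) * x\<^sup>2 + y\<^sup>2))"

lemma err_deriv:
  "((\<lambda>t. err_A n t l) has_real_derivative err_A' n t l) (at t within S)"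
  "((\<lambda>t. err_B n t l) has_real_derivative err_B' n t l) (at t within S)"
  unfolding err_A_def err_B_def err_A'_def err_B'_def
  using theta_deriv[of 1 "n - 1" l t S] theta_deriv[of 0 n l t S]
  by (auto intro!: derivative_eq_intros osc_p_deriv osc_q_deriv simp: numeral_2_eq_2)

section \<open>Generating functions of the profiles\<close>

lemma central_binomial_gbinomial:
  "((- 1/2 :: real) gchoose m) * (- 4) ^ m = real ((2 * m) choose m)"
proof (induction m)
  case (Suc m)
  have "Suc m * ((2 * Suc m) choose Suc m) = Suc (Suc (2 * m)) * (Suc (2 * m) choose m)"
    using Suc_times_binomial_eq[of "Suc (2 * m)" m] by simp
  moreover have "Suc m * (Suc (2 * m) choose m) = Suc (2 * m) * ((2 * m) choose m)"
  proof -
    have "Suc (2 * m) choose m = Suc (2 * m) choose Suc m"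
      using binomial_symmetric[of m "Suc (2 * m)"] by simp
    then show ?thesis using Suc_times_binomial_eq[of "2 * m" m] by (simp add: mult.commute)
  qed
  ultimately have "Suc m * (Suc m * ((2 * Suc m) choose Suc m))
      = Suc m * (2 * (Suc (2 * m) * ((2 * m) choose m)))"
    by (metis (no_types, lifting) mult.assoc mult.left_commute mult_2 add_Suc_right add_Suc)
  then have "Suc m * ((2 * Suc m) choose Suc m) = 2 * (Suc (2 * m) * ((2 * m) choose m))"
    by (metis mult_cancel1 nat.distinct(1))
  then have "real (Suc m) * real ((2 * Suc m) choose Suc m) = 2 * (2 * real m + 1) * real ((2 * m) choose m)"
    by (metis of_nat_mult of_nat_Suc of_nat_numeral add.commute mult.assoc)
  then have step: "real ((2 * m) choose m) * (2 * (2 * real m + 1)) = real (Suc m) * real ((2 * Suc m) choose Suc m)"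
    by (simp only: mult_ac)
  have "((- 1/2 :: real) gchoose Suc m) * (- 4) ^ Suc m
     = ((- 1/2 gchoose m) * (- 4) ^ m) * (2 * (2 * real m + 1)) / real (Suc m)"
  proof -
    have "real (Suc m) * ((- 1/2 :: real) gchoose Suc m) = (- 1/2 - real m) * (- 1/2 gchoose m)"
      using gbinomial_mult_1[of "-1/2 :: real" m] by (simp add: algebra_simps)
    then have "((- 1/2 :: real) gchoose Suc m) = (- 1/2 - real m) * (- 1/2 gchoose m) / real (Suc m)"
      by (simp add: field_simps)
    then have e: "((- 1/2 :: real) gchoose Suc m) = (- 1/2 - real m) * (- 1/2 gchoose m) / real (Suc m)" .
    show ?thesis unfolding e by (simp add: field_simps)
  qed
  then show ?case
    unfolding Suc.IH step by (simp only: nonzero_mult_div_cancel_left[of "real (Suc m)"] of_nat_eq_0_iff nat.distinct not_False_eq_True)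
qed simp

text \<open>
  The binomial series for \<open>(1 - 4 x)\<close> to the power \<open>- 1/2\<close>.
\<close>

lemma central_binomial_series:
  assumes "0 \<le> x" "x < 1/4"
  shows "(\<lambda>m. real ((2 * m) choose m) * x ^ m) sums (1 / sqrt (1 - 4 * x))"
proof -
  have "(\<lambda>m. ((- 1/2) gchoose m) * (- 4 * x) ^ m) sums (1 + - 4 * x) powr (- 1/2)"
    by (rule gen_binomial_real) (use assms in auto)
  moreover have "((- 1/2) gchoose m) * (- 4 * x) ^ m = real ((2 * m) choose m) * x ^ m" for m
  proof -
    have "((- 1/2) gchoose m) * (- 4 * x) ^ m = (((- 1/2) gchoose m) * (- 4) ^ m) * x ^ m"
      by (subst power_mult_distrib) (rule mult.assoc[symmetric])
    then show ?thesis by (simp only: central_binomial_gbinomial)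
  qed
  moreover have "(1 + - 4 * x) powr (- 1/2) = 1 / sqrt (1 - 4 * x)"
  proof -
    have "(1 - 4 * x) powr (- (1/2)) = inverse ((1 - 4 * x) powr (1/2))" by (rule powr_minus)
    also have "\<dots> = 1 / sqrt (1 - 4 * x)" using assms by (simp add: powr_half_sqrt inverse_eq_divide)
    finally show ?thesis by simp
  qed
  ultimately show ?thesis by (simp only:)
qed

text \<open>
  The roots of \<open>r\<^sup>2 + r + x = 0\<close> are \<open>(- 1 \<plusminus> \<sigma>) / 2\<close>. With \<open>z\<close> as below the slow root is \<open>- x (1 + z)\<close>, and \<open>x = z / (1 + z)\<^sup>2\<close>.
  The quotient defining \<open>z\<close> avoids a division by \<open>x\<close>.
\<close>

definition root_sigma :: "real \<Rightarrow> real" where "root_sigma x = sqrt (1 - 4 * x)"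
definition root_z :: "real \<Rightarrow> real" where "root_z x = (1 - root_sigma x) / (1 + root_sigma x)"

lemma root_facts:
  assumes "0 \<le> x" "x < 1/4"
  shows "0 < root_sigma x" "root_sigma x \<le> 1" "(root_sigma x)\<^sup>2 = 1 - 4 * x"
    and "0 \<le> root_z x" "1 + root_z x = 2 / (1 + root_sigma x)"
    and "x * (1 + root_z x)\<^sup>2 = root_z x" "x * (1 + root_z x) = (1 - root_sigma x) / 2"
proof -
  show s: "0 < root_sigma x" "root_sigma x \<le> 1" "(root_sigma x)\<^sup>2 = 1 - 4 * x"
    using assms by (auto simp: root_sigma_def)
  show "0 \<le> root_z x" using s by (simp add: root_z_def)
  show z: "1 + root_z x = 2 / (1 + root_sigma x)" using s by (simp add: root_z_def field_simps)
  have x: "4 * x = (1 - root_sigma x) * (1 + root_sigma x)"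
    using s(3) by (simp add: algebra_simps power2_eq_square)
  have "x * (2 / (1 + root_sigma x)) = (4 * x) / (2 * (1 + root_sigma x))"
    using s by (simp add: field_simps)
  also have "\<dots> = (1 - root_sigma x) / 2"
    unfolding x by (rule mult_divide_mult_cancel_right) (use s in simp)
  finally show xz: "x * (1 + root_z x) = (1 - root_sigma x) / 2" unfolding z .
  show "x * (1 + root_z x)\<^sup>2 = root_z x"
  proof -
    have "x * (1 + root_z x)\<^sup>2 = (x * (1 + root_z x)) * (1 + root_z x)"
      by (simp add: power2_eq_square)
    also have "\<dots> = (1 - root_sigma x) / 2 * (2 / (1 + root_sigma x))" by (simp only: xz) (simp only: z)
    also have "\<dots> = root_z x" unfolding root_z_def using s by (simp add: field_simps)
    finally show ?thesis .
  qed
qed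

lemma binomial_shift_Suc:
  "(2 * Suc m) choose (Suc m + Suc j)
    = ((2 * m) choose (m + Suc (Suc j))) + 2 * ((2 * m) choose (m + Suc j)) + ((2 * m) choose (m + j))"
  by (simp add: numeral_2_eq_2)

lemma binomial_shift_0:
  "(2 * Suc m) choose (Suc m) = 2 * ((2 * m) choose m) + 2 * ((2 * m) choose (m + 1))"
proof (cases m)
  case (Suc k)
  have "(2 * m) choose k = (2 * m) choose (m + 1)"
    using binomial_symmetric[of k "2 * m"] Suc by simp
  then show ?thesis using Suc by (simp add: numeral_2_eq_2)
qed simp

text \<open>
  For \<open>i = 0\<close> Pascal's rule applied twice gives \<open>G\<^sub>j = x (G\<^sub>j\<^sub>+\<^sub>1 + 2 G\<^sub>j + G\<^sub>j\<^sub>-\<^sub>1)\<close> for the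
  series \<open>G\<^sub>j\<close> in question and \<open>j \<ge> 1\<close>. The sequence
  \<open>z\<^sup>j / \<sigma>\<close> satisfies the same recursion because \<open>x = z / (1 + z)\<^sup>2\<close>, and the two start equally. Pascal's rule once more
  shows that raising \<open>i\<close> by one multiplies by \<open>1 + z\<close>.
\<close>

lemma shifted_binomial_series:
  assumes x: "0 \<le> x" "x < 1/4"
  shows "(\<lambda>m. real ((2 * m + i) choose (m + i + j)) * x ^ m)
     sums (root_z x ^ j * (1 + root_z x) ^ i / root_sigma x)"
proof (cases "x = 0")
  case True
  have "root_sigma x = 1" "root_z x = 0" using True by (simp_all add: root_sigma_def root_z_def)
  moreover have "i choose (i + j) = (if j = 0 then 1 else 0)" by simp
  ultimately show ?thesis
    using powser_sums_zero[of "\<lambda>m. real ((2 * m + i) choose (m + i + j))"] True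
    by (cases "j = 0") (simp_all add: power_0_left binomial_eq_0)
next
  case False
  then have x0: "0 < x" using x by simp
  note rf = root_facts[OF x]
  let ?z = "root_z x" and ?s = "root_sigma x"
  have split: "(\<lambda>m. c (Suc m) * x ^ m) sums ((S - c 0) / x)" if "(\<lambda>m. c m * x ^ m) sums S" for c S
  proof -
    have "(\<lambda>m. c (Suc m) * x ^ Suc m) sums (S - c 0 * x ^ 0)"
      using that by (subst sums_Suc_iff) simp
    from sums_divide[OF this, of x] show ?thesis using x0 by (simp add: field_simps)
  qed
  have G0: "(\<lambda>m. real ((2 * m) choose m) * x ^ m) sums (1 / ?s)"
    using central_binomial_series[OF x] by (simp add: root_sigma_def)
  \<comment> \<open>The recursion at \<open>j = 0\<close>, where the terms for \<open>1\<close> and \<open>- 1\<close> coincide, determines \<open>G\<^sub>1\<close> from \<open>G\<^sub>0\<close>.\<close>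
  have zs: "(1 / ?s - 1) / x = 2 / ?s + 2 * (?z / ?s)"
  proof -
    have "x * (2 / ?s + 2 * (?z / ?s)) = 2 * (x * (1 + ?z)) / ?s" using rf(1) by (simp add: field_simps)
    also have "\<dots> = 1 / ?s - 1" unfolding rf(7) using rf(1) by (simp add: field_simps)
    finally show ?thesis using x0 by (simp add: field_simps)
  qed
  have G1: "(\<lambda>m. real ((2 * m) choose (m + 1)) * x ^ m) sums (?z / ?s)"
  proof -
    have "(\<lambda>m. real ((2 * Suc m) choose Suc m) * x ^ m) sums ((1 / ?s - 1) / x)"
      using split[OF G0] by simp
    then have "(\<lambda>m. (real ((2 * Suc m) choose Suc m) * x ^ m - 2 * (real ((2 * m) choose m) * x ^ m)) / 2)
        sums ((2 / ?s + 2 * (?z / ?s) - 2 * (1 / ?s)) / 2)"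
      unfolding zs by (intro sums_divide sums_diff sums_mult G0)
    then show ?thesis unfolding binomial_shift_0 by (simp add: algebra_simps)
  qed
  have base: "(\<lambda>m. real ((2 * m) choose (m + j)) * x ^ m) sums (?z ^ j / ?s)
     \<and> (\<lambda>m. real ((2 * m) choose (m + Suc j)) * x ^ m) sums (?z ^ Suc j / ?s)" for j
  proof (induction j)
    case 0 show ?case using G0 G1 by simp
  next
    case (Suc j)
    let ?G = "\<lambda>j m. real ((2 * m) choose (m + j)) * x ^ m"
    have "(\<lambda>m. real ((2 * Suc m) choose (Suc m + Suc j)) * x ^ m) sums ((?z ^ Suc j / ?s - 0) / x)"
      using split[OF conjunct2[OF Suc.IH]] by simp
    then have "(\<lambda>m. real ((2 * Suc m) choose (Suc m + Suc j)) * x ^ m - 2 * ?G (Suc j) m - ?G j m)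
      sums ((?z ^ Suc j / ?s - 0) / x - 2 * (?z ^ Suc j / ?s) - ?z ^ j / ?s)"
      using Suc.IH by (intro sums_diff sums_mult) auto
    moreover have "(?z ^ Suc j / ?s - 0) / x - 2 * (?z ^ Suc j / ?s) - ?z ^ j / ?s = ?z ^ Suc (Suc j) / ?s"
    proof -
      have "?z ^ j * (?z / x - 2 * ?z - 1) / ?s = ?z ^ j * (?z ^ 2) / ?s"
      proof -
        have "?z / x = (1 + ?z)\<^sup>2" using rf(6) x0 by (simp add: field_simps)
        then show ?thesis by (simp add: power2_eq_square algebra_simps)
      qed
      then show ?thesis using rf(1) by (simp add: field_simps power2_eq_square)
    qed
    ultimately have "(\<lambda>m. ?G (Suc (Suc j)) m) sums (?z ^ Suc (Suc j) / ?s)"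
      unfolding binomial_shift_Suc by (simp add: algebra_simps)
    with Suc.IH show ?case by blast
  qed
  show ?thesis
  proof (induction i arbitrary: j)
    case 0 then show ?case using base[of j] by simp
  next
    case (Suc i)
    have "(\<lambda>m. real ((2 * m + i) choose (m + i + j)) * x ^ m + real ((2 * m + i) choose (m + i + Suc j)) * x ^ m)
      sums (?z ^ j * (1 + ?z) ^ i / ?s + ?z ^ Suc j * (1 + ?z) ^ i / ?s)"
      by (intro sums_add Suc.IH)
    moreover have "real ((2 * m + Suc i) choose (m + Suc i + j)) * x ^ m
      = real ((2 * m + i) choose (m + i + j)) * x ^ m + real ((2 * m + i) choose (m + i + Suc j)) * x ^ m" for m
      by (simp add: algebra_simps)
    moreover have "?z ^ j * (1 + ?z) ^ i / ?s + ?z ^ Suc j * (1 + ?z) ^ i / ?s = ?z ^ j * (1 + ?z) ^ Suc i / ?s"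
      by (simp add: add_divide_distrib[symmetric] algebra_simps)
    ultimately show ?case by (simp only:)
  qed
qed

lemma abs_profile_poly_le: "0 \<le> y \<Longrightarrow> \<bar>profile_poly i m y\<bar> \<le> profile_poly i m (- y)"
  unfolding profile_poly_def
  by (intro order_trans[OF sum_abs] sum_mono) (simp add: abs_mult power_abs)

text \<open>
  Interchange the two sums: summing over \<open>m\<close> first turns the coefficients into \<open>z\<^sup>j (1 + z)\<^sup>i / \<sigma>\<close>, and then the sum over
  \<open>j\<close> is an exponential series. All terms are nonnegative when \<open>y\<close> is replaced by \<open>- \<bar>y\<bar>\<close>, which gives the
  summability.
\<close>

lemma profile_poly_has_sum:
  assumes x: "0 \<le> x" "x < 1/4"
  shows "((\<lambda>m. x ^ m * profile_poly i m y) has_sum ((1 + root_z x) ^ i / root_sigma x * exp (- (root_z x * y)))) UNIV"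
proof -
  note rf = root_facts[OF x]
  let ?z = "root_z x" and ?s = "root_sigma x"
  let ?c = "\<lambda>m j. real ((2 * m + i) choose (m + i + j)) * x ^ m"
  let ?K = "(1 + ?z) ^ i / ?s"
  have inner: "((\<lambda>m. ?c m j * r) has_sum (?K * (?z ^ j * r))) UNIV" for j r
  proof -
    have "((\<lambda>m. ?c m j) has_sum (?z ^ j * (1 + ?z) ^ i / ?s)) UNIV"
      by (rule sums_nonneg_imp_has_sum[OF shifted_binomial_series[OF x]]) (use x in auto)
    from has_sum_cmult_left[OF this, of r] show ?thesis by (simp add: mult_ac)
  qed
  have outer: "((\<lambda>j. ?K * (?z ^ j * (w ^ j / fact j))) has_sum (?K * exp (?z * w))) UNIV" for w
  proof (intro has_sum_cmult_right norm_summable_imp_has_sum)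
    show "(\<lambda>j. ?z ^ j * (w ^ j / fact j)) sums exp (?z * w)"
      using exp_converges[of "?z * w"] by (simp add: power_mult_distrib divide_inverse mult_ac)
    show "summable (\<lambda>j. norm (?z ^ j * (w ^ j / fact j)))"
      using summable_norm_exp[of "?z * w"] by (simp add: power_mult_distrib divide_inverse mult_ac)
  qed
  have "(\<lambda>(j, m). ?c m j * (\<bar>y\<bar> ^ j / fact j)) summable_on (UNIV \<times> UNIV)"
  proof (rule summable_on_SigmaI)
    show "((\<lambda>m. case (j, m) of (j, m) \<Rightarrow> ?c m j * (\<bar>y\<bar> ^ j / fact j)) has_sum
        (?K * (?z ^ j * (\<bar>y\<bar> ^ j / fact j)))) UNIV" for j
      using inner[of j "\<bar>y\<bar> ^ j / fact j"] by simp
    show "(\<lambda>j. ?K * (?z ^ j * (\<bar>y\<bar> ^ j / fact j))) summable_on UNIV"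
      using outer[of "\<bar>y\<bar>"] by (rule has_sum_imp_summable)
  qed (use x in auto)
  then have "(\<lambda>(j, m). ?c m j * ((- y) ^ j / fact j)) summable_on (UNIV \<times> UNIV)"
  proof -
    have "(\<lambda>p. norm ((\<lambda>(j, m). ?c m j * ((- y) ^ j / fact j)) p)) = (\<lambda>(j, m). ?c m j * (\<bar>y\<bar> ^ j / fact j))"
      using x by (auto simp: fun_eq_iff abs_mult power_abs)
    then show ?thesis using \<open>(\<lambda>(j, m). ?c m j * (\<bar>y\<bar> ^ j / fact j)) summable_on (UNIV \<times> UNIV)\<close>
      by (subst summable_on_iff_abs_summable_on_real) (simp only:)
  qed
  then have "((\<lambda>(j, m). ?c m j * ((- y) ^ j / fact j)) has_sum (?K * exp (?z * (- y)))) (UNIV \<times> UNIV)"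
  proof (rule has_sum_SigmaI[where g="\<lambda>j. ?K * (?z ^ j * ((- y) ^ j / fact j))", rotated, OF outer])
    show "((\<lambda>m. case (j, m) of (j, m) \<Rightarrow> ?c m j * ((- y) ^ j / fact j)) has_sum
        (?K * (?z ^ j * ((- y) ^ j / fact j)))) UNIV" for j
      using inner[of j "(- y) ^ j / fact j"] by simp
  qed
  then have "((\<lambda>(m, j). ?c m j * ((- y) ^ j / fact j)) has_sum (?K * exp (?z * (- y)))) (UNIV \<times> UNIV)"
    by (subst has_sum_swap) (simp add: case_prod_unfold)
  then have "((\<lambda>m. x ^ m * profile_poly i m y) has_sum (?K * exp (?z * (- y)))) UNIV"
  proof (rule has_sum_SigmaD)
    fix m
    have "((\<lambda>j. ?c m j * ((- y) ^ j / fact j)) has_sum (\<Sum>j\<le>m. ?c m j * ((- y) ^ j / fact j))) UNIV"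
      by (rule has_sum_finite_neutralI[of "{..m}"]) auto
    also have "(\<Sum>j\<le>m. ?c m j * ((- y) ^ j / fact j)) = x ^ m * profile_poly i m y"
      by (simp add: profile_poly_def sum_distrib_left mult_ac)
    finally show "((\<lambda>j. case (m, j) of (m, j) \<Rightarrow> ?c m j * ((- y) ^ j / fact j)) has_sum
        x ^ m * profile_poly i m y) UNIV" by simp
  qed
  then show ?thesis by simp
qed

text \<open>
  The term of order \<open>m\<close> is at most \<open>x\<^sup>m\<close> times the polynomial with all signs positive, and \<open>x\<^sup>m \<le> (16 x / 3)\<^sup>n (3/16)\<^sup>m\<close> for
  \<open>m \<ge> n\<close>. So the tail is bounded by the complete series with positive signs at \<open>x = 3/16\<close>, where \<open>\<sigma> = 1/2\<close> and
  \<open>z = 1/3\<close>.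
\<close>

lemma profile_poly_tail:
  assumes x: "0 \<le> x" "x \<le> 3/16" and y: "0 \<le> y"
  shows "\<bar>(1 + root_z x) ^ i / root_sigma x * exp (- (root_z x * y)) - (\<Sum>m<n. x ^ m * profile_poly i m y)\<bar>
    \<le> (16/3 * x) ^ n * (2 * (4/3) ^ i * exp (y / 3))"
proof -
  have x4: "x < 1/4" using x by simp
  let ?f = "\<lambda>m. x ^ m * profile_poly i m y" and ?x0 = "3/16 :: real"
  let ?g = "\<lambda>m. ?x0 ^ m * profile_poly i m (- y)"
  have s0: "root_sigma ?x0 = 1/2"
    by (simp add: root_sigma_def real_sqrt_divide)
  have z0: "root_z ?x0 = 1/3" by (simp add: root_z_def s0)
  have f: "?f sums ((1 + root_z x) ^ i / root_sigma x * exp (- (root_z x * y)))"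
    by (rule has_sum_imp_sums[OF profile_poly_has_sum[OF x(1) x4]])
  have "?g sums ((1 + root_z ?x0) ^ i / root_sigma ?x0 * exp (- (root_z ?x0 * (- y))))"
    by (rule has_sum_imp_sums[OF profile_poly_has_sum]) auto
  then have g: "?g sums (2 * (4/3) ^ i * exp (y / 3))" by (simp add: s0 z0 mult_ac)
  have g_nonneg: "0 \<le> ?g m" for m
    using abs_profile_poly_le[OF y, of i m] by simp
  have cmp: "\<bar>?f (m + n)\<bar> \<le> (16/3 * x) ^ n * ?g (m + n)" for m
  proof -
    have "\<bar>?f (m + n)\<bar> \<le> x ^ (m + n) * profile_poly i (m + n) (- y)"
      using x abs_profile_poly_le[OF y] by (simp add: abs_mult mult_left_mono)
    also have "x ^ (m + n) * profile_poly i (m + n) (- y)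
        = (16/3 * x) ^ n * (?x0 ^ n * x ^ m) * profile_poly i (m + n) (- y)"
      by (simp add: power_add power_mult_distrib[symmetric])
    also have "\<dots> \<le> (16/3 * x) ^ n * (?x0 ^ n * ?x0 ^ m) * profile_poly i (m + n) (- y)"
      using x abs_profile_poly_le[OF y, of i "m + n"]
      by (intro mult_right_mono mult_left_mono power_mono) auto
    finally show ?thesis unfolding power_add[of "3/16"] by (simp only: mult_ac)
  qed
  have gn: "summable (\<lambda>m. ?g (m + n))" using sums_summable[OF g] by (rule summable_ignore_initial_segment)
  have "(\<lambda>m. ?f (m + n)) sums ((1 + root_z x) ^ i / root_sigma x * exp (- (root_z x * y)) - (\<Sum>m<n. ?f m))"
    using f by (subst sums_iff_shift) simp
  then have "\<bar>(1 + root_z x) ^ i / root_sigma x * exp (- (root_z x * y)) - (\<Sum>m<n. ?f m)\<bar> = \<bar>\<Sum>m. ?f (m + n)\<bar>"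
    by (simp add: sums_iff)
  also have "\<dots> \<le> (\<Sum>m. (16/3 * x) ^ n * ?g (m + n))"
    unfolding real_norm_def[symmetric]
    by (rule norm_suminf_le[OF _ summable_mult[OF gn]]) (use cmp in \<open>simp only: real_norm_def\<close>)
  also have "\<dots> = (16/3 * x) ^ n * (\<Sum>m. ?g (m + n))" by (rule suminf_mult[OF gn])
  also have "(\<Sum>m. ?g (m + n)) \<le> 2 * (4/3) ^ i * exp (y / 3)"
  proof -
    have "(\<Sum>m. ?g (m + n)) = (\<Sum>m. ?g m) - (\<Sum>m<n. ?g m)"
      using suminf_minus_initial_segment[OF sums_summable[OF g]] by simp
    also have "\<dots> \<le> (\<Sum>m. ?g m)" using sum_nonneg[of "{..<n}" ?g] g_nonneg by simp
    also have "\<dots> = 2 * (4/3) ^ i * exp (y / 3)" using g by (simp add: sums_iff)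
    finally show ?thesis .
  qed
  finally show ?thesis using x by (simp add: mult_left_mono)
qed

section \<open>The estimate for the damped oscillator\<close>

text \<open>
  The first time derivatives of \<open>osc_q\<close>, of order \<open>0\<close>, \<open>1\<close> and \<open>2\<close>.
\<close>

definition osc_dq :: "nat \<Rightarrow> real \<Rightarrow> real \<Rightarrow> real" where
  "osc_dq i t l = (if i = 0 then osc_q t l else if i = 1 then osc_p t l - osc_q t l
     else - l * osc_q t l - (osc_p t l - osc_q t l))"

lemma err_osc_dq:
  "err_A n t l = (osc_dq 0 t l - theta 0 n t l) + (osc_dq 1 t l - theta 1 (n - 1) t l)"
  "err_B n t l = osc_dq 0 t l - theta 0 n t l"
  "err_A' n t l = (osc_dq 1 t l - theta 1 n t l) + (osc_dq 2 t l - theta 2 (n - 1) t l)"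
  "err_B' n t l = osc_dq 1 t l - theta 1 n t l"
  by (simp_all add: err_A_def err_B_def err_A'_def err_B'_def osc_dq_def)

lemma osc_dq_overdamped:
  assumes x: "0 \<le> x" "x < 1/4" and i: "i \<le> 2"
  defines "s \<equiv> root_sigma x"
  shows "osc_dq i t x = (((s - 1) / 2) ^ i * exp ((s - 1) / 2 * t) - (- (1 + s) / 2) ^ i * exp (- (1 + s) / 2 * t)) / s"
proof -
  note rf = root_facts[OF x, folded s_def]
  have sq: "sqrt (1/4 - x) = s / 2"
    unfolding s_def root_sigma_def using real_sqrt_divide[of "1 - 4 * x" 4] by (simp add: field_simps)
  have k: "\<not> 1/4 - x < 0" "1/4 - x \<noteq> 0" "0 < 1/4 - x" using x by auto
  define P where "P = exp ((s - 1) / 2 * t)"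
  define Q where "Q = exp (- (1 + s) / 2 * t)"
  have P: "P = exp (- t / 2) * exp (t * (s / 2))" and Q: "Q = exp (- t / 2) * exp (- (t * (s / 2)))"
    unfolding P_def Q_def exp_add[symmetric] by (simp_all add: field_simps)
  have q: "osc_q t x = (P - Q) / s"
    using k rf(1) unfolding osc_q_def osc_sin_def sq P Q sinh_def by (simp add: field_simps)
  have c: "exp (- t / 2) * osc_cos (1/4 - x) t = (P + Q) / 2"
    using k unfolding osc_cos_def sq P Q cosh_def by (simp add: field_simps)
  have "osc_p t x = exp (- t / 2) * osc_cos (1/4 - x) t + osc_q t x / 2"
    unfolding osc_p_def osc_q_def by (simp add: algebra_simps)
  then have p: "osc_p t x = (P + Q) / 2 + osc_q t x / 2" unfolding c .
  have x': "x = (1 - s * s) / 4" using rf(3) by (simp add: power2_eq_square)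
  have pq: "osc_p t x - osc_q t x = ((s - 1) / 2 * P - (- (1 + s) / 2) * Q) / s"
    unfolding p q using rf(1) by (simp add: field_simps)
  have xq: "x * osc_q t x = (1 - s * s) / 4 * ((P - Q) / s)" by (subst q, subst x') (rule refl)
  have "- x * osc_q t x - (osc_p t x - osc_q t x)
     = (((s - 1) / 2) ^ 2 * P - (- (1 + s) / 2) ^ 2 * Q) / s"
    unfolding mult_minus_left xq pq using rf(1) by (simp add: field_simps power2_eq_square)
  moreover have "i = 0 \<or> i = 1 \<or> i = 2" using i by auto
  ultimately show ?thesis unfolding P_def[symmetric] Q_def[symmetric] osc_dq_def using q pq by auto
qed

text \<open>
  The slow mode of \<open>q\<close> is compared with \<open>theta\<close> by the bound for the tail of the series; the fast mode decays like
  \<open>exp (- t / 2)\<close>. The weight \<open>1 + t l\<close> absorbs the factor \<open>t l\<close> of the potential energy.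
\<close>

lemma low_frequency_estimate:
  assumes i: "i \<le> 2"
  obtains K where "\<And>l t. 0 \<le> l \<Longrightarrow> l \<le> 3/16 \<Longrightarrow> 1 \<le> t \<Longrightarrow>
     (1 + t * l) * \<bar>osc_dq i t l - theta i n t l\<bar> \<le> K / t ^ (n + i)"
proof -
  obtain M1 where M1: "\<And>y::real. 0 \<le> y \<Longrightarrow> \<bar>exp (- (2/3) * y) * ((1 + y) * y ^ (n + i))\<bar> \<le> M1"
    by (rule exp_tempered_bounded[of "2/3" "\<lambda>y. (1 + y) * y ^ (n + i)"]) (auto intro!: tempered_intros)
  obtain M2 where M2: "\<And>t::real. 0 \<le> t \<Longrightarrow> \<bar>exp (- (1/2) * t) * ((1 + t) * t ^ (n + i))\<bar> \<le> M2"
    by (rule exp_tempered_bounded[of "1/2" "\<lambda>y. (1 + y) * y ^ (n + i)"]) (auto intro!: tempered_intros)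
  let ?C = "(16/3) ^ n * (2 * (4/3) ^ i) :: real"
  show thesis
  proof (rule that[of "?C * M1 + 2 * M2"])
    fix l t :: real assume l: "0 \<le> l" "l \<le> 3/16" and t: "1 \<le> t"
    have l4: "l < 1/4" using l by simp
    note rf = root_facts[OF l(1) l4]
    let ?s = "root_sigma l" and ?z = "root_z l"
    define y where "y = t * l"
    have y: "0 \<le> y" "y \<le> t" using l t mult_left_mono[of l 1 t] by (auto simp: y_def)
    have s2: "1/2 \<le> ?s"
    proof -
      have "(1/2)\<^sup>2 \<le> ?s\<^sup>2" unfolding rf(3) using l by (simp add: power2_eq_square)
      then show ?thesis using rf(1) by (simp add: power2_le_iff_abs_le)
    qed
    have r: "(?s - 1) / 2 = - l * (1 + ?z)" unfolding mult_minus_left rf(7) by (simp add: field_simps)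
    define S where "S = (\<Sum>m<n. l ^ m * profile_poly i m y)"
    define F where "F = (1 + ?z) ^ i / ?s * exp (- (?z * y))"
    define Q where "Q = (- (1 + ?s) / 2) ^ i * exp (- (1 + ?s) / 2 * t) / ?s"
    have th: "theta i n t l = (- l) ^ i * exp (- y) * S"
      unfolding theta_def S_def y_def sum_distrib_left by (intro sum.cong refl) (simp add: mult_ac)
    \<comment> \<open>The slow mode of \<open>q\<close> is the complete series whose partial sums are \<open>theta\<close>.\<close>
    have main: "((?s - 1) / 2) ^ i * exp ((?s - 1) / 2 * t) / ?s = (- l) ^ i * exp (- y) * F"
    proof -
      have "exp ((?s - 1) / 2 * t) = exp (- y) * exp (- (?z * y))"
        unfolding r y_def exp_add[symmetric] by (simp add: algebra_simps)
      then have "((?s - 1) / 2) ^ i * exp ((?s - 1) / 2 * t) / ?s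
          = ((?s - 1) / 2) ^ i * (exp (- y) * exp (- (?z * y))) / ?s" by (simp only:)
      then show ?thesis unfolding F_def r power_mult_distrib by simp
    qed
    have "osc_dq i t l - theta i n t l = (- l) ^ i * exp (- y) * (F - S) - Q"
    proof -
      have "osc_dq i t l = ((?s - 1) / 2) ^ i * exp ((?s - 1) / 2 * t) / ?s - Q"
        unfolding osc_dq_overdamped[OF l(1) l4 i] Q_def by (rule diff_divide_distrib)
      then show ?thesis unfolding main th by (simp add: algebra_simps)
    qed
    then have "\<bar>osc_dq i t l - theta i n t l\<bar> \<le> l ^ i * exp (- y) * \<bar>F - S\<bar> + \<bar>Q\<bar>"
      using l abs_triangle_ineq4[of "(- l) ^ i * exp (- y) * (F - S)" Q]
      by (simp add: abs_mult power_abs)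
    also have "\<bar>F - S\<bar> \<le> (16/3 * l) ^ n * (2 * (4/3) ^ i * exp (y / 3))"
      unfolding F_def S_def by (rule profile_poly_tail[OF l y(1)])
    finally have "\<bar>osc_dq i t l - theta i n t l\<bar>
        \<le> l ^ i * exp (- y) * ((16/3 * l) ^ n * (2 * (4/3) ^ i * exp (y / 3))) + \<bar>Q\<bar>"
      using l by (simp add: mult_left_mono)
    also have "l ^ i * exp (- y) * ((16/3 * l) ^ n * (2 * (4/3) ^ i * exp (y / 3)))
        = ?C * (exp (- (2/3) * y) * y ^ (n + i)) / t ^ (n + i)"
    proof -
      have "exp (- y) * exp (y / 3) = exp (- (2/3) * y)" unfolding exp_add[symmetric] by simp
      moreover have "l ^ (n + i) = y ^ (n + i) / t ^ (n + i)"
        using t by (simp add: y_def power_mult_distrib)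
      moreover have "l ^ i * exp (- y) * ((16/3 * l) ^ n * (2 * (4/3) ^ i * exp (y / 3)))
         = ?C * ((exp (- y) * exp (y / 3)) * l ^ (n + i))"
        unfolding power_mult_distrib power_add by (simp only: mult_ac)
      ultimately show ?thesis by simp
    qed
    finally have bound: "\<bar>osc_dq i t l - theta i n t l\<bar>
      \<le> ?C * (exp (- (2/3) * y) * y ^ (n + i)) / t ^ (n + i) + \<bar>Q\<bar>" .
    have "0 \<le> 1 + y" using y by simp
    from mult_left_mono[OF bound this] have "(1 + y) * \<bar>osc_dq i t l - theta i n t l\<bar>
      \<le> (1 + y) * (?C * (exp (- (2/3) * y) * y ^ (n + i)) / t ^ (n + i)) + (1 + y) * \<bar>Q\<bar>"
      unfolding distrib_left[of "1 + y"] .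
    also have "(1 + y) * (?C * (exp (- (2/3) * y) * y ^ (n + i)) / t ^ (n + i)) \<le> ?C * M1 / t ^ (n + i)"
    proof -
      have "exp (- (2/3) * y) * ((1 + y) * y ^ (n + i)) \<le> M1" using M1[OF y(1)] by linarith
      then have "?C * (exp (- (2/3) * y) * ((1 + y) * y ^ (n + i))) / t ^ (n + i) \<le> ?C * M1 / t ^ (n + i)"
        using t by (intro divide_right_mono mult_left_mono) auto
      then show ?thesis by (simp add: mult_ac)
    qed
    also have "(1 + y) * \<bar>Q\<bar> \<le> 2 * M2 / t ^ (n + i)"
    proof -
      have "\<bar>- (1 + ?s) / 2\<bar> ^ i \<le> 1" using rf(1,2) by (intro power_le_one) auto
      moreover have "exp (- (1 + ?s) / 2 * t) \<le> exp (- (1/2) * t)"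
        using rf(1) t by (simp add: field_simps)
      moreover have "1 / ?s \<le> 2" using s2 by (simp add: divide_le_eq)
      ultimately have "\<bar>- (1 + ?s) / 2\<bar> ^ i * exp (- (1 + ?s) / 2 * t) * (1 / ?s) \<le> 1 * exp (- (1/2) * t) * 2"
        using rf(1) by (intro mult_mono) auto
      then have "\<bar>Q\<bar> \<le> 2 * exp (- (1/2) * t)"
        using rf(1) unfolding Q_def by (simp add: abs_mult power_abs)
      then have "(1 + y) * \<bar>Q\<bar> \<le> (1 + t) * (2 * exp (- (1/2) * t))"
        using y by (intro mult_mono) auto
      also have "\<dots> = 2 * (exp (- (1/2) * t) * ((1 + t) * t ^ (n + i))) / t ^ (n + i)"
        using t by simp
      also have "\<dots> \<le> 2 * M2 / t ^ (n + i)"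
        using M2[of t] t by (intro divide_right_mono mult_left_mono) auto
      finally show ?thesis .
    qed
    finally show "(1 + t * l) * \<bar>osc_dq i t l - theta i n t l\<bar> \<le> (?C * M1 + 2 * M2) / t ^ (n + i)"
      by (simp add: y_def add_divide_distrib)
  qed
qed

text \<open>
  In terms of \<open>y = t l\<close> and with \<open>l \<le> y / d\<close>, the left-hand side is at most a polynomial in \<open>y\<close> times \<open>exp (- y)\<close>.
\<close>

lemma theta_weighted_bound:
  assumes d: "0 < d"
  obtains M where "\<And>l t. 0 \<le> l \<Longrightarrow> d \<le> t \<Longrightarrow> (1 + t * l) * \<bar>theta i n t l\<bar> * (t * l) ^ N \<le> M"
proof -
  define g where "g y = (\<Sum>m<n. (1 / d) ^ (m + i) * y ^ (m + i) * profile_poly i m (- 1 * y))" for y :: real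
  have tmp: "tempered (\<lambda>y. (1 + y) * g y * y ^ N)"
    unfolding g_def by (intro tempered_intros tempered_profile_poly)
  obtain M where M: "\<And>y. 0 \<le> y \<Longrightarrow> \<bar>exp (- 1 * y) * ((1 + y) * g y * y ^ N)\<bar> \<le> M"
    by (rule exp_tempered_bounded[OF zero_less_one tmp]) blast
  show thesis
  proof (rule that[of M])
    fix l t :: real assume l: "0 \<le> l" and t: "d \<le> t"
    define y where "y = t * l"
    have y: "0 \<le> y" using l t d by (simp add: y_def)
    have ly: "l \<le> 1 / d * y" using mult_right_mono[OF t l] d by (simp add: y_def field_simps)
    have "\<bar>theta i n t l\<bar> \<le> (\<Sum>m<n. exp (- y) * ((1 / d) ^ (m + i) * y ^ (m + i) * profile_poly i m (- 1 * y)))"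
      unfolding theta_def
    proof (intro order_trans[OF sum_abs] sum_mono)
      fix m
      have "\<bar>l ^ m * (- l) ^ i\<bar> \<le> (1 / d * y) ^ (m + i)"
        using ly l by (simp add: abs_mult power_abs power_add[symmetric] power_mono)
      moreover have "\<bar>profile_poly i m y\<bar> \<le> profile_poly i m (- 1 * y)"
        using abs_profile_poly_le[OF y, of i m] by simp
      ultimately have "\<bar>l ^ m * (- l) ^ i\<bar> * \<bar>profile_poly i m y\<bar>
          \<le> ((1 / d) ^ (m + i) * y ^ (m + i)) * profile_poly i m (- 1 * y)"
        unfolding power_mult_distrib[symmetric] using y d by (intro mult_mono) auto
      then show "\<bar>exp (- t * l) * (l ^ m * (- l) ^ i * profile_poly i m (t * l))\<bar>
        \<le> exp (- y) * ((1 / d) ^ (m + i) * y ^ (m + i) * profile_poly i m (- 1 * y))"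
        unfolding y_def[symmetric] by (simp add: abs_mult y_def[symmetric] mult_left_mono)
    qed
    also have "\<dots> = exp (- y) * g y" by (simp add: g_def sum_distrib_left)
    finally have "(1 + y) * \<bar>theta i n t l\<bar> * y ^ N \<le> (1 + y) * (exp (- y) * g y) * y ^ N"
      using y by (intro mult_right_mono mult_left_mono) auto
    also have "\<dots> = exp (- 1 * y) * ((1 + y) * g y * y ^ N)" by simp
    also have "\<dots> \<le> M" using M[OF y] by linarith
    finally show "(1 + t * l) * \<bar>theta i n t l\<bar> * (t * l) ^ N \<le> M" by (simp add: y_def)
  qed
qed

lemma high_frequency_theta:
  obtains K where "\<And>l t. 3/16 \<le> l \<Longrightarrow> 1 \<le> t \<Longrightarrow> (1 + t * l) * \<bar>theta i n t l\<bar> \<le> K / t ^ N"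
proof -
  obtain M where M: "\<And>l t. 0 \<le> l \<Longrightarrow> 1 \<le> t \<Longrightarrow> (1 + t * l) * \<bar>theta i n t l\<bar> * (t * l) ^ N \<le> M"
    by (rule theta_weighted_bound[OF zero_less_one]) blast
  show thesis
  proof (rule that[of "(16/3) ^ N * M"])
    fix l t :: real assume l: "3/16 \<le> l" and t: "1 \<le> t"
    have y: "0 \<le> t * l" "3/16 * t \<le> t * l"
      using l t mult_left_mono[of "3/16" l t] by (auto simp: mult.commute)
    have "(1 + t * l) * \<bar>theta i n t l\<bar> * (3/16 * t) ^ N \<le> (1 + t * l) * \<bar>theta i n t l\<bar> * (t * l) ^ N"
      using y t by (intro mult_left_mono power_mono) auto
    also have "\<dots> \<le> M" using l t by (intro M) auto
    finally have "(1 + t * l) * \<bar>theta i n t l\<bar> \<le> M / (3/16 * t) ^ N"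
      using t by (subst pos_le_divide_eq) auto
    also have "\<dots> = (16/3) ^ N * M / t ^ N"
      unfolding power_mult_distrib power_divide using t by (simp add: field_simps)
    finally show "(1 + t * l) * \<bar>theta i n t l\<bar> \<le> (16/3) ^ N * M / t ^ N" .
  qed
qed

text \<open>
  A Lyapunov function: \<open>L = v\<^sup>2 + l u\<^sup>2 + u v + u\<^sup>2 / 2\<close> has derivative \<open>- v\<^sup>2 - l u\<^sup>2\<close>, and it is comparable to
  \<open>v\<^sup>2 + l u\<^sup>2\<close> as long as \<open>l\<close> stays away from \<open>0\<close>.
\<close>

lemma high_frequency_decay:
  fixes l t x y :: real
  assumes l: "3/16 \<le> l" and t: "0 \<le> t"
  defines "u \<equiv> \<lambda>t. osc_p t l * x + osc_q t l * y"
    and "v \<equiv> \<lambda>t. - l * osc_q t l * x + (osc_p t l - osc_q t l) * y"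
  shows "(v t)\<^sup>2 + l * (u t)\<^sup>2 \<le> 4 * exp (- t / 8) * ((1 + l) * x\<^sup>2 + y\<^sup>2)"
proof -
  have u: "(u has_real_derivative v s) (at s)" and v: "(v has_real_derivative - l * u s - v s) (at s)" for s
    unfolding u_def v_def
    by (auto intro!: derivative_eq_intros osc_p_deriv osc_q_deriv simp: algebra_simps)
  define L where "L s = (v s)\<^sup>2 + l * (u s)\<^sup>2 + u s * v s + (u s)\<^sup>2 / 2" for s
  have uv: "- (u s)\<^sup>2 / 2 - (v s)\<^sup>2 / 2 \<le> u s * v s" "u s * v s \<le> (u s)\<^sup>2 / 2 + (v s)\<^sup>2 / 2" for s
    using zero_le_power2[of "u s + v s"] zero_le_power2[of "u s - v s"]
    by (simp_all add: power2_eq_square algebra_simps)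
  have lu: "(u s)\<^sup>2 \<le> 16/3 * (l * (u s)\<^sup>2)" for s
    using mult_right_mono[OF l, of "(u s)\<^sup>2"] by simp
  have "exp (t / 8) * L t \<le> exp (0 / 8) * L 0"
  proof (rule nonincreasing_from_0[where f="\<lambda>t. exp (t / 8) * L t"
        and f'="\<lambda>s. exp (s / 8) * (L s / 8 - (v s)\<^sup>2 - l * (u s)\<^sup>2)", OF _ _ t])
    show "((\<lambda>t. exp (t / 8) * L t) has_real_derivative exp (s / 8) * (L s / 8 - (v s)\<^sup>2 - l * (u s)\<^sup>2)) (at s)" for s
      unfolding L_def
      by (auto intro!: derivative_eq_intros u v simp: field_simps power2_eq_square)
    fix s
    \<comment> \<open>Indeed \<open>L \<le> 3/2 v\<^sup>2 + 19/3 l u\<^sup>2\<close>, as \<open>1 \<le> 16/3 l\<close>.\<close>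
    have "L s \<le> 8 * ((v s)\<^sup>2 + l * (u s)\<^sup>2)"
      unfolding L_def using uv(2)[of s] lu[of s] zero_le_power2[of "v s"] zero_le_power2[of "u s"] by argo
    then have "L s / 8 - (v s)\<^sup>2 - l * (u s)\<^sup>2 \<le> 0" by simp
    then show "exp (s / 8) * (L s / 8 - (v s)\<^sup>2 - l * (u s)\<^sup>2) \<le> 0" by (simp add: mult_le_0_iff)
  qed
  then have "L t \<le> exp (- t / 8) * L 0" by (simp add: exp_minus field_simps)
  moreover have "(v t)\<^sup>2 + l * (u t)\<^sup>2 \<le> 2 * L t"
  proof -
    have "0 \<le> l * (u t)\<^sup>2" using l by simp
    then show ?thesis unfolding L_def using uv(1)[of t] by simp
  qed
  moreover have "L 0 \<le> 2 * ((1 + l) * x\<^sup>2 + y\<^sup>2)"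
  proof -
    have "L 0 = y\<^sup>2 + l * x\<^sup>2 + x * y + x\<^sup>2 / 2" by (simp add: L_def u_def v_def osc_0)
    moreover have "x * y \<le> x\<^sup>2 / 2 + y\<^sup>2 / 2" using uv(2)[of 0] by (simp add: u_def v_def osc_0)
    moreover have "0 \<le> l * x\<^sup>2" using l by simp
    ultimately show ?thesis
      unfolding distrib_right using zero_le_power2[of x] zero_le_power2[of y] by argo
  qed
  then have "exp (- t / 8) * L 0 \<le> exp (- t / 8) * (2 * ((1 + l) * x\<^sup>2 + y\<^sup>2))" by (intro mult_left_mono) auto
  ultimately have "(v t)\<^sup>2 + l * (u t)\<^sup>2 \<le> 2 * (exp (- t / 8) * (2 * ((1 + l) * x\<^sup>2 + y\<^sup>2)))" by linarith
  then show ?thesis by (simp add: algebra_simps)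
qed

lemma quadratic_error_bound:
  fixes a b a' b' x y s t l K :: real
  assumes t: "1 \<le> t" and l: "0 \<le> l" and r: "0 \<le> r"
    and ab: "(1 + t * l) * \<bar>a\<bar> \<le> K * r" "(1 + t * l) * \<bar>b\<bar> \<le> K * r"
    and ab': "t * \<bar>a'\<bar> \<le> K * r" "t * \<bar>b'\<bar> \<le> K * r"
  shows "(a * x + b * y)\<^sup>2 + t * ((a' * x + b' * y)\<^sup>2 + l * (a * x + b * y)\<^sup>2)
    \<le> 4 * K\<^sup>2 * r\<^sup>2 * ((1 + l) * x\<^sup>2 + y\<^sup>2)"
proof -
  have lin: "\<bar>c * (d * x + e * y)\<bar> \<le> K * r * (\<bar>x\<bar> + \<bar>y\<bar>)"
    if "0 \<le> c" "c * \<bar>d\<bar> \<le> K * r" "c * \<bar>e\<bar> \<le> K * r" for c d e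
  proof -
    have "\<bar>c * (d * x + e * y)\<bar> \<le> c * \<bar>d\<bar> * \<bar>x\<bar> + c * \<bar>e\<bar> * \<bar>y\<bar>"
      unfolding distrib_left using that(1)
      by (intro order_trans[OF abs_triangle_ineq]) (simp add: abs_mult mult.assoc)
    also have "\<dots> \<le> K * r * \<bar>x\<bar> + K * r * \<bar>y\<bar>" using that by (intro add_mono mult_right_mono) auto
    finally show ?thesis by (simp add: distrib_left)
  qed
  have sq: "(c * (d * x + e * y))\<^sup>2 \<le> 2 * K\<^sup>2 * r\<^sup>2 * (x\<^sup>2 + y\<^sup>2)"
    if "0 \<le> c" "c * \<bar>d\<bar> \<le> K * r" "c * \<bar>e\<bar> \<le> K * r" for c d e
  proof -
    have "(c * (d * x + e * y))\<^sup>2 \<le> (K * r * (\<bar>x\<bar> + \<bar>y\<bar>))\<^sup>2"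
      using lin[OF that] by (simp add: abs_le_square_iff[symmetric])
    also have "\<dots> = (K * r)\<^sup>2 * (\<bar>x\<bar> + \<bar>y\<bar>)\<^sup>2" by (rule power_mult_distrib)
    also have "\<dots> \<le> (K * r)\<^sup>2 * (2 * (x\<^sup>2 + y\<^sup>2))"
      using sum_squares_bound[of "\<bar>x\<bar>" "\<bar>y\<bar>"] by (intro mult_left_mono) (auto simp: power2_sum)
    finally show ?thesis by (simp only: power_mult_distrib mult_ac)
  qed
  let ?w = "a * x + b * y" and ?w' = "a' * x + b' * y"
  have tl: "0 \<le> t * l" using t l by simp
  have "?w\<^sup>2 + t * l * ?w\<^sup>2 \<le> ((1 + t * l) * ?w)\<^sup>2"
  proof -
    have "1 + T \<le> (1 + T)\<^sup>2" if "0 \<le> T" for T :: real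
      using that by (simp add: power2_eq_square algebra_simps)
    from this[OF tl] have "1 + t * l \<le> (1 + t * l)\<^sup>2" .
    from mult_right_mono[OF this zero_le_power2[of ?w]] show ?thesis
      by (simp only: power_mult_distrib[of "1 + t * l"] distrib_right[of 1 "t * l" "?w\<^sup>2"] mult_1_left)
  qed
  also have "\<dots> \<le> 2 * K\<^sup>2 * r\<^sup>2 * (x\<^sup>2 + y\<^sup>2)" using tl ab by (intro sq) auto
  finally have 1: "?w\<^sup>2 + t * l * ?w\<^sup>2 \<le> 2 * K\<^sup>2 * r\<^sup>2 * (x\<^sup>2 + y\<^sup>2)" .
  have "t * ?w'\<^sup>2 \<le> t\<^sup>2 * ?w'\<^sup>2" using t by (intro mult_right_mono) (auto simp: power2_eq_square)
  also have "\<dots> = (t * ?w')\<^sup>2" by (simp add: power_mult_distrib)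
  also have "\<dots> \<le> 2 * K\<^sup>2 * r\<^sup>2 * (x\<^sup>2 + y\<^sup>2)" using t ab' by (intro sq) auto
  finally have 2: "t * ?w'\<^sup>2 \<le> 2 * K\<^sup>2 * r\<^sup>2 * (x\<^sup>2 + y\<^sup>2)" .
  have "?w\<^sup>2 + t * (?w'\<^sup>2 + l * ?w\<^sup>2) = (?w\<^sup>2 + t * l * ?w\<^sup>2) + t * ?w'\<^sup>2"
    by (simp add: distrib_left mult.assoc)
  also have "\<dots> \<le> 4 * K\<^sup>2 * r\<^sup>2 * (x\<^sup>2 + y\<^sup>2)" using 1 2 by linarith
  also have "\<dots> \<le> 4 * K\<^sup>2 * r\<^sup>2 * ((1 + l) * x\<^sup>2 + y\<^sup>2)"
    using l by (intro mult_left_mono) (auto simp: distrib_right)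
  finally show ?thesis .
qed

lemma powi_neg_double: "0 < t \<Longrightarrow> (t::real) powi (- 2 * int n) = (1 / t ^ n)\<^sup>2"
  by (simp add: power_int_def nat_mult_distrib power_mult power_divide power_inverse inverse_eq_divide mult.commute
      flip: power_mult)

lemma divide_power_le:
  fixes t :: real assumes "1 \<le> t" "0 \<le> K" "m \<le> k" shows "K / t ^ k \<le> K / t ^ m"
  using assms by (intro divide_left_mono power_increasing) auto

text \<open>
  Below \<open>l = 3/16\<close> the error is small because solution and profile nearly agree; above, solution and profile are
  small separately. The time derivative has to be smaller by a factor \<open>1 / t\<close>, which is why the second pair of
  bounds is needed at order \<open>n + 1\<close>. For \<open>n = 0\<close> the truncated difference \<open>n - 1\<close> is harmless, as the bounds for
  order \<open>0\<close> are then stronger than required.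
\<close>

lemma exists_scalar_estimate: "\<exists>C>0. scalar_estimate n C"
proof -
  have "\<exists>K. \<forall>l t. 0 \<le> l \<longrightarrow> l \<le> 3/16 \<longrightarrow> 1 \<le> t \<longrightarrow>
     (1 + t * l) * \<bar>osc_dq i t l - theta i n t l\<bar> \<le> K / t ^ (n + i)" if "i \<le> 2" for i n
    using low_frequency_estimate[OF that] by metis
  then obtain KL where KL: "\<And>i n l t. i \<le> 2 \<Longrightarrow> 0 \<le> l \<Longrightarrow> l \<le> 3/16 \<Longrightarrow> 1 \<le> t \<Longrightarrow>
     (1 + t * l) * \<bar>osc_dq i t l - theta i n t l\<bar> \<le> KL i n / t ^ (n + i)" by metis
  have KL0: "0 \<le> KL i n" if "i \<le> 2" for i n using KL[OF that, of 0 1 n] by simp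
  have "\<exists>K. \<forall>l t. 3/16 \<le> l \<longrightarrow> 1 \<le> t \<longrightarrow> (1 + t * l) * \<bar>theta i n t l\<bar> \<le> K / t ^ N" for i n N
    using high_frequency_theta[of i n N] by metis
  then obtain KH where KH: "\<And>i n N l t. 3/16 \<le> l \<Longrightarrow> 1 \<le> t \<Longrightarrow>
     (1 + t * l) * \<bar>theta i n t l\<bar> \<le> KH i n N / t ^ N" by metis
  have KH0: "0 \<le> KH i n N" for i n N
    using order_trans[OF _ KH[of 1 1 i n N]] by simp
  obtain M where M: "\<And>t::real. 0 \<le> t \<Longrightarrow> \<bar>exp (- (1/8) * t) * ((6 + t) * t ^ (2 * n))\<bar> \<le> M"
    by (rule exp_tempered_bounded[of "1/8" "\<lambda>t. (6 + t) * t ^ (2 * n)"]) (auto intro!: tempered_intros)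
  have M0: "0 \<le> M" using M[of 0] by linarith
  define K1 where "K1 = KL 0 n + KL 1 (n - 1) + KL 1 n + KL 2 (n - 1)"
  define K2 where "K2 = KH 0 n n + KH 1 (n - 1) n + KH 1 n (Suc n) + KH 2 (n - 1) (Suc n)"
  define C where "C = 4 * K1\<^sup>2 + 2 * (4 * M + 4 * K2\<^sup>2) + 1"
  have K1: "0 \<le> K1" and K2: "0 \<le> K2"
    unfolding K1_def K2_def by (intro add_nonneg_nonneg KL0 KH0; simp)+
  have "scalar_estimate n C"
    unfolding scalar_estimate_def
  proof (intro allI impI)
    fix l t x y :: real assume l: "0 \<le> l" and t: "1 \<le> t"
    let ?N = "(1 + l) * x\<^sup>2 + y\<^sup>2" and ?r = "1 / t ^ n"
    let ?lhs = "(err_A n t l * x + err_B n t l * y)\<^sup>2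
      + t * ((err_A' n t l * x + err_B' n t l * y)\<^sup>2 + l * (err_A n t l * x + err_B n t l * y)\<^sup>2)"
    have tl: "0 \<le> t * l" using t l by simp
    have N: "0 \<le> ?N" using l by simp
    have drop_weight: "\<bar>c\<bar> \<le> (1 + t * l) * \<bar>c\<bar>" for c
      using mult_right_mono[of 1 "1 + t * l" "\<bar>c\<bar>"] tl by simp
    have r: "0 \<le> ?r" using t by simp
    have tri: "c * \<bar>a + b\<bar> \<le> c * \<bar>a\<bar> + c * \<bar>b\<bar>" if "0 \<le> c" for a b c :: real
      using mult_left_mono[OF abs_triangle_ineq that] by (simp add: distrib_left)
    have shift: "t * \<bar>c\<bar> \<le> K * ?r" if "\<bar>c\<bar> \<le> K / t ^ Suc n" for c K
      using mult_left_mono[OF that, of t] t by simp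
    have "?lhs \<le> C * ?r\<^sup>2 * ?N"
    proof (cases "l \<le> 3/16")
      case True
      let ?d = "\<lambda>i n. osc_dq i t l - theta i n t l"
      have d: "(1 + t * l) * \<bar>?d 0 n\<bar> \<le> KL 0 n * ?r" "(1 + t * l) * \<bar>?d 1 (n - 1)\<bar> \<le> KL 1 (n - 1) * ?r"
        using KL[of 0 l t n] order_trans[OF KL[of 1 l t "n - 1"] divide_power_le[OF t KL0[of 1 "n - 1"], of n "n - 1 + 1"]]
          True l t by simp_all
      have d': "t * \<bar>?d 1 n\<bar> \<le> KL 1 n * ?r" "t * \<bar>?d 2 (n - 1)\<bar> \<le> KL 2 (n - 1) * ?r"
      proof -
        have "\<bar>?d 1 n\<bar> \<le> KL 1 n / t ^ Suc n"
          using order_trans[OF drop_weight KL[of 1 l t n]] True l t by simp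
        moreover have "\<bar>?d 2 (n - 1)\<bar> \<le> KL 2 (n - 1) / t ^ Suc n"
          using order_trans[OF order_trans[OF drop_weight KL[of 2 l t "n - 1"]]
              divide_power_le[OF t KL0[of 2 "n - 1"], of "Suc n" "n - 1 + 2"]] True l t by simp
        ultimately show "t * \<bar>?d 1 n\<bar> \<le> KL 1 n * ?r" "t * \<bar>?d 2 (n - 1)\<bar> \<le> KL 2 (n - 1) * ?r"
          by (blast intro: shift)+
      qed
      have "?lhs \<le> 4 * K1\<^sup>2 * ?r\<^sup>2 * ?N"
        unfolding err_osc_dq
      proof (rule quadratic_error_bound[OF t l r])
        have p: "0 \<le> KL 0 n * ?r" "0 \<le> KL 1 (n - 1) * ?r" "0 \<le> KL 1 n * ?r" "0 \<le> KL 2 (n - 1) * ?r"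
          using r KL0 by auto
        have e: "K1 * ?r = KL 0 n * ?r + KL 1 (n - 1) * ?r + KL 1 n * ?r + KL 2 (n - 1) * ?r"
          by (simp only: K1_def distrib_right)
        show "(1 + t * l) * \<bar>?d 0 n + ?d 1 (n - 1)\<bar> \<le> K1 * ?r"
          unfolding e using tri[of "1 + t * l" "?d 0 n" "?d 1 (n - 1)"] d p tl by linarith
        show "(1 + t * l) * \<bar>?d 0 n\<bar> \<le> K1 * ?r" unfolding e using d p by linarith
        show "t * \<bar>?d 1 n + ?d 2 (n - 1)\<bar> \<le> K1 * ?r"
          unfolding e using tri[of t "?d 1 n" "?d 2 (n - 1)"] d' p t by linarith
        show "t * \<bar>?d 1 n\<bar> \<le> K1 * ?r" unfolding e using d' p by linarith
      qed
      also have "\<dots> \<le> C * ?r\<^sup>2 * ?N"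
        using N M0 by (intro mult_right_mono) (auto simp: C_def)
      finally show ?thesis .
    next
      case False
      then have l': "3/16 \<le> l" by simp
      let ?u = "osc_p t l * x + osc_q t l * y"
      let ?v = "- l * osc_q t l * x + (osc_p t l - osc_q t l) * y"
      let ?a = "theta 0 n t l + theta 1 (n - 1) t l" and ?b = "theta 0 n t l"
      let ?a' = "theta 1 n t l + theta 2 (n - 1) t l" and ?b' = "theta 1 n t l"
      let ?V = "?a * x + ?b * y" and ?V' = "?a' * x + ?b' * y"
      have V: "?V\<^sup>2 + t * (?V'\<^sup>2 + l * ?V\<^sup>2) \<le> 4 * K2\<^sup>2 * ?r\<^sup>2 * ?N"
      proof (rule quadratic_error_bound[OF t l r])
        have p: "0 \<le> KH 0 n n * ?r" "0 \<le> KH 1 (n - 1) n * ?r" "0 \<le> KH 1 n (Suc n) * ?r"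
            "0 \<le> KH 2 (n - 1) (Suc n) * ?r"
          using r KH0 by auto
        have e: "K2 * ?r = KH 0 n n * ?r + KH 1 (n - 1) n * ?r + KH 1 n (Suc n) * ?r + KH 2 (n - 1) (Suc n) * ?r"
          by (simp only: K2_def distrib_right)
        have d: "(1 + t * l) * \<bar>theta i m t l\<bar> \<le> KH i m n * ?r" for i m using KH[OF l' t, of i m n] by simp
        have d': "t * \<bar>theta i m t l\<bar> \<le> KH i m (Suc n) * ?r" for i m
          by (rule shift[OF order_trans[OF drop_weight KH[OF l' t, of i m "Suc n"]]])
        show "(1 + t * l) * \<bar>?a\<bar> \<le> K2 * ?r"
          unfolding e using tri[of "1 + t * l" "theta 0 n t l" "theta 1 (n - 1) t l"] d[of 0 n] d[of 1 "n - 1"] p tl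
          by linarith
        show "(1 + t * l) * \<bar>?b\<bar> \<le> K2 * ?r" unfolding e using d[of 0 n] p by linarith
        show "t * \<bar>?a'\<bar> \<le> K2 * ?r"
          unfolding e using tri[of t "theta 1 n t l" "theta 2 (n - 1) t l"] d'[of 1 n] d'[of 2 "n - 1"] p t
          by linarith
        show "t * \<bar>?b'\<bar> \<le> K2 * ?r" unfolding e using d'[of 1 n] p by linarith
      qed
      have U: "?u\<^sup>2 + t * (?v\<^sup>2 + l * ?u\<^sup>2) \<le> 4 * M * ?r\<^sup>2 * ?N"
      proof -
        \<comment> \<open>At high frequencies the potential energy controls \<open>u\<^sup>2\<close>; \<open>6\<close> is \<open>16/3\<close> rounded up.\<close>
        have "?u\<^sup>2 \<le> 16/3 * (l * ?u\<^sup>2)" using mult_right_mono[OF l', of "?u\<^sup>2"] by simp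
        moreover have "0 \<le> ?v\<^sup>2" "0 \<le> l * ?u\<^sup>2" using l by simp_all
        ultimately have "?u\<^sup>2 + t * (?v\<^sup>2 + l * ?u\<^sup>2) \<le> (6 + t) * (?v\<^sup>2 + l * ?u\<^sup>2)"
          unfolding distrib_right[of 6 t] by argo
        also have "\<dots> \<le> (6 + t) * (4 * exp (- t / 8) * ?N)"
          using high_frequency_decay[OF l', of t x y] t by (intro mult_left_mono) auto
        also have "\<dots> = 4 * (exp (- (1/8) * t) * ((6 + t) * t ^ (2 * n))) * ?r\<^sup>2 * ?N"
          using t by (simp add: power_divide power_mult[symmetric] mult.commute[of 2 n])
        also have "\<dots> \<le> 4 * M * ?r\<^sup>2 * ?N"
          using M[of t] t N by (intro mult_right_mono mult_left_mono) auto
        finally show ?thesis .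
      qed
      have w: "err_A n t l * x + err_B n t l * y = ?u - ?V" "err_A' n t l * x + err_B' n t l * y = ?v - ?V'"
        by (simp_all add: err_A_def err_B_def err_A'_def err_B'_def algebra_simps)
      have sq: "(c - d)\<^sup>2 \<le> 2 * c\<^sup>2 + 2 * d\<^sup>2" for c d :: real
        using zero_le_power2[of "c + d"] by (simp add: power2_eq_square algebra_simps)
      have "?lhs \<le> (2 * ?u\<^sup>2 + 2 * ?V\<^sup>2) + t * ((2 * ?v\<^sup>2 + 2 * ?V'\<^sup>2) + l * (2 * ?u\<^sup>2 + 2 * ?V\<^sup>2))"
        unfolding w using l t by (intro add_mono mult_left_mono sq) auto
      also have "\<dots> = 2 * (?u\<^sup>2 + t * (?v\<^sup>2 + l * ?u\<^sup>2)) + 2 * (?V\<^sup>2 + t * (?V'\<^sup>2 + l * ?V\<^sup>2))"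
        by (simp only: distrib_left mult_ac add_ac)
      also have "\<dots> \<le> 2 * (4 * M * ?r\<^sup>2 * ?N) + 2 * (4 * K2\<^sup>2 * ?r\<^sup>2 * ?N)"
        by (intro add_mono mult_left_mono U V) auto
      also have "\<dots> = (2 * (4 * M + 4 * K2\<^sup>2)) * ?r\<^sup>2 * ?N" by (simp only: distrib_left distrib_right mult_ac)
      also have "\<dots> \<le> C * ?r\<^sup>2 * ?N"
        using N by (intro mult_right_mono) (auto simp: C_def)
      finally show ?thesis .
    qed
    then show "?lhs \<le> C * t powi (- 2 * int n) * ?N" using t by (subst powi_neg_double) auto
  qed
  moreover have "0 < C" using M0 by (simp add: C_def add_nonneg_pos)
  ultimately show ?thesis by blast
qed

section \<open>The profiles as functions of the operator\<close>

text \<open>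
  The coefficients of \<open>u\<^sub>0 + u\<^sub>1\<close> and of \<open>- u\<^sub>0\<close> in the profile of order \<open>m\<close>, apart from the factor \<open>exp (- t l)\<close>.
\<close>

definition profile_coeff_sum :: "nat \<Rightarrow> real \<Rightarrow> real \<Rightarrow> real" where
  "profile_coeff_sum m t l = l ^ m * profile_poly 0 m (t * l)"

definition profile_coeff_pos :: "nat \<Rightarrow> real \<Rightarrow> real \<Rightarrow> real" where
  "profile_coeff_pos m t l = (if m = 0 then 0 else l ^ m * profile_poly 1 (m - 1) (t * l))"

lemma profile_coeff_sum_eq:
  "profile_coeff_sum m t l = l ^ m * (\<Sum>j=0..m. real ((2 * m) choose (m + j)) / fact j * (- (t * l)) ^ j)"
  unfolding profile_coeff_sum_def profile_poly_def atLeast0AtMost by (simp add: mult_ac)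

lemma profile_coeff_pos_eq:
  "profile_coeff_pos m t l = (if m = 0 then 0 else
     l ^ m * (\<Sum>k=0..m-1. real ((2 * m - 1) choose (m + k)) / fact k * (- (t * l)) ^ k))"
proof (cases m)
  case (Suc m')
  have "2 * m' + 1 = 2 * m - 1" "\<And>k. m' + 1 + k = m + k" using Suc by auto
  then show ?thesis
    unfolding profile_coeff_pos_def profile_poly_def atLeast0AtMost using Suc by (simp add: mult_ac)
qed (simp add: profile_coeff_pos_def)

lemma sum_profile_coeff:
  "(\<Sum>m<n. exp (- t * l) * profile_coeff_sum m t l) = theta 0 n t l"
  "(\<Sum>m<n. exp (- t * l) * profile_coeff_pos m t l) = - theta 1 (n - 1) t l"
proof -
  show "(\<Sum>m<n. exp (- t * l) * profile_coeff_sum m t l) = theta 0 n t l"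
    by (simp add: theta_def profile_coeff_sum_def)
  show "(\<Sum>m<n. exp (- t * l) * profile_coeff_pos m t l) = - theta 1 (n - 1) t l"
  proof (cases n)
    case (Suc n')
    then show ?thesis
      by (simp add: sum.lessThan_Suc_shift theta_def profile_coeff_pos_def sum_negf mult_ac del: sum.lessThan_Suc)
  qed (simp add: theta_def)
qed

lemma tempered_profile_coeff: "tempered (profile_coeff_sum m t)" "tempered (profile_coeff_pos m t)"
  unfolding profile_coeff_sum_def[abs_def] profile_coeff_pos_def[abs_def]
  by (cases "m = 0"; auto intro!: tempered_intros tempered_profile_poly)+

lemma vanishing_theta: "0 < t \<Longrightarrow> vanishing (theta i n t)"
  unfolding theta_def[abs_def] sum_distrib_left[symmetric]
  by (intro vanishing_exp_tempered tempered_intros tempered_profile_poly)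

lemma tempered_osc: "0 \<le> t \<Longrightarrow> tempered (osc_p t)" "0 \<le> t \<Longrightarrow> tempered (osc_q t)"
  using temperedI[OF continuous_on_osc(2), of t 1 0] temperedI[OF continuous_on_osc(1), of t 2 0]
    osc_bounds[of _ t] by auto

lemma vanishing_exp_osc:
  assumes e: "0 < e" and t: "0 \<le> t" and w: "tempered w"
  shows "vanishing (\<lambda>l. exp (- e * l) * (w l * osc_p t l))" "vanishing (\<lambda>l. exp (- e * l) * (w l * osc_q t l))"
proof -
  show "vanishing (\<lambda>l. exp (- e * l) * (w l * osc_p t l))"
    by (rule vanishing_exp_tempered[OF e tempered_mult[OF w tempered_osc(1)[OF t]]])
  show "vanishing (\<lambda>l. exp (- e * l) * (w l * osc_q t l))"
    by (rule vanishing_exp_tempered[OF e tempered_mult[OF w tempered_osc(2)[OF t]]])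
qed

context nonneg_operator begin

lemma R_fc:
  assumes "vanishing (\<lambda>l. (1 + l) * h l)"
  shows "R (fc (\<lambda>l. (1 + l) * h l) x) = fc h x"
proof -
  have "R (fc (\<lambda>l. (1 + l) * h l) x) = fc (\<lambda>l. 1 / (1 + l) * ((1 + l) * h l)) x"
    by (simp only: fc_mult[OF vanishing_resolvent assms] fc_resolvent)
  also have "\<dots> = fc h x"
    by (rule fc_cong[OF vanishing_mult[OF vanishing_resolvent assms]]) simp
  finally show ?thesis .
qed

lemma fc_theta_deriv:
  assumes t: "0 < t"
  shows "((\<lambda>s. fc (theta i n s) x) has_vector_derivative fc (theta (Suc i) n t) x) (at t)"
proof -
  have t2: "0 < t / 2" using t by simp
  obtain M where weighted: "\<And>l r. 0 \<le> l \<Longrightarrow> t / 2 \<le> r \<Longrightarrow>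
      (1 + r * l) * \<bar>theta (Suc (Suc i)) n r l\<bar> * (r * l) ^ 0 \<le> M"
    by (rule theta_weighted_bound[OF t2]) blast
  have M: "\<bar>theta (Suc (Suc i)) n r l\<bar> \<le> M" if "0 \<le> l" "t / 2 \<le> r" for l r
  proof -
    have "0 \<le> r * l" using that t by simp
    then show ?thesis
      using weighted[OF that] mult_right_mono[of 1 "1 + r * l" "\<bar>theta (Suc (Suc i)) n r l\<bar>"] by simp
  qed
  have "((\<lambda>s. fc (theta i n s) x) has_vector_derivative fc (theta (Suc i) n t) x) (at t within {t/2..})"
    by (rule fc_has_vector_derivative[where f''="\<lambda>s. theta (Suc (Suc i)) n s" and M=M])
      (use t M in \<open>auto intro!: vanishing_theta theta_deriv\<close>)
  moreover have "at t within {t/2..} = at t" by (rule at_within_interior) (use t in simp)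
  ultimately show ?thesis by simp
qed

lemma fc_osc_deriv:
  assumes e: "0 < e" and t: "0 \<le> t" and w: "tempered w"
  shows "((\<lambda>s. fc (\<lambda>l. exp (- e * l) * (w l * osc_p s l)) x) has_vector_derivative
      fc (\<lambda>l. exp (- e * l) * (- l * w l * osc_q t l)) x) (at t within {0..})" (is ?P)
    and "((\<lambda>s. fc (\<lambda>l. exp (- e * l) * (w l * osc_q s l)) x) has_vector_derivative
      fc (\<lambda>l. exp (- e * l) * (w l * (osc_p t l - osc_q t l))) x) (at t within {0..})" (is ?Q)
proof -
  obtain M where M: "\<And>l. 0 \<le> l \<Longrightarrow> \<bar>exp (- e * l) * (w l * (3 * l + 3))\<bar> \<le> M"
    by (rule exp_tempered_bounded[OF e, of "\<lambda>l. w l * (3 * l + 3)"]) (auto intro!: tempered_intros w)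
  have bnd: "\<bar>exp (- e * l) * (w l * z)\<bar> \<le> M" if "0 \<le> l" "\<bar>z\<bar> \<le> 3 * l + 3" for l z
  proof -
    have "\<bar>exp (- e * l) * (w l * z)\<bar> \<le> \<bar>exp (- e * l) * (w l * (3 * l + 3))\<bar>"
      unfolding abs_mult using that by (intro mult_left_mono) auto
    then show ?thesis using M[OF that(1)] by linarith
  qed
  have lw: "tempered (\<lambda>l. - l * w l)" by (intro tempered_intros w)
  have d1: "((\<lambda>s. exp (- e * l) * (w l * osc_p s l)) has_real_derivative exp (- e * l) * (- l * w l * osc_q s l)) (at s within S)"
    "((\<lambda>s. exp (- e * l) * (- l * w l * osc_q s l)) has_real_derivative exp (- e * l) * (w l * (- l * (osc_p s l - osc_q s l)))) (at s within S)"
    "((\<lambda>s. exp (- e * l) * (w l * osc_q s l)) has_real_derivative exp (- e * l) * (w l * (osc_p s l - osc_q s l))) (at s within S)"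
    "((\<lambda>s. exp (- e * l) * (w l * (osc_p s l - osc_q s l))) has_real_derivative
      exp (- e * l) * (w l * (- l * osc_q s l - (osc_p s l - osc_q s l)))) (at s within S)" for l s S
    by (auto intro!: derivative_eq_intros osc_p_deriv osc_q_deriv)
  have b: "\<bar>- l * (osc_p r l - osc_q r l)\<bar> \<le> 3 * l + 3"
    "\<bar>- l * osc_q r l - (osc_p r l - osc_q r l)\<bar> \<le> 3 * l + 3" if "0 \<le> l" "0 \<le> r" for l r
  proof -
    note ob = osc_bounds[OF that]
    have "\<bar>l * osc_q r l\<bar> \<le> l * 2" "\<bar>l * (osc_p r l - osc_q r l)\<bar> \<le> l * 3"
      unfolding abs_mult abs_of_nonneg[OF that(1)] using ob that(1) by (auto intro!: mult_left_mono)
    then show "\<bar>- l * (osc_p r l - osc_q r l)\<bar> \<le> 3 * l + 3"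
      "\<bar>- l * osc_q r l - (osc_p r l - osc_q r l)\<bar> \<le> 3 * l + 3"
      unfolding mult_minus_left using ob that(1) by linarith+
  qed
  show ?P
  proof (rule fc_has_vector_derivative[where M=M
        and f''="\<lambda>s l. exp (- e * l) * (w l * (- l * (osc_p s l - osc_q s l)))"])
    show "t \<in> {0..}" using t by simp
    show "vanishing (\<lambda>l. exp (- e * l) * (w l * osc_p s l))" if "s \<in> {0..}" for s
      using that by (intro vanishing_exp_osc(1)[OF e _ w]) simp
    show "vanishing (\<lambda>l. exp (- e * l) * (- l * w l * osc_q t l))" by (rule vanishing_exp_osc(2)[OF e t lw])
    show "\<bar>exp (- e * l) * (w l * (- l * (osc_p r l - osc_q r l)))\<bar> \<le> M" if "0 \<le> l" "r \<in> {0..}" for l r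
      using that by (intro bnd b) simp_all
  qed (rule convex_real_interval d1)+
  show ?Q
  proof (rule fc_has_vector_derivative[where M=M
        and f''="\<lambda>s l. exp (- e * l) * (w l * (- l * osc_q s l - (osc_p s l - osc_q s l)))"])
    show "t \<in> {0..}" using t by simp
    show "vanishing (\<lambda>l. exp (- e * l) * (w l * osc_q s l))" if "s \<in> {0..}" for s
      using that by (intro vanishing_exp_osc(2)[OF e _ w]) simp
    show "vanishing (\<lambda>l. exp (- e * l) * (w l * (osc_p t l - osc_q t l)))"
      unfolding right_diff_distrib by (intro vanishing_diff vanishing_exp_osc e t w)
    show "\<bar>exp (- e * l) * (w l * (- l * osc_q r l - (osc_p r l - osc_q r l)))\<bar> \<le> M"
      if "0 \<le> l" "r \<in> {0..}" for l r
      using that by (intro bnd b) simp_all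
  qed (rule convex_real_interval d1)+
qed

text \<open>
  \<open>A\<close> is additive on its domain only, so the difference is carried through the induction.
\<close>

lemma A_power_fc:
  assumes t: "0 < t" and h: "tempered h" and g: "tempered g"
  shows "(A ^^ m) (fc (\<lambda>l. exp (- t * l) * h l) x - fc (\<lambda>l. exp (- t * l) * g l) y)
    = fc (\<lambda>l. exp (- t * l) * (l ^ m * h l)) x - fc (\<lambda>l. exp (- t * l) * (l ^ m * g l)) y"
proof (induction m)
  case (Suc m)
  have v: "vanishing (\<lambda>l. exp (- t * l) * (l ^ m * h l))" "vanishing (\<lambda>l. l * (exp (- t * l) * (l ^ m * h l)))"
    if "tempered h" for h
  proof -
    show "vanishing (\<lambda>l. exp (- t * l) * (l ^ m * h l))"
      by (intro vanishing_exp_tempered[OF t] tempered_intros that)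
    have "vanishing (\<lambda>l. exp (- t * l) * (l * (l ^ m * h l)))"
      by (intro vanishing_exp_tempered[OF t] tempered_intros that)
    then show "vanishing (\<lambda>l. l * (exp (- t * l) * (l ^ m * h l)))" by (simp only: mult.left_commute)
  qed
  have Af: "fc (\<lambda>l. exp (- t * l) * (l ^ m * h l)) x \<in> DA"
    "A (fc (\<lambda>l. exp (- t * l) * (l ^ m * h l)) x) = fc (\<lambda>l. exp (- t * l) * (l ^ Suc m * h l)) x"
    if "tempered h" for h x
  proof -
    have "(\<lambda>l. l * (exp (- t * l) * (l ^ m * h l))) = (\<lambda>l. exp (- t * l) * (l ^ Suc m * h l))"
      by (simp add: mult_ac)
    then show "fc (\<lambda>l. exp (- t * l) * (l ^ m * h l)) x \<in> DA"
      "A (fc (\<lambda>l. exp (- t * l) * (l ^ m * h l)) x) = fc (\<lambda>l. exp (- t * l) * (l ^ Suc m * h l)) x"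
      using A_fc[OF v[OF that], of x] by simp_all
  qed
  show ?case unfolding funpow.simps o_def Suc.IH A_diff[OF Af(1)[OF h] Af(1)[OF g]] Af(2)[OF h] Af(2)[OF g] ..
qed simp

end

context heat_operator begin

lemma T_fc:
  assumes "0 < e" "vanishing h" shows "T e (fc h x) = fc (\<lambda>l. exp (- e * l) * h l) x"
  using assms vanishing_exp_tempered[OF assms(1) tempered_const[of 1]]
  by (simp add: T_eq_fc fc_mult)

lemma scaled_A_power_T:
  assumes t: "0 < t"
  shows "((\<lambda>x. - (t *\<^sub>R A x)) ^^ j) (T t x) = fc (\<lambda>l. exp (- t * l) * (- (t * l)) ^ j) x"
proof (induction j)
  case 0 then show ?case using t by (simp add: T_eq_fc)
next
  case (Suc j)
  have v: "vanishing (\<lambda>l. exp (- t * l) * (- (t * l)) ^ j)" "vanishing (\<lambda>l. l * (exp (- t * l) * (- (t * l)) ^ j))"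
  proof -
    show "vanishing (\<lambda>l. exp (- t * l) * (- (t * l)) ^ j)"
      by (intro vanishing_exp_tempered[OF t] tempered_intros)
    have "vanishing (\<lambda>l. exp (- t * l) * (l * (- (t * l)) ^ j))"
      by (intro vanishing_exp_tempered[OF t] tempered_intros)
    then show "vanishing (\<lambda>l. l * (exp (- t * l) * (- (t * l)) ^ j))" by (simp only: mult.left_commute)
  qed
  have "- (t *\<^sub>R A (fc (\<lambda>l. exp (- t * l) * (- (t * l)) ^ j) x))
    = (- t) *\<^sub>R fc (\<lambda>l. l * (exp (- t * l) * (- (t * l)) ^ j)) x"
    by (simp only: A_fc(2)[OF v] scaleR_minus_left)
  also have "\<dots> = fc (\<lambda>l. (- t) * (l * (exp (- t * l) * (- (t * l)) ^ j))) x" by (rule fc_cmult[OF v(2), symmetric])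
  also have "(\<lambda>l. (- t) * (l * (exp (- t * l) * (- (t * l)) ^ j))) = (\<lambda>l. exp (- t * l) * (- (t * l)) ^ Suc j)"
    by (simp add: mult_ac)
  finally show ?case by (simp add: Suc.IH)
qed

lemma sum_scaled_A_power_T:
  assumes t: "0 < t" and I: "finite I"
  shows "(\<Sum>j\<in>I. c j *\<^sub>R ((\<lambda>x. - (t *\<^sub>R A x)) ^^ j) (T t x))
    = fc (\<lambda>l. exp (- t * l) * (\<Sum>j\<in>I. c j * (- (t * l)) ^ j)) x"
proof -
  have v: "vanishing (\<lambda>l. exp (- t * l) * (- (t * l)) ^ j)" for j
    by (intro vanishing_exp_tempered[OF t] tempered_intros)
  have "(\<Sum>j\<in>I. c j *\<^sub>R ((\<lambda>x. - (t *\<^sub>R A x)) ^^ j) (T t x))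
    = (\<Sum>j\<in>I. fc (\<lambda>l. c j * (exp (- t * l) * (- (t * l)) ^ j)) x)"
    by (simp only: scaled_A_power_T[OF t] fc_cmult[OF v])
  also have "\<dots> = fc (\<lambda>l. \<Sum>j\<in>I. c j * (exp (- t * l) * (- (t * l)) ^ j)) x"
    by (rule fc_sum[symmetric, OF I vanishing_cmult[OF v]])
  finally show ?thesis by (simp add: sum_distrib_left mult_ac)
qed

lemma profile_eq_fc:
  assumes t: "0 < t"
  shows "profile A T u0 u1 m t = fc (\<lambda>l. exp (- t * l) * profile_coeff_sum m t l) (u0 + u1)
      - fc (\<lambda>l. exp (- t * l) * profile_coeff_pos m t l) u0"
proof (cases "m = 0")
  case True
  have "fc (\<lambda>l. 0) u0 = 0" using fc_cmult[OF vanishing_0, of 0 u0] by simp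
  then show ?thesis using True t
    by (simp add: profile_def T_eq_fc profile_coeff_sum_def profile_coeff_pos_def profile_poly_def)
next
  case False
  let ?h = "\<lambda>l. \<Sum>j=0..m. real ((2 * m) choose (m + j)) / fact j * (- (t * l)) ^ j"
  let ?g = "\<lambda>l. \<Sum>k=0..m-1. real ((2 * m - 1) choose (m + k)) / fact k * (- (t * l)) ^ k"
  have "tempered ?h" "tempered ?g" by (intro tempered_intros)+
  from A_power_fc[OF t this, of m "u0 + u1" u0] False show ?thesis
    by (simp only: profile_def if_False sum_scaled_A_power_T[OF t finite_atLeastAtMost]
        profile_coeff_sum_eq profile_coeff_pos_eq)
qed

lemma profile_sum_eq_fc:
  assumes t: "0 < t"
  shows "profile_sum A T u0 u1 n t = fc (theta 0 n t) (u0 + u1) + fc (theta 1 (n - 1) t) u0"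
proof -
  have v: "vanishing (\<lambda>l. exp (- t * l) * profile_coeff_sum m t l)"
    "vanishing (\<lambda>l. exp (- t * l) * profile_coeff_pos m t l)" for m
    by (intro vanishing_exp_tempered[OF t] tempered_profile_coeff)+
  have "profile_sum A T u0 u1 n t = fc (\<lambda>l. \<Sum>m<n. exp (- t * l) * profile_coeff_sum m t l) (u0 + u1)
      - fc (\<lambda>l. \<Sum>m<n. exp (- t * l) * profile_coeff_pos m t l) u0"
    by (simp only: profile_sum_def profile_eq_fc[OF t] sum_subtractf fc_sum[OF finite_lessThan v(1)]
        fc_sum[OF finite_lessThan v(2)])
  also have "\<dots> = fc (theta 0 n t) (u0 + u1) + fc (theta 1 (n - 1) t) u0"
  proof -
    have "fc (\<lambda>l. - theta 1 (n - 1) t l) u0 = - fc (theta 1 (n - 1) t) u0"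
      using fc_cmult[OF vanishing_theta[OF t], of "-1" 1 "n - 1" u0] by simp
    then show ?thesis by (simp only: sum_profile_coeff diff_minus_eq_add)
  qed
  finally show ?thesis .
qed

end

section \<open>The square root and the weak solution\<close>

locale wave_operator = heat_operator +
  fixes DB B
  assumes sqrt_operator: "is_sqrt_operator DB B DA A"
begin

lemma B_nonneg_selfadjoint: "nonneg_selfadjoint DB B"
  and domain_A_iff: "x \<in> DA \<longleftrightarrow> x \<in> DB \<and> B x \<in> DB"
  and A_eq_BB: "x \<in> DA \<Longrightarrow> A x = B (B x)"
  using sqrt_operator unfolding is_sqrt_operator_def by auto

sublocale root: nonneg_operator DB B
  by (rule nonneg_operator.intro[OF B_nonneg_selfadjoint])

lemma inner_A_eq: "x \<in> DA \<Longrightarrow> y \<in> DB \<Longrightarrow> inner (A x) y = inner (B x) (B y)"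
  by (simp add: A_eq_BB root.A_sym domain_A_iff)

text \<open>
  \<open>B\<close> maps the solution \<open>R x\<close> of \<open>z + B (B z) = x\<close> to a solution of the same equation with right-hand side \<open>B x\<close>.
\<close>

lemma B_R:
  assumes x: "x \<in> DB" shows "B (R x) = R (B x)"
proof (rule R_unique[symmetric])
  have r: "R x \<in> DB" "B (R x) \<in> DB" using R_domain[of x] by (auto simp: domain_A_iff)
  have BB: "B (B (R x)) = x - R x" using A_eq_BB[OF R_domain] A_R by metis
  have "x - R x \<in> DB" by (intro subspace_diff[OF root.subspace_domain] x r)
  then show D: "B (R x) \<in> DA" using r BB by (simp add: domain_A_iff)
  show "B (R x) + A (B (R x)) = B x"
    using r x by (simp add: A_eq_BB[OF D] BB root.A_diff)
qed

lemma norm_R_le: "norm (R x) \<le> norm x"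
  using fc_norm_le[OF vanishing_resolvent, of 1 x] by (simp add: fc_resolvent)

text \<open>
  \<open>\<parallel>B R x\<parallel>\<^sup>2 = \<langle>A R x, R x\<rangle>\<close>, and \<open>A R = 1 - R\<close>.
\<close>

lemma bounded_linear_BR: "bounded_linear (\<lambda>x. B (R x))"
proof (rule bounded_linear_intro[where K=1])
  have r: "R x \<in> DB" for x using R_domain[of x] by (auto simp: domain_A_iff)
  show "B (R (x + y)) = B (R x) + B (R y)" for x y by (simp add: add root.A_add r)
  show "B (R (c *\<^sub>R x)) = c *\<^sub>R B (R x)" for c x by (simp add: scale root.A_scaleR r)
  fix x
  have "(norm (B (R x)))\<^sup>2 = inner (x - R x) (R x)"
    using inner_A_eq[OF R_domain r, of x x] by (simp add: A_R power2_norm_eq_inner)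
  also have "\<dots> \<le> inner x (R x)" by (simp add: inner_diff_left)
  also have "\<dots> \<le> norm x * norm x"
    using norm_cauchy_schwarz[of x "R x"] norm_R_le[of x] mult_left_mono[of "norm (R x)" "norm x" "norm x"]
    by simp
  finally show "norm (B (R x)) \<le> norm x * 1"
    by (simp add: power2_eq_square power2_le_imp_le[of "norm (B (R x))" "norm x"])
qed

lemma B_fc:
  assumes x: "x \<in> DB" and h: "vanishing h" "vanishing (\<lambda>l. (1 + l) * h l)"
  shows "fc h x \<in> DB" "B (fc h x) = fc h (B x)"
proof -
  let ?g = "\<lambda>l. (1 + l) * h l"
  have RDB: "R x \<in> DB" for x using R_domain[of x] by (auto simp: domain_A_iff)
  show "fc h x \<in> DB" unfolding R_fc[OF h(2), symmetric] by (rule RDB)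
  have "B (fc h x) = B (R (fc ?g x))" by (simp only: R_fc[OF h(2)])
  also have "\<dots> = fc ?g (B (R x))"
    by (rule fc_commute[OF bounded_linear_BR _ h(2)]) (rule B_R[OF RDB])
  also have "\<dots> = R (fc ?g (B x))"
    unfolding B_R[OF x] by (rule fc_commute[OF bounded_linear_R _ h(2), symmetric]) (rule refl)
  also have "\<dots> = fc h (B x)" by (rule R_fc[OF h(2)])
  finally show "B (fc h x) = fc h (B x)" .
qed

lemma B_T:
  assumes x: "x \<in> DB" and e: "0 < e" shows "T e x \<in> DB" "B (T e x) = T e (B x)"
proof -
  have "vanishing (\<lambda>l. exp (- e * l) * 1)" "vanishing (\<lambda>l. exp (- e * l) * (1 + l))"
    by (intro vanishing_exp_tempered[OF e] tempered_intros)+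
  then have "vanishing (\<lambda>l. exp (- e * l))" "vanishing (\<lambda>l. (1 + l) * exp (- e * l))"
    by (simp_all add: mult.commute)
  from B_fc[OF x this] show "T e x \<in> DB" "B (T e x) = T e (B x)" using e by (simp_all add: T_eq_fc)
qed

end

context wave_operator begin

lemma energy_space_norm_nonneg: "0 \<le> energy_space_norm B v"
  by (cases v) (simp add: energy_space_norm_def)

lemma norm_snd_le_energy: "norm (snd v) \<le> energy_space_norm B v"
  by (cases v) (simp add: energy_space_norm_def real_le_rsqrt)

text \<open>
  The generator satisfies \<open>1 - L - L\<^sup>2 = (1 + A) \<oplus> (1 + A)\<close>, so \<open>R \<oplus> R\<close> is a function of \<open>L\<close> and commutes with the
  semigroup. Below, \<open>z1 = L z\<close> and \<open>z2 = L\<^sup>2 z\<close>.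
\<close>

lemma wave_semigroup_commutes_R:
  assumes S: "wave_semigroup DA A DB B S" and h: "0 \<le> h" and x: "x \<in> DB" and S_xy: "S h (x, y) = (x', y')"
  shows "S h (R x, R y) = (R x', R y')"
proof -
  let ?X = "energy_space DB" and ?L = "\<lambda>(f, g). (g, - A f - g)"
  have gen: "semigroup_generated_by ?X (energy_space_norm B) S (DA \<times> DB) ?L"
    using S by (simp add: wave_semigroup_def)
  have lin: "subspace ?X" "\<And>v w. v \<in> ?X \<Longrightarrow> w \<in> ?X \<Longrightarrow> S h (v + w) = S h v + S h w"
    "\<And>c v. v \<in> ?X \<Longrightarrow> S h (c *\<^sub>R v) = c *\<^sub>R S h v"
    using gen h unfolding semigroup_generated_by_def C0_semigroup_def linear_operator_on_def by blast+
  have diff: "S h (v - w) = S h v - S h w" if "v \<in> ?X" "w \<in> ?X" for v w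
    using lin(2)[of v "(-1) *\<^sub>R w"] lin(3)[of w "-1"] subspace_scale[OF lin(1), of w "-1"] that by simp
  note comm = generator_commutes_with_semigroup[OF gen energy_space_norm_nonneg h]
  have RD: "R z \<in> DA" "R z \<in> DB" for z using R_domain[of z] by (auto simp: domain_A_iff)
  note sub = subspace_diff[OF root.subspace_domain] subspace_add[OF root.subspace_domain]
  define z where "z = (R x, R y)"
  define z1 where "z1 = (R y, - x + R x - R y)"
  define z2 where "z2 = (- x + R x - R y, - y + R y + x - R x + R y)"
  have z: "z \<in> DA \<times> DB" "?L z = z1" by (simp_all add: z_def z1_def RD A_R)
  have "- x + R x - R y \<in> DB" using sub(1)[OF sub(1)[OF RD(2) x] RD(2), of x y] by (simp add: algebra_simps)
  then have z1: "z1 \<in> DA \<times> DB" "?L z1 = z2" by (simp_all add: z1_def z2_def RD A_R algebra_simps)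
  obtain a b where ab: "S h z = (a, b)" by fastforce
  have L1: "S h z1 = (b, - A a - b)" and Dz: "a \<in> DA" "b \<in> DB"
    using comm[OF z(1)] ab z(2) by auto
  have L2: "S h z2 = (- A a - b, - A b - (- A a - b))" and Dz1: "b \<in> DA"
    using comm[OF z1(1)] L1 z1(2) by auto
  have inX: "z \<in> ?X" "z1 \<in> ?X" "z2 \<in> ?X"
    using z(1) z1(1) z1(2)[symmetric] by (auto simp: energy_space_def domain_A_iff z2_def z1_def)
  have "(x, y) = z - z1 - z2" by (simp add: z_def z1_def z2_def algebra_simps)
  then have "(x', y') = S h z - S h z1 - S h z2"
    using S_xy diff[OF inX(1,2)] diff[OF subspace_diff[OF lin(1) inX(1,2)] inX(3)] by metis
  also have "\<dots> = (a + A a, b + A b)" unfolding ab L1 L2 by (simp add: algebra_simps)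
  finally have "R x' = a" "R y' = b" using Dz Dz1 by (auto intro: R_unique)
  then show ?thesis using ab by (simp add: z_def)
qed

text \<open>
  Pair the solution at time \<open>s\<close> with the adjoint flow at time \<open>t - s\<close>, smoothed by \<open>exp (- e A)\<close>: the function
  \<open>\<langle>u s, p\<^sub>t\<^sub>-\<^sub>s y\<rangle> + \<langle>u' s, q\<^sub>t\<^sub>-\<^sub>s y\<rangle>\<close> is continuous and has right derivative zero. Since only \<open>R u'\<close> is known to be
  differentiable from the right, the second term is written as \<open>\<langle>R u' s, (1 + A) q\<^sub>t\<^sub>-\<^sub>s y\<rangle>\<close>. Comparing \<open>s = 0\<close> with
  \<open>s = t\<close> gives the formula.
\<close>

lemma wave_eq_fc:
  assumes u: "\<And>s. 0 \<le> s \<Longrightarrow> (u has_vector_derivative u' s) (at s within {0..})"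
    and cu': "continuous_on {0..} u'" and uDB: "\<And>s. 0 \<le> s \<Longrightarrow> u s \<in> DB"
    and S: "wave_semigroup DA A DB B S" and uS: "\<And>s. 0 \<le> s \<Longrightarrow> (u s, u' s) = S s (u0, u1)"
    and u0: "u0 \<in> DB" and e: "0 < e" and t: "0 \<le> t"
  shows "T e (u t) = fc (\<lambda>l. exp (- e * l) * osc_p t l) u0 + fc (\<lambda>l. exp (- e * l) * osc_q t l) u1"
proof -
  let ?X = "energy_space DB" and ?L = "\<lambda>(f, g). (g, - A f - g)"
  have gen: "semigroup_generated_by ?X (energy_space_norm B) S (DA \<times> DB) ?L"
    using S by (simp add: wave_semigroup_def)
  have inX: "(u0, u1) \<in> ?X" using u0 by (simp add: energy_space_def)
  have S0: "(u 0, u' 0) = (u0, u1)" and S_add: "\<And>r s. 0 \<le> r \<Longrightarrow> 0 \<le> s \<Longrightarrow> S (r + s) (u0, u1) = S r (S s (u0, u1))"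
    using gen inX uS[of 0] unfolding semigroup_generated_by_def C0_semigroup_def by auto
  have RD: "R z \<in> DA" "R z \<in> DB" for z using R_domain[of z] by (auto simp: domain_A_iff)
  have Ru': "((\<lambda>s. R (u' s)) has_vector_derivative - A (R (u s)) - R (u' s)) (at s within {s..})"
    if s: "0 \<le> s" for s
  proof (rule has_vector_derivative_from_right)
    let ?z = "(R (u s), R (u' s))"
    have "(?z, ?L ?z) \<in> generator_graph ?X (energy_space_norm B) S"
      using gen RD unfolding semigroup_generated_by_def by blast
    then have lim: "((\<lambda>h. energy_space_norm B ((1 / h) *\<^sub>R (S h ?z - ?z) - ?L ?z)) \<longlongrightarrow> 0) (at_right 0)"
      unfolding generator_graph_def by blast
    show "((\<lambda>h. norm ((1 / h) *\<^sub>R (R (u' (s + h)) - R (u' s)) - (- A (R (u s)) - R (u' s)))) \<longlongrightarrow> 0) (at_right 0)"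
    proof (rule Lim_null_comparison[OF _ lim])
      show "\<forall>\<^sub>F h in at_right 0. norm (norm ((1 / h) *\<^sub>R (R (u' (s + h)) - R (u' s)) - (- A (R (u s)) - R (u' s))))
          \<le> energy_space_norm B ((1 / h) *\<^sub>R (S h ?z - ?z) - ?L ?z)"
        using eventually_at_right_less[of 0]
      proof eventually_elim
        fix h :: real assume h: "0 < h"
        have "S h (u s, u' s) = (u (s + h), u' (s + h))"
          using S_add[of h s] uS[of "s + h"] uS[OF s] h s by (simp add: add.commute)
        then have "S h ?z = (R (u (s + h)), R (u' (s + h)))"
          using wave_semigroup_commutes_R[OF S _ uDB[OF s]] h by simp
        then show "norm (norm ((1 / h) *\<^sub>R (R (u' (s + h)) - R (u' s)) - (- A (R (u s)) - R (u' s))))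
          \<le> energy_space_norm B ((1 / h) *\<^sub>R (S h ?z - ?z) - ?L ?z)"
          using norm_snd_le_energy[of "(1 / h) *\<^sub>R (S h ?z - ?z) - ?L ?z"] by simp
      qed
    qed
  qed
  have w1: "tempered (\<lambda>l. 1 + l)" and w0: "tempered (\<lambda>l. 1)" by (intro tempered_intros)+
  let ?P = "\<lambda>s. fc (\<lambda>l. exp (- e * l) * (1 * osc_p s l))"
  let ?P' = "\<lambda>s. fc (\<lambda>l. exp (- e * l) * (- l * 1 * osc_q s l))"
  let ?Q = "\<lambda>s. fc (\<lambda>l. exp (- e * l) * ((1 + l) * osc_q s l))"
  let ?Q' = "\<lambda>s. fc (\<lambda>l. exp (- e * l) * ((1 + l) * (osc_p s l - osc_q s l)))"
  let ?q = "\<lambda>s. fc (\<lambda>l. exp (- e * l) * (1 * osc_q s l))"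
  note vp = vanishing_exp_osc(1)[OF e] and vq = vanishing_exp_osc(2)[OF e]
  have R_weight: "R (fc (\<lambda>l. exp (- e * l) * ((1 + l) * f l)) y) = fc (\<lambda>l. exp (- e * l) * (1 * f l)) y"
    if "vanishing (\<lambda>l. exp (- e * l) * ((1 + l) * f l))" for f y
  proof -
    have eq: "(\<lambda>l. exp (- e * l) * ((1 + l) * f l)) = (\<lambda>l. (1 + l) * (exp (- e * l) * (1 * f l)))"
      by (simp add: mult_ac)
    show ?thesis using R_fc[of "\<lambda>l. exp (- e * l) * (1 * f l)" y] that unfolding eq .
  qed
  have "inner (T e (u t)) y = inner (?P t u0 + ?q t u1) y" for y
  proof -
    let ?G = "\<lambda>s. inner (u s) (?P (t - s) y) + inner (R (u' s)) (?Q (t - s) y)"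
    have "?G t = ?G 0"
    proof (rule right_derivative_zero_constant[where f="?G", OF t])
      have c: "continuous_on {0..t} (\<lambda>s. F (t - s))" if "continuous_on {0..} F" for F :: "real \<Rightarrow> 'a"
        by (rule continuous_on_compose2[OF that]) (auto intro!: continuous_intros)
      have "continuous_on {0..} (\<lambda>s. ?P s y)" "continuous_on {0..} (\<lambda>s. ?Q s y)"
        by (rule continuous_on_vector_derivative[OF fc_osc_deriv(1)[OF e _ w0]], simp)
          (rule continuous_on_vector_derivative[OF fc_osc_deriv(2)[OF e _ w1]], simp)
      moreover have "continuous_on {0..t} u" "continuous_on {0..t} (\<lambda>s. R (u' s))"
        by (rule continuous_on_subset[OF continuous_on_vector_derivative[OF u]]; simp)
          (rule bounded_linear.continuous_on[OF bounded_linear_R continuous_on_subset[OF cu']]; simp)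
      ultimately show "continuous_on {0..t} ?G"
        by (intro continuous_on_add continuous_on_inner c)
      fix s assume s: "0 \<le> s" "s < t"
      then have ts: "0 \<le> t - s" by simp
      have "((\<lambda>s. inner (u s) (?P (t - s) y)) has_vector_derivative
          inner (u s) (- ?P' (t - s) y) + inner (u' s) (?P (t - s) y)) (at s within {s..})"
        by (rule bounded_bilinear.has_vector_derivative[OF bounded_bilinear_inner
              has_vector_derivative_within_subset[OF u[OF s(1)]]
              has_vector_derivative_at_within[OF has_vector_derivative_reversed_time[OF fc_osc_deriv(1)[OF e ts w0] s(2)]]])
          (use s in simp)
      moreover have "((\<lambda>s. inner (R (u' s)) (?Q (t - s) y)) has_vector_derivative
          inner (R (u' s)) (- ?Q' (t - s) y) + inner (- A (R (u s)) - R (u' s)) (?Q (t - s) y)) (at s within {s..})"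
        by (rule bounded_bilinear.has_vector_derivative[OF bounded_bilinear_inner Ru'[OF s(1)]])
          (rule has_vector_derivative_at_within[OF has_vector_derivative_reversed_time[OF fc_osc_deriv(2)[OF e ts w1] s(2)]])
      ultimately have "(?G has_vector_derivative
         (inner (u s) (- ?P' (t - s) y) + inner (u' s) (?P (t - s) y))
         + (inner (R (u' s)) (- ?Q' (t - s) y) + inner (- A (R (u s)) - R (u' s)) (?Q (t - s) y))) (at s within {s..})"
        by (rule has_vector_derivative_add)
      moreover have "(inner (u s) (- ?P' (t - s) y) + inner (u' s) (?P (t - s) y))
         + (inner (R (u' s)) (- ?Q' (t - s) y) + inner (- A (R (u s)) - R (u' s)) (?Q (t - s) y)) = 0"
      proof -
        let ?r = "t - s"
        have vQ: "vanishing (\<lambda>l. exp (- e * l) * ((1 + l) * osc_q ?r l))"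
          and vQ': "vanishing (\<lambda>l. exp (- e * l) * ((1 + l) * (osc_p ?r l - osc_q ?r l)))"
          and vP: "vanishing (\<lambda>l. exp (- e * l) * (1 * osc_p ?r l))"
          and vq1: "vanishing (\<lambda>l. exp (- e * l) * (1 * osc_q ?r l))"
          unfolding right_diff_distrib by (intro vanishing_diff vp vq ts w1 w0)+
        have "?P' ?r y = fc (\<lambda>l. exp (- e * l) * (1 * osc_q ?r l) - exp (- e * l) * ((1 + l) * osc_q ?r l)) y"
          by (rule arg_cong[where f="\<lambda>h. fc h y"]) (simp add: fun_eq_iff algebra_simps)
        then have P': "?P' ?r y = ?q ?r y - ?Q ?r y" by (simp only: fc_diff[OF vq1 vQ])
        have RQ: "R (?Q ?r y) = ?q ?r y" by (rule R_weight[OF vQ])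
        have "R (?Q' ?r y) = fc (\<lambda>l. exp (- e * l) * (1 * (osc_p ?r l - osc_q ?r l))) y" by (rule R_weight[OF vQ'])
        also have "\<dots> = fc (\<lambda>l. exp (- e * l) * (1 * osc_p ?r l) - exp (- e * l) * (1 * osc_q ?r l)) y"
          by (rule arg_cong[where f="\<lambda>h. fc h y"]) (simp add: fun_eq_iff algebra_simps)
        also have "\<dots> = ?P ?r y - ?q ?r y" by (rule fc_diff[OF vP vq1])
        finally have RQ': "R (?Q' ?r y) = ?P ?r y - ?q ?r y" .
        show ?thesis
          unfolding P' A_R inner_diff_left inner_minus_left inner_minus_right sym RQ RQ' by (simp add: inner_diff_right)
      qed
      ultimately show "(?G has_vector_derivative 0) (at s within {s..})" by simp
    qed
    moreover have "?P 0 y = T e y" using e by (simp add: osc_0 T_eq_fc)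
    moreover have "?Q 0 y = 0" using fc_cmult[OF vanishing_0, of 0 y] by (simp add: osc_0)
    moreover have "inner (R u1) (?Q t y) = inner u1 (?q t y)"
      unfolding sym by (simp only: R_weight[OF vq[OF t w1]])
    moreover have "inner (T e (u t)) y = inner (u t) (T e y)"
      using fc_sym[OF vanishing_exp_tempered[OF e w0], of "u t" y] e by (simp add: T_eq_fc)
    ultimately show ?thesis
      using S0 fc_sym[OF vp[OF t w0], of u0 y] fc_sym[OF vq[OF t w0], of u1 y]
      by (simp add: inner_add_left)
  qed
  then show ?thesis using vector_eq_rdot[of "T e (u t)" "?P t u0 + ?q t u1"] by simp
qed

lemma inner_fc_pair:
  assumes "vanishing a" "vanishing b" "vanishing c" "vanishing d"
  shows "inner (fc a x + fc b y) (fc c x + fc d y)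
    = inner (fc (\<lambda>l. a l * c l) x) x + inner (fc (\<lambda>l. a l * d l + b l * c l) x) y + inner (fc (\<lambda>l. b l * d l) y) y"
proof -
  have m: "inner (fc f v) (fc g w) = inner (fc (\<lambda>l. f l * g l) v) w" if "vanishing f" "vanishing g" for f g v w
    using that by (metis (no_types, lifting) fc_mult fc_sym vanishing_mult mult.commute[abs_def])
  show ?thesis
    using assms inner_commute[of "fc b y" "fc c x"]
    by (simp add: inner_add_left inner_add_right m fc_add vanishing_mult mult.commute)
qed

end

context wave_operator begin

text \<open>
  The solution and the profiles are functions of \<open>A\<close> after smoothing by \<open>T e\<close>, so that the difference of the two sides
  of the smoothed estimate is a quadratic form in \<open>(u\<^sub>0, u\<^sub>1)\<close> with coefficients in the functional calculus. Its
  matrix is positive semidefinite at every point by the scalar estimate.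
\<close>

lemma scalar_estimate_transfers:
  assumes est: "scalar_estimate n C" and u0: "u0 \<in> DB" and sol: "weak_solution DA A DB B u0 u1 u" and t: "1 \<le> t"
  defines "w \<equiv> \<lambda>s. u s - profile_sum A T u0 u1 n s"
  shows "w differentiable (at t) \<and> w t \<in> DB \<and>
     (norm (w t))\<^sup>2 + t * energy B w t \<le> C * t powi (- 2 * int n) * (energy_space_norm B (u0, u1))\<^sup>2"
proof -
  obtain u' S where u: "\<And>s. 0 \<le> s \<Longrightarrow> (u has_vector_derivative u' s) (at s within {0..})"
    and cu': "continuous_on {0..} u'" and uDB: "\<And>s. 0 \<le> s \<Longrightarrow> u s \<in> DB"
    and S: "wave_semigroup DA A DB B S" and uS: "\<And>s. 0 \<le> s \<Longrightarrow> (u s, u' s) = S s (u0, u1)"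
    using sol unfolding weak_solution_def by blast
  have t0: "0 < t" "0 \<le> t" using t by auto
  note v\<theta> = vanishing_theta[OF t0(1)]
  define V where "V s = fc (theta 0 n s) (u0 + u1) + fc (theta 1 (n - 1) s) u0" for s
  define V' where "V' = fc (theta 1 n t) (u0 + u1) + fc (theta 2 (n - 1) t) u0"
  have w_eq: "w s = u s - V s" if "0 < s" for s using profile_sum_eq_fc[OF that] by (simp add: w_def V_def)
  have at_t: "at t within {0..} = at t" by (rule at_within_interior) (use t in simp)
  have du: "(u has_vector_derivative u' t) (at t)" using u[OF t0(2)] at_t by simp
  have "(V has_vector_derivative V') (at t)"
    unfolding V_def V'_def
    using fc_theta_deriv[OF t0(1), of 0 n "u0 + u1"] fc_theta_deriv[OF t0(1), of 1 "n - 1" u0]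
    by (intro has_vector_derivative_add) (simp_all add: numeral_2_eq_2)
  from has_vector_derivative_diff[OF du this]
  have dw: "(w has_vector_derivative u' t - V') (at t)"
    by (rule has_vector_derivative_transform_within_open[where S="{0<..}"]) (use t w_eq in auto)
  have wDB: "w t \<in> DB"
  proof -
    have "fc (theta i k t) x \<in> DA" for i k x
    proof (rule A_fc(1)[OF v\<theta>])
      have "vanishing (\<lambda>l. exp (- t * l) * (l * (\<Sum>m<k. l ^ m * (- l) ^ i * profile_poly i m (t * l))))"
        by (intro vanishing_exp_tempered[OF t0(1)] tempered_intros tempered_profile_poly)
      then show "vanishing (\<lambda>l. l * theta i k t l)"
        by (simp add: theta_def sum_distrib_left mult_ac)
    qed
    then have "fc (theta i k t) x \<in> DB" for i k x by (simp add: domain_A_iff)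
    then show ?thesis unfolding w_eq[OF t0(1)] V_def
      by (intro subspace_diff subspace_add root.subspace_domain uDB t0)
  qed
  define K where "K = C * t powi (- 2 * int n)"
  \<comment> \<open>The functions \<open>p\<close> and \<open>q\<close> do not vanish at infinity, but they do after multiplication by \<open>exp (- e l)\<close>.\<close>
  have smoothed: "(norm (T e (w t)))\<^sup>2 + t * ((norm (T e (u' t - V')))\<^sup>2 + (norm (T e (B (w t))))\<^sup>2)
      \<le> K * ((norm (T e u0))\<^sup>2 + (norm (T e (B u0)))\<^sup>2 + (norm (T e u1))\<^sup>2)" if e: "0 < e" for e
  proof -
    define E where "E l = exp (- e * l)" for l :: real
    have vE: "vanishing (\<lambda>l. E l * f l)" if "tempered f" for f
      unfolding E_def by (rule vanishing_exp_tempered[OF e that])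
    note tosc = tempered_osc[OF t0(2)]
    have t\<theta>: "tempered (theta i k t)" for i k
      unfolding theta_def[abs_def] by (intro tempered_intros tempered_profile_poly t0)
    have terr: "tempered (err_A n t)" "tempered (err_B n t)" "tempered (err_A' n t)" "tempered (err_B' n t)"
      unfolding err_A_def[abs_def] err_B_def[abs_def] err_A'_def[abs_def] err_B'_def[abs_def]
      by (intro tempered_intros tosc t\<theta>)+
    let ?a = "\<lambda>l. E l * err_A n t l" and ?b = "\<lambda>l. E l * err_B n t l"
    let ?c = "\<lambda>l. E l * err_A' n t l" and ?d = "\<lambda>l. E l * err_B' n t l"
    have vab: "vanishing ?a" "vanishing ?b" "vanishing ?c" "vanishing ?d" by (intro vE terr)+
    have lin: "linear (T e)" using e by (intro T_linear) simp
    have TV: "T e (fc (theta i k t) x) = fc (\<lambda>l. E l * theta i k t l) x" for i k x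
      unfolding E_def by (rule T_fc[OF e v\<theta>])
    have uE: "T e (u s) = fc (\<lambda>l. E l * osc_p s l) u0 + fc (\<lambda>l. E l * osc_q s l) u1" if "0 \<le> s" for s
      unfolding E_def by (rule wave_eq_fc[OF u cu' uDB S uS u0 e that])
    have w_fc: "T e (w t) = fc ?a u0 + fc ?b u1"
    proof -
      have "fc ?a u0 = fc (\<lambda>l. E l * osc_p t l) u0 - fc (\<lambda>l. E l * theta 0 n t l) u0
          - fc (\<lambda>l. E l * theta 1 (n - 1) t l) u0"
        unfolding err_A_def right_diff_distrib by (simp only: fc_diff vanishing_diff vE tosc t\<theta>)
      moreover have "fc ?b u1 = fc (\<lambda>l. E l * osc_q t l) u1 - fc (\<lambda>l. E l * theta 0 n t l) u1"
        unfolding err_B_def right_diff_distrib by (simp only: fc_diff vE tosc t\<theta>)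
      ultimately show ?thesis
        unfolding w_eq[OF t0(1)] V_def
        by (simp add: linear_diff[OF lin] linear_add[OF lin] TV uE[OF t0(2)] fc_vadd vE t\<theta>)
    qed
    have u'_fc: "T e (u' t) = fc (\<lambda>l. E l * (- l * osc_q t l)) u0 + fc (\<lambda>l. E l * (osc_p t l - osc_q t l)) u1"
    proof (rule vector_derivative_unique_within[where f="\<lambda>s. T e (u s)" and x=t and S="{0..}"])
      show "at t within {0..} \<noteq> bot" by (simp add: at_t)
      show "((\<lambda>s. T e (u s)) has_vector_derivative T e (u' t)) (at t within {0..})"
        by (rule bounded_linear.has_vector_derivative[OF T_bounded_linear u[OF t0(2)]]) (use e in simp)
      have "((\<lambda>s. fc (\<lambda>l. E l * osc_p s l) u0 + fc (\<lambda>l. E l * osc_q s l) u1) has_vector_derivative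
         fc (\<lambda>l. E l * (- l * osc_q t l)) u0 + fc (\<lambda>l. E l * (osc_p t l - osc_q t l)) u1) (at t within {0..})"
        unfolding E_def
        using fc_osc_deriv(1)[OF e t0(2) tempered_const[of 1], of u0] fc_osc_deriv(2)[OF e t0(2) tempered_const[of 1], of u1]
        by (intro has_vector_derivative_add) simp_all
      then show "((\<lambda>s. T e (u s)) has_vector_derivative
         fc (\<lambda>l. E l * (- l * osc_q t l)) u0 + fc (\<lambda>l. E l * (osc_p t l - osc_q t l)) u1) (at t within {0..})"
        by (rule has_vector_derivative_transform[rotated 2]) (use t0 uE in auto)
    qed
    have w'_fc: "T e (u' t - V') = fc ?c u0 + fc ?d u1"
    proof -
      have lq: "tempered (\<lambda>l. - l * osc_q t l)" by (intro tempered_intros tosc)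
      have pq: "tempered (\<lambda>l. osc_p t l - osc_q t l)" by (intro tempered_intros tosc)
      have "fc ?c u0 = fc (\<lambda>l. E l * (- l * osc_q t l)) u0 - fc (\<lambda>l. E l * theta 1 n t l) u0
          - fc (\<lambda>l. E l * theta 2 (n - 1) t l) u0"
        unfolding err_A'_def right_diff_distrib by (simp only: fc_diff vanishing_diff vE lq t\<theta>)
      moreover have "fc ?d u1 = fc (\<lambda>l. E l * (osc_p t l - osc_q t l)) u1 - fc (\<lambda>l. E l * theta 1 n t l) u1"
        unfolding err_B'_def right_diff_distrib[of "E _" "_ - _"] by (simp only: fc_diff vE pq t\<theta>)
      ultimately show ?thesis
        unfolding V'_def
        by (simp add: linear_diff[OF lin] linear_add[OF lin] TV u'_fc fc_vadd vE t\<theta>)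
    qed
    have norm_B: "(norm (T e (B x)))\<^sup>2 = inner (A (T e x)) (T e x)" if x: "x \<in> DB" for x
    proof -
      have "T e x \<in> DA"
      proof -
        have "vanishing (\<lambda>l. E l * 1)" "vanishing (\<lambda>l. E l * l)" by (intro vE tempered_intros)+
        then have "fc E x \<in> DA" using A_fc(1)[of E x] by (simp add: mult.commute)
        then show ?thesis using e by (simp add: T_eq_fc E_def[abs_def])
      qed
      then show ?thesis
        using inner_A_eq[OF _ B_T(1)[OF x e]] B_T(2)[OF x e] by (simp add: power2_norm_eq_inner)
    qed
    have vl: "vanishing (\<lambda>l. l * (E l * f l))" if "tempered f" for f
      using vE[OF tempered_mult[OF tempered_id that]] by (simp add: mult.left_commute)
    have Aw: "A (T e (w t)) = fc (\<lambda>l. l * ?a l) u0 + fc (\<lambda>l. l * ?b l) u1"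
      unfolding w_fc
      by (simp only: A_add A_fc[OF vab(1) vl[OF terr(1)]] A_fc[OF vab(2) vl[OF terr(2)]])
    have vE1: "vanishing E" using vE[OF tempered_const[of 1]] by simp
    have vE2: "vanishing (\<lambda>l. l * E l)" using vl[OF tempered_const[of 1]] by simp
    have sqE: "(norm (T e x))\<^sup>2 = inner (fc (\<lambda>l. E l * E l) x) x" for x
    proof -
      have "T e x = fc E x" using e by (simp add: T_eq_fc E_def[abs_def])
      then show ?thesis
        using fc_sym[OF vE1, of "fc E x" x] by (simp add: power2_norm_eq_inner fc_mult[OF vE1 vE1])
    qed
    have sqBE: "(norm (T e (B u0)))\<^sup>2 = inner (fc (\<lambda>l. E l * (l * E l)) u0) u0"
    proof -
      have "T e u0 = fc E u0" using e by (simp add: T_eq_fc E_def[abs_def])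
      then show ?thesis
        using norm_B[OF u0] A_fc(2)[OF vE1 vE2, of u0] fc_sym[OF vE1, of "fc (\<lambda>l. l * E l) u0" u0]
        by (simp add: fc_mult[OF vE1 vE2])
    qed
    let ?\<alpha> = "\<lambda>l. K * (E l * E l + E l * (l * E l)) - (?a l * ?a l + t * (?c l * ?c l + (l * ?a l) * ?a l))"
    let ?\<beta> = "\<lambda>l. (1/2) * (0 - ((?a l * ?b l + ?b l * ?a l) + t * ((?c l * ?d l + ?d l * ?c l) + ((l * ?a l) * ?b l + (l * ?b l) * ?a l))))"
    let ?\<gamma> = "\<lambda>l. K * (E l * E l) - (?b l * ?b l + t * (?d l * ?d l + (l * ?b l) * ?b l))"
    note vs = vanishing_add vanishing_diff vanishing_mult vanishing_cmult vab vl[OF terr(1)] vl[OF terr(2)]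
      vE1 vE2 vanishing_0
    have "0 \<le> inner (fc ?\<alpha> u0) u0 + 2 * inner (fc ?\<beta> u0) u1 + inner (fc ?\<gamma> u1) u1"
    proof (rule fc_form_nonneg)
      show "vanishing ?\<alpha>" "vanishing ?\<beta>" "vanishing ?\<gamma>" by (intro vs)+
      fix l \<xi> \<eta> :: real assume l: "0 \<le> l"
      let ?W = "err_A n t l * \<xi> + err_B n t l * \<eta>" and ?W' = "err_A' n t l * \<xi> + err_B' n t l * \<eta>"
      have "?W\<^sup>2 + t * (?W'\<^sup>2 + l * ?W\<^sup>2) \<le> K * ((1 + l) * \<xi>\<^sup>2 + \<eta>\<^sup>2)"
        using est l t unfolding scalar_estimate_def K_def by blast
      then have "0 \<le> (E l)\<^sup>2 * (K * ((1 + l) * \<xi>\<^sup>2 + \<eta>\<^sup>2) - (?W\<^sup>2 + t * (?W'\<^sup>2 + l * ?W\<^sup>2)))" by simp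
      also have "\<dots> = ?\<alpha> l * \<xi>\<^sup>2 + 2 * ?\<beta> l * \<xi> * \<eta> + ?\<gamma> l * \<eta>\<^sup>2"
        by (simp add: power2_eq_square algebra_simps)
      finally show "0 \<le> ?\<alpha> l * \<xi>\<^sup>2 + 2 * ?\<beta> l * \<xi> * \<eta> + ?\<gamma> l * \<eta>\<^sup>2" .
    qed
    also have "inner (fc ?\<alpha> u0) u0 + 2 * inner (fc ?\<beta> u0) u1 + inner (fc ?\<gamma> u1) u1
      = K * ((norm (T e u0))\<^sup>2 + (norm (T e (B u0)))\<^sup>2 + (norm (T e u1))\<^sup>2)
        - ((norm (T e (w t)))\<^sup>2 + t * ((norm (T e (u' t - V')))\<^sup>2 + (norm (T e (B (w t))))\<^sup>2))"
    proof -
      have fc0: "fc (\<lambda>l. 0) x = 0" for x using fc_cmult[OF vanishing_0, of 0 x] by simp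
      have F\<alpha>: "inner (fc ?\<alpha> u0) u0 = K * (inner (fc (\<lambda>l. E l * E l) u0) u0 + inner (fc (\<lambda>l. E l * (l * E l)) u0) u0)
         - (inner (fc (\<lambda>l. ?a l * ?a l) u0) u0 + t * (inner (fc (\<lambda>l. ?c l * ?c l) u0) u0 + inner (fc (\<lambda>l. (l * ?a l) * ?a l) u0) u0))"
        by (simp only: fc_diff fc_add fc_cmult vs inner_diff_left inner_add_left inner_scaleR_left)
      have F\<beta>: "2 * inner (fc ?\<beta> u0) u1 = - (inner (fc (\<lambda>l. ?a l * ?b l + ?b l * ?a l) u0) u1
         + t * (inner (fc (\<lambda>l. ?c l * ?d l + ?d l * ?c l) u0) u1 + inner (fc (\<lambda>l. (l * ?a l) * ?b l + (l * ?b l) * ?a l) u0) u1))"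
      proof -
        have "2 * ((1/2) * (inner 0 u1 - z)) = - z" for z :: real by simp
        then show ?thesis
          by (simp only: fc_diff[OF vanishing_0] fc_add fc_cmult vs fc0 inner_diff_left inner_add_left inner_scaleR_left)
      qed
      have F\<gamma>: "inner (fc ?\<gamma> u1) u1 = K * inner (fc (\<lambda>l. E l * E l) u1) u1
         - (inner (fc (\<lambda>l. ?b l * ?b l) u1) u1 + t * (inner (fc (\<lambda>l. ?d l * ?d l) u1) u1 + inner (fc (\<lambda>l. (l * ?b l) * ?b l) u1) u1))"
        by (simp only: fc_diff fc_add fc_cmult vs inner_diff_left inner_add_left inner_scaleR_left)
      show ?thesis
        unfolding F\<alpha> F\<beta> F\<gamma> sqE[of u0] sqE[of u1] sqBE norm_B[OF wDB] Aw
        unfolding w_fc w'_fc power2_norm_eq_inner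
          inner_fc_pair[OF vab(1,2,1,2)] inner_fc_pair[OF vab(3,4,3,4)]
          inner_fc_pair[OF vl[OF terr(1)] vl[OF terr(2)] vab(1,2)]
        by (simp only: distrib_left minus_add_distrib diff_conv_add_uminus ac_simps)
    qed
    finally show ?thesis by simp
  qed
  have "(norm (w t))\<^sup>2 + t * ((norm (u' t - V'))\<^sup>2 + (norm (B (w t)))\<^sup>2)
      \<le> K * ((norm u0)\<^sup>2 + (norm (B u0))\<^sup>2 + (norm u1)\<^sup>2)"
  proof (rule tendsto_le[OF trivial_limit_at_right_real])
    show "((\<lambda>e. (norm (T e (w t)))\<^sup>2 + t * ((norm (T e (u' t - V')))\<^sup>2 + (norm (T e (B (w t))))\<^sup>2)) \<longlongrightarrow>
       (norm (w t))\<^sup>2 + t * ((norm (u' t - V'))\<^sup>2 + (norm (B (w t)))\<^sup>2)) (at_right 0)"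
      by (intro tendsto_intros T_tendsto)
    show "((\<lambda>e. K * ((norm (T e u0))\<^sup>2 + (norm (T e (B u0)))\<^sup>2 + (norm (T e u1))\<^sup>2)) \<longlongrightarrow>
       K * ((norm u0)\<^sup>2 + (norm (B u0))\<^sup>2 + (norm u1)\<^sup>2)) (at_right 0)"
      by (intro tendsto_intros T_tendsto)
    show "\<forall>\<^sub>F e in at_right 0. (norm (T e (w t)))\<^sup>2 + t * ((norm (T e (u' t - V')))\<^sup>2 + (norm (T e (B (w t))))\<^sup>2)
      \<le> K * ((norm (T e u0))\<^sup>2 + (norm (T e (B u0)))\<^sup>2 + (norm (T e u1))\<^sup>2)"
      using eventually_at_right_less[of 0] by eventually_elim (rule smoothed)
  qed
  moreover have "energy B w t = (norm (u' t - V'))\<^sup>2 + (norm (B (w t)))\<^sup>2"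
    unfolding energy_def vector_derivative_at[OF dw] ..
  moreover have "(energy_space_norm B (u0, u1))\<^sup>2 = (norm u0)\<^sup>2 + (norm (B u0))\<^sup>2 + (norm u1)\<^sup>2"
    by (simp add: energy_space_norm_def sqrt_graph_norm_def)
  ultimately show ?thesis using dw wDB differentiableI_vector[OF dw] unfolding K_def by simp
qed

end

lemma admissible_constant_if_scalar_estimate:
  assumes "scalar_estimate n C"
  shows "admissible_constant TYPE('a::{real_inner,complete_space}) n C"
  unfolding admissible_constant_def Let_def
proof (intro allI impI)
  fix DA :: "'a set" and A DB B T u0 u1 u and t :: real
  assume "nonneg_selfadjoint DA A" "is_sqrt_operator DB B DA A" "heat_semigroup DA A T"
    and "(u0, u1) \<in> energy_space DB" and sol: "weak_solution DA A DB B u0 u1 u" and t: "1 \<le> t"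
  then interpret wave_operator DA A T DB B by unfold_locales
  have "u0 \<in> DB" using \<open>(u0, u1) \<in> energy_space DB\<close> by (simp add: energy_space_def)
  from scalar_estimate_transfers[OF assms this sol t]
  show "(\<lambda>s. u s - profile_sum A T u0 u1 n s) differentiable at t \<and>
    u t - profile_sum A T u0 u1 n t \<in> DB \<and>
    (norm (u t - profile_sum A T u0 u1 n t))\<^sup>2 + t * energy B (\<lambda>s. u s - profile_sum A T u0 u1 n s) t
      \<le> C * t powi (- 2 * int n) * (energy_space_norm B (u0, u1))\<^sup>2" .
qed

section \<open>Multiplication operators on the real line\<close>

text \<open>
  For a semigroup of bounded operators that is differentiable at \<open>0\<close> on the whole space, everything follows from the
  derivative, in any norm equivalent to the given one. It provides the semigroups on \<open>\<real>\<close> and \<open>\<real> \<times> \<real>\<close> that belong to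
  the scalar problem.
\<close>

lemma semigroup_generated_byI:
  fixes S :: "real \<Rightarrow> 'b::real_normed_vector \<Rightarrow> 'b"
  assumes lin: "\<And>t. 0 \<le> t \<Longrightarrow> bounded_linear (S t)" and S0: "\<And>x. S 0 x = x"
    and add: "\<And>s t x. 0 \<le> s \<Longrightarrow> 0 \<le> t \<Longrightarrow> S (s + t) x = S s (S t x)"
    and deriv: "\<And>x. ((\<lambda>t. S t x) has_vector_derivative G x) (at 0 within {0..})"
    and N: "\<And>x. norm x \<le> N x" "\<And>x. N x \<le> c * norm x"
  shows "semigroup_generated_by UNIV N S UNIV G"
proof -
  have c0: "0 \<le> c * norm x" for x :: 'b using order_trans[OF order_trans[OF norm_ge_zero N(1)] N(2)] .
  have N0: "0 \<le> N x" for x using order_trans[OF norm_ge_zero N(1)] .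
  have N_lim: "((\<lambda>h. N (f h)) \<longlongrightarrow> 0) F" if "(f \<longlongrightarrow> 0) F" for f :: "real \<Rightarrow> 'b" and F
  proof (rule Lim_null_comparison)
    show "\<forall>\<^sub>F h in F. norm (N (f h)) \<le> c * norm (f h)" using N(2) N0 by simp
    show "((\<lambda>h. c * norm (f h)) \<longlongrightarrow> 0) F" using tendsto_mult_left[OF tendsto_norm[OF that], of c] by simp
  qed
  have quotient: "((\<lambda>h. (1 / h) *\<^sub>R (S h x - x)) \<longlongrightarrow> G x) (at_right 0)" for x
  proof -
    have "((\<lambda>h. (1 / norm (h - 0)) *\<^sub>R (S h x - (S 0 x + (h - 0) *\<^sub>R G x))) \<longlongrightarrow> 0) (at 0 within {0..})"
      using deriv[of x] unfolding has_vector_derivative_def has_derivative_within by blast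
    then have "((\<lambda>h. (1 / norm (h - 0)) *\<^sub>R (S h x - (S 0 x + (h - 0) *\<^sub>R G x))) \<longlongrightarrow> 0) (at_right 0)"
      by (rule tendsto_within_subset) auto
    then have "((\<lambda>h. (1 / h) *\<^sub>R (S h x - x) - G x) \<longlongrightarrow> 0) (at_right 0)"
    proof (rule Lim_transform_eventually)
      show "\<forall>\<^sub>F h in at_right 0. (1 / norm (h - 0)) *\<^sub>R (S h x - (S 0 x + (h - 0) *\<^sub>R G x)) = (1 / h) *\<^sub>R (S h x - x) - G x"
        using eventually_at_right_less[of 0] by eventually_elim (simp add: S0 algebra_simps)
    qed
    then show ?thesis by (simp add: LIM_zero_iff)
  qed
  have "C0_semigroup UNIV N S"
    unfolding C0_semigroup_def linear_operator_on_def
  proof (intro conjI allI impI ballI)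
    fix t :: real and x y :: 'b and r :: real assume t: "0 \<le> t"
    interpret bounded_linear "S t" by (rule lin[OF t])
    show "S t (x + y) = S t x + S t y" "S t (r *\<^sub>R x) = r *\<^sub>R S t x" by (simp_all add: add scaleR)
    obtain K where K: "\<And>x. norm (S t x) \<le> norm x * K" using bounded by blast
    have "N (S t x) \<le> (\<bar>c\<bar> * \<bar>K\<bar>) * N x" for x
    proof -
      have "N (S t x) \<le> \<bar>c\<bar> * norm (S t x)"
        using N(2)[of "S t x"] by (rule order_trans) (simp add: mult_right_mono)
      also have "\<dots> \<le> \<bar>c\<bar> * (\<bar>K\<bar> * N x)"
      proof (rule mult_left_mono)
        have "norm (S t x) \<le> norm x * \<bar>K\<bar>" using K[of x] by (rule order_trans) (simp add: mult_left_mono)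
        also have "\<dots> \<le> N x * \<bar>K\<bar>" using N(1) by (rule mult_right_mono) simp
        finally show "norm (S t x) \<le> \<bar>K\<bar> * N x" by (simp add: mult.commute)
      qed simp
      finally show ?thesis by (simp add: mult.assoc)
    qed
    then show "\<exists>M. \<forall>x\<in>UNIV. N (S t x) \<le> M * N x" by blast
  next
    fix x
    have "((\<lambda>t. S t x) \<longlongrightarrow> S 0 x) (at 0 within {0..})"
      using has_vector_derivative_continuous[OF deriv[of x]] by (simp add: continuous_within)
    then have "((\<lambda>t. S t x) \<longlongrightarrow> x) (at_right 0)" unfolding S0 by (rule tendsto_within_subset) auto
    then show "((\<lambda>t. N (S t x - x)) \<longlongrightarrow> 0) (at_right 0)" by (intro N_lim) (simp add: LIM_zero_iff)
  qed (auto simp: S0 add)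
  moreover have "((\<lambda>h. N ((1 / h) *\<^sub>R (S h x - x) - y)) \<longlongrightarrow> 0) (at_right 0) \<longleftrightarrow> y = G x" for x y
  proof
    assume "((\<lambda>h. N ((1 / h) *\<^sub>R (S h x - x) - y)) \<longlongrightarrow> 0) (at_right 0)"
    then have "((\<lambda>h. (1 / h) *\<^sub>R (S h x - x) - y) \<longlongrightarrow> 0) (at_right 0)"
      by (rule Lim_null_comparison[rotated]) (simp add: N(1))
    then have "((\<lambda>h. (1 / h) *\<^sub>R (S h x - x)) \<longlongrightarrow> y) (at_right 0)" by (simp add: LIM_zero_iff)
    then show "y = G x" using quotient tendsto_unique trivial_limit_at_right_real by blast
  next
    assume "y = G x"
    then show "((\<lambda>h. N ((1 / h) *\<^sub>R (S h x - x) - y)) \<longlongrightarrow> 0) (at_right 0)"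
      using quotient[of x] by (intro N_lim) (simp add: LIM_zero_iff)
  qed
  then have "generator_graph UNIV N S = {(x, G x) |x. x \<in> UNIV}"
    unfolding generator_graph_def by auto
  ultimately show ?thesis unfolding semigroup_generated_by_def by blast
qed

lemma nonneg_selfadjoint_real_mult:
  assumes "0 \<le> l" shows "nonneg_selfadjoint UNIV (\<lambda>x::real. l * x)"
proof -
  have "z = l * y" if "\<forall>x. (l * x) * y = x * z" for y z :: real using that[rule_format, of 1] by simp
  then have "adjoint_graph UNIV (\<lambda>x::real. l * x) = {(x, l * x) |x. x \<in> UNIV}"
    by (auto simp: adjoint_graph_def)
  moreover have "0 \<le> inner (l * x) x" for x
    using mult_nonneg_nonneg[OF assms zero_le_square[of x]] by (simp add: mult.assoc)
  ultimately show ?thesis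
    unfolding nonneg_selfadjoint_def selfadjoint_operator_def linear_operator_on_def
    by (simp add: distrib_left mult.left_commute)
qed

lemma real_profile_sum:
  fixes x y l t :: real
  shows "profile_sum (\<lambda>z. l * z) (\<lambda>t z. exp (- t * l) * z) x y n t
    = theta 0 n t l * (x + y) + theta 1 (n - 1) t l * x"
proof -
  have A: "((\<lambda>z. l * z) ^^ m) v = l ^ m * v" for m v by (induction m) auto
  have tA: "((\<lambda>z. - (t *\<^sub>R (l * z))) ^^ j) v = (- (t * l)) ^ j * v" for j v by (induction j) auto
  have "profile (\<lambda>z. l * z) (\<lambda>t z. exp (- t * l) * z) x y m t
    = (exp (- t * l) * profile_coeff_sum m t l) * (x + y) - (exp (- t * l) * profile_coeff_pos m t l) * x" for m
  proof (cases "m = 0")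
    case True
    then show ?thesis by (simp add: profile_def profile_coeff_sum_def profile_coeff_pos_def profile_poly_def)
  next
    case False
    have s: "(\<Sum>j\<in>I. c j *\<^sub>R ((- (t * l)) ^ j * (exp (- t * l) * v))) = (\<Sum>j\<in>I. c j * (- (t * l)) ^ j) * (exp (- t * l) * v)"
      for I :: "nat set" and c v by (simp add: sum_distrib_right mult.assoc)
    show ?thesis
      unfolding profile_def tA A profile_coeff_sum_eq profile_coeff_pos_eq s using False by (simp add: algebra_simps)
  qed
  then have "profile_sum (\<lambda>z. l * z) (\<lambda>t z. exp (- t * l) * z) x y n t
     = (\<Sum>m<n. exp (- t * l) * profile_coeff_sum m t l) * (x + y) - (\<Sum>m<n. exp (- t * l) * profile_coeff_pos m t l) * x"
    by (simp only: profile_sum_def sum_subtractf sum_distrib_right)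
  then show ?thesis unfolding sum_profile_coeff by simp
qed

text \<open>
  Apply the hypothesis to multiplication by \<open>l\<close> on the Hilbert space \<open>\<real>\<close>, with the oscillator as weak solution.
\<close>

lemma scalar_estimate_if_admissible_constant:
  assumes adm: "admissible_constant TYPE(real) n C"
  shows "scalar_estimate n C"
  unfolding scalar_estimate_def
proof (intro allI impI)
  fix l t x y :: real assume l: "0 \<le> l" and t: "1 \<le> t"
  let ?A = "\<lambda>z::real. l * z" and ?B = "\<lambda>z::real. sqrt l * z"
  let ?T = "\<lambda>(t::real) (z::real). exp (- t * l) * z"
  define u where "u s = osc_p s l * x + osc_q s l * y" for s
  define u' where "u' s = - l * osc_q s l * x + (osc_p s l - osc_q s l) * y" for s
  define S :: "real \<Rightarrow> real \<times> real \<Rightarrow> real \<times> real" where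
    "S s v = (osc_p s l * fst v + osc_q s l * snd v, - l * osc_q s l * fst v + (osc_p s l - osc_q s l) * snd v)" for s v
  have sl: "0 \<le> sqrt l" "sqrt l * sqrt l = l" using l by simp_all
  have A: "nonneg_selfadjoint UNIV ?A" by (rule nonneg_selfadjoint_real_mult[OF l])
  have B: "is_sqrt_operator UNIV ?B UNIV ?A"
    unfolding is_sqrt_operator_def using nonneg_selfadjoint_real_mult[OF sl(1)] sl(2)
    by (simp add: mult.assoc[symmetric])
  have T: "heat_semigroup UNIV ?A ?T"
    unfolding heat_semigroup_def
  proof (rule semigroup_generated_byI[where c=1])
    show "bounded_linear (?T t)" for t by (rule bounded_linear_mult_right)
    show "((\<lambda>t. ?T t z) has_vector_derivative - (l * z)) (at 0 within {0..})" for z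
      unfolding has_real_derivative_iff_has_vector_derivative[symmetric]
      by (auto intro!: derivative_eq_intros)
  qed (auto simp: exp_add[symmetric] algebra_simps simp flip: mult.assoc)
  have W: "wave_semigroup UNIV ?A UNIV ?B S"
    unfolding wave_semigroup_def energy_space_def UNIV_Times_UNIV
  proof (rule semigroup_generated_byI[where c="1 + sqrt l"])
    show "bounded_linear (S t)" for t
      unfolding S_def
      by (intro bounded_linear_Pair bounded_linear_add bounded_linear_compose[OF bounded_linear_mult_right]
          bounded_linear_fst bounded_linear_snd)
    show "S 0 v = v" for v by (simp add: S_def osc_0)
    show "S (r + s) v = S r (S s v)" if "0 \<le> r" "0 \<le> s" for r s v
      unfolding S_def osc_add[OF l that] by (simp add: algebra_simps)
    show "((\<lambda>t. S t v) has_vector_derivative (\<lambda>(f, g). (g, - (l * f) - g)) v) (at 0 within {0..})" for v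
    proof -
      have "((\<lambda>t. osc_p t l * fst v + osc_q t l * snd v) has_real_derivative snd v) (at 0 within {0..})"
        "((\<lambda>t. - l * osc_q t l * fst v + (osc_p t l - osc_q t l) * snd v) has_real_derivative - (l * fst v) - snd v) (at 0 within {0..})"
        by (auto intro!: derivative_eq_intros osc_p_deriv osc_q_deriv simp: osc_0)
      then have "((\<lambda>t. S t v) has_vector_derivative (snd v, - (l * fst v) - snd v)) (at 0 within {0..})"
        unfolding S_def has_real_derivative_iff_has_vector_derivative
        by (rule has_vector_derivative_Pair)
      then show ?thesis by (simp add: case_prod_unfold)
    qed
    show "norm v \<le> energy_space_norm ?B v" for v
      by (cases v) (simp add: energy_space_norm_def sqrt_graph_norm_def norm_Pair)
    show "energy_space_norm ?B v \<le> (1 + sqrt l) * norm v" for v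
    proof (rule power2_le_imp_le)
      have "(energy_space_norm ?B v)\<^sup>2 = (1 + l) * (fst v)\<^sup>2 + (snd v)\<^sup>2"
        using l by (cases v) (simp add: energy_space_norm_def sqrt_graph_norm_def power_mult_distrib algebra_simps)
      also have "\<dots> \<le> (1 + sqrt l)\<^sup>2 * (fst v)\<^sup>2 + (1 + sqrt l)\<^sup>2 * (snd v)\<^sup>2"
      proof -
        have "(1 + sqrt l)\<^sup>2 = 1 + l + 2 * sqrt l" using l by (simp add: power2_eq_square algebra_simps)
        then have "1 + l \<le> (1 + sqrt l)\<^sup>2" "1 \<le> (1 + sqrt l)\<^sup>2" using l sl(1) by simp_all
        then show ?thesis
          using mult_right_mono[of 1 "(1 + sqrt l)\<^sup>2" "(snd v)\<^sup>2"] by (intro add_mono mult_right_mono) auto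
      qed
      also have "\<dots> = ((1 + sqrt l) * norm v)\<^sup>2"
        by (cases v) (simp add: norm_Pair power_mult_distrib distrib_left)
      finally show "(energy_space_norm ?B v)\<^sup>2 \<le> ((1 + sqrt l) * norm v)\<^sup>2" .
    qed (use l in simp)
  qed
  have du: "(u has_real_derivative u' s) (at s within R)" for s R
    unfolding u_def u'_def by (auto intro!: derivative_eq_intros osc_p_deriv osc_q_deriv)
  have du': "(u' has_real_derivative - l * u s - u' s) (at s within R)" for s R
    unfolding u_def u'_def by (auto intro!: derivative_eq_intros osc_p_deriv osc_q_deriv simp: algebra_simps)
  have "weak_solution UNIV ?A UNIV ?B x y u"
    unfolding weak_solution_def
  proof (intro exI[of _ u'] exI[of _ S] conjI allI impI W)
    show "(u has_vector_derivative u' s) (at s within {0..})" for s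
      using du unfolding has_real_derivative_iff_has_vector_derivative .
    show "continuous_on {0..} u'" by (rule DERIV_continuous_on[OF du'])
    show "((\<lambda>r. sqrt_graph_norm ?B (u r - u s)) \<longlongrightarrow> 0) (at s within {0..})" for s
    proof -
      have "((\<lambda>r. u r) \<longlongrightarrow> u s) (at s within {0..})"
        using DERIV_isCont[OF du[of s UNIV]] continuous_at_imp_continuous_at_within
        by (auto simp: isCont_def intro: tendsto_within_subset)
      then have "((\<lambda>r. sqrt ((norm (u r - u s))\<^sup>2 + (norm (sqrt l * (u r - u s)))\<^sup>2)) \<longlongrightarrow>
          sqrt ((norm (u s - u s))\<^sup>2 + (norm (sqrt l * (u s - u s)))\<^sup>2)) (at s within {0..})"
        by (intro tendsto_intros)
      then show ?thesis by (simp add: sqrt_graph_norm_def)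
    qed
    show "(u s, u' s) = S s (x, y)" for s by (simp add: S_def u_def u'_def)
  qed simp
  then have sol: "weak_solution UNIV ?A UNIV ?B x y u" .
  define w where "w s = u s - profile_sum ?A ?T x y n s" for s
  have xy: "(x, y) \<in> energy_space UNIV" by (simp add: energy_space_def)
  from adm[unfolded admissible_constant_def Let_def, rule_format, OF A B T xy sol t]
  have est: "(norm (w t))\<^sup>2 + t * energy ?B w t \<le> C * t powi (- 2 * int n) * (energy_space_norm ?B (x, y))\<^sup>2"
    unfolding w_def[abs_def] by blast
  have w: "w s = err_A n s l * x + err_B n s l * y" for s
    unfolding w_def u_def real_profile_sum err_A_def err_B_def by (simp add: algebra_simps)
  have "(w has_real_derivative err_A' n t l * x + err_B' n t l * y) (at t)"
    unfolding w[abs_def] by (auto intro!: derivative_eq_intros err_deriv)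
  then have "vector_derivative w (at t) = err_A' n t l * x + err_B' n t l * y"
    unfolding has_real_derivative_iff_has_vector_derivative by (rule vector_derivative_at)
  then have "energy ?B w t = (err_A' n t l * x + err_B' n t l * y)\<^sup>2 + l * (err_A n t l * x + err_B n t l * y)\<^sup>2"
    using l by (simp add: energy_def w power_mult_distrib)
  moreover have "(energy_space_norm ?B (x, y))\<^sup>2 = (1 + l) * x\<^sup>2 + y\<^sup>2"
    using l by (simp add: energy_space_norm_def sqrt_graph_norm_def power_mult_distrib algebra_simps)
  ultimately show "(err_A n t l * x + err_B n t l * y)\<^sup>2
      + t * ((err_A' n t l * x + err_B' n t l * y)\<^sup>2 + l * (err_A n t l * x + err_B n t l * y)\<^sup>2)
     \<le> C * t powi (- 2 * int n) * ((1 + l) * x\<^sup>2 + y\<^sup>2)"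
    using est by (simp add: w)
qed

theorem theorem1p1:
  "0 < C1 n \<and>
   (\<forall>DA (A :: 'a::{real_inner,complete_space} \<Rightarrow> 'a) DB B T u0 u1 u.
      nonneg_selfadjoint DA A \<longrightarrow> is_sqrt_operator DB B DA A \<longrightarrow> heat_semigroup DA A T \<longrightarrow>
      (u0, u1) \<in> energy_space DB \<longrightarrow> weak_solution DA A DB B u0 u1 u \<longrightarrow>
      (\<forall>t\<ge>1.
         let w = (\<lambda>s. u s - profile_sum A T u0 u1 n s) in
           w differentiable (at t) \<and> w t \<in> DB \<and>
           (norm (w t))\<^sup>2 + t * energy B w t
             \<le> C1 n * t powi (- 2 * int n) * (energy_space_norm B (u0, u1))\<^sup>2))"
proof -
  obtain C where "0 < C" "scalar_estimate n C" using exists_scalar_estimate by blast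
  then have "0 < C \<and> admissible_constant TYPE(real) n C"
    by (intro conjI admissible_constant_if_scalar_estimate)
  then have C1: "0 < C1 n \<and> admissible_constant TYPE(real) n (C1 n)"
    unfolding C1_def by (rule someI)
  have "admissible_constant TYPE('a) n (C1 n)"
    by (rule admissible_constant_if_scalar_estimate[OF scalar_estimate_if_admissible_constant[OF conjunct2[OF C1]]])
  then show ?thesis
    unfolding admissible_constant_def by (rule conjI[OF conjunct1[OF C1]])
qed

end
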